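(* Let $\mathcal{F}_{d,m}$ and $\mathcal{I}_{d,m}$ be, respectively, the classes of all normal and of all Ising undirected graphical models with respect to some unknown graph with $d$ vertices and $m$ edges. The minimax learning rates (in total variation distance, from $n$ i.i.d. samples) for $\mathcal{F}_{d,m}$ and $\mathcal{I}_{d,m}$ are both bounded from above by a constant factor of $\min\{1,\sqrt{(m+d)\log(d)/n}\}$, and bounded from below by a constant factor of $\min\{1,\sqrt{(m+d)/n}\}$. That is, there exist absolute constants $c,C>0$ such that $$c\min\left\{1,\sqrt{\frac{m+d}{n}}\right\}\le \mathcal{R}_n(\mathcal{F}_{d,m})\le C\min\left\{1,\sqrt{\frac{(m+d)\log (d)}{n}}\right\}$$ and $$c\min\left\{1,\sqrt{\frac{m+d}{n}}\right\}\le \mathcal{R}_n(\mathcal{I}_{d,m})\le C\min\left\{1,\sqrt{\frac{(m+d)\log (d)}{n}}\right\}.$$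
   Context: Here $d$ is a positive integer, $m$ is the number of edges of a graph on $d$ vertices, and $n$ is the number of samples. All graphs are undirected, without parallel edges or self-loops; $\log$ is the natural logarithm. Let $\mathcal{G}_{d,m}$ be the set of all labeled graphs with vertex set $\{1,\dots,d\}$ and $m$ edges. Normal graphical models. For $\mu \in \mathbb{R}^d$ and a (symmetric) positive definite $\Sigma \in \mathbb{R}^{d\times d}$, let $f_{\mu,\Sigma}(x) = \frac{\exp\{-\frac12 (x-\mu)^{\mathsf T}\Sigma^{-1}(x-\mu)\}}{(2\pi)^{d/2}\sqrt{\det \Sigma}}$ for $x\in\mathbb{R}^d$. For a graph $G=(\{1,\dots,d\},E)$, $\mathcal{F}_G$ is the class of all $f_{\mu,\Sigma}$ with $\mu\in\mathbb{R}^d$ and $\Sigma$ positive definite such that $(\Sigma^{-1})_{ij}=0$ whenever $i\ne j$ and $\{i,j\}\notin E$. Set $\mathcal{F}_{d,m}=\bigcup_{G\in\mathcal{G}_{d,m}}\mathcal{F}_G$. Ising models. For a graph $G=(\{1,\dots,d\},E)$, $\mathcal{I}_G$ is the class of all probability mass functions on $\{-1,1\}^d$ that assign to $x$ probability proportional to $\exp\{\sum_{\{i,j\}\in E} w_{ij}x_ix_j+\sum_{i=1}^d h_i x_i\}$ for some reals $w_{ij}$ ($\{i,j\}\in E$) and $h_i$ ($1\le i\le d$). Set $\mathcal{I}_{d,m}=\bigcup_{G\in\mathcal{G}_{d,m}}\mathcal{I}_G$. Minimax risk. Let $\mathcal{F}$ be a class of densities on $\mathcal{X}$, where either $\mathcal{X}=\mathbb{R}^d$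 (densities with respect to Lebesgue measure) or $\mathcal{X}=\{-1,1\}^d$ (probability mass functions). For $f,g:\mathcal{X}\to\mathbb{R}$, $\mathrm{TV}(f,g)=\frac12\|f-g\|_1$, where $\|\cdot\|_1$ is the $L^1$-norm with respect to Lebesgue, respectively counting, measure. An estimator is a (possibly randomized) map $\hat f:\mathcal{X}^n\to\mathbb{R}^{\mathcal{X}}$ applied to i.i.d. samples $X_1,\dots,X_n$ from an unknown $f\in\mathcal{F}$. Its risk is $\mathcal{R}_n(\hat f,\mathcal{F})=\sup_{f\in\mathcal{F}}\mathbf{E}\{\mathrm{TV}(\hat f,f)\}$, the expectation being over the $n$ i.i.d. samples from $f$ and any randomization of the estimator. The minimax rate for learning $\mathcal{F}$ is $\mathcal{R}_n(\mathcal{F})=\inf_{\hat f}\mathcal{R}_n(\hat f,\mathcal{F})$.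
   Formalization: The upper bounds are claimed only for d ≥ 2, since for d = 1 the right side is 0 (log 1 = 0) while the lower bound is positive; the lower bounds are claimed for all d ≥ 1. It is assumed that n ≥ 1 and m ≤ d(d−1)/2, so that the classes are non-empty. *)

theory Defs
  imports
    "HOL-Probability.Probability"
    "Jordan_Normal_Form.Determinant"
    "Jordan_Normal_Form.Gauss_Jordan_Elimination"
begin

text \<open>The \<open>d\<close> vertices are labelled \<open>0, \<dots>, d - 1\<close>, to agree with the index range of
  the matrices and vectors of \<^theory>\<open>Jordan_Normal_Form.Matrix\<close>.\<close>

definition graphs :: "nat \<Rightarrow> nat \<Rightarrow> nat set set set" where
  "graphs d m = {E. E \<subseteq> {e. e \<subseteq> {..<d} \<and> card e = 2} \<and> card E = m}"

definition pos_def_mat :: "nat \<Rightarrow> real mat \<Rightarrow> bool" where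
  "pos_def_mat d A \<longleftrightarrow> A \<in> carrier_mat d d \<and> transpose_mat A = A \<and>
     (\<forall>v \<in> carrier_vec d. v \<noteq> 0\<^sub>v d \<longrightarrow> scalar_prod v (A *\<^sub>v v) > 0)"

text \<open>The option type of \<^const>\<open>mat_inverse\<close> is harmless below: it is only applied to positive
  definite, hence invertible, matrices.\<close>

abbreviation inv_mat :: "real mat \<Rightarrow> real mat" where
  "inv_mat A \<equiv> the (mat_inverse A)"

text \<open>Points of \<open>d\<close>-space are functions on \<open>nat\<close> restricted to the index set \<open>{..<d}\<close>, as in
  the carrier of the product measure \<open>lborel_pow d\<close>, which is Lebesgue measure.\<close>

abbreviation lborel_pow :: "nat \<Rightarrow> (nat \<Rightarrow> real) measure" where
  "lborel_pow d \<equiv> PiM {..<d} (\<lambda>_. lborel)"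

definition mvn_density :: "nat \<Rightarrow> real vec \<Rightarrow> real mat \<Rightarrow> (nat \<Rightarrow> real) \<Rightarrow> real" where
  "mvn_density d \<mu> \<Sigma> x =
     exp (- (1/2) * scalar_prod (Matrix.vec d x - \<mu>) (inv_mat \<Sigma> *\<^sub>v (Matrix.vec d x - \<mu>)))
       / ((2 * pi) powr (real d / 2) * sqrt (Determinant.det \<Sigma>))"

definition normal_graph_class :: "nat \<Rightarrow> nat set set \<Rightarrow> ((nat \<Rightarrow> real) \<Rightarrow> real) set" where
  "normal_graph_class d E =
     {mvn_density d \<mu> \<Sigma> | \<mu> \<Sigma>.
        \<mu> \<in> carrier_vec d \<and> pos_def_mat d \<Sigma> \<and>
        (\<forall>i<d. \<forall>j<d. i \<noteq> j \<longrightarrow> {i, j} \<notin> E \<longrightarrow> inv_mat \<Sigma> $$ (i, j) = 0)}"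

definition normal_class :: "nat \<Rightarrow> nat \<Rightarrow> ((nat \<Rightarrow> real) \<Rightarrow> real) set" where
  "normal_class d m = (\<Union>E \<in> graphs d m. normal_graph_class d E)"

definition cube :: "nat \<Rightarrow> (nat \<Rightarrow> real) set" where
  "cube d = PiE {..<d} (\<lambda>_. {-1, 1})"

text \<open>An edge \<open>e = {i, j}\<close> has exactly two elements, so the product over \<open>e\<close> is \<open>x i * x j\<close>.\<close>

definition ising_weight ::
    "nat \<Rightarrow> nat set set \<Rightarrow> (nat set \<Rightarrow> real) \<Rightarrow> (nat \<Rightarrow> real) \<Rightarrow> (nat \<Rightarrow> real) \<Rightarrow> real" where
  "ising_weight d E w h x =
     exp ((\<Sum>e\<in>E. w e * (\<Prod>i\<in>e. x i)) + (\<Sum>i<d. h i * x i))"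

definition ising_pmf ::
    "nat \<Rightarrow> nat set set \<Rightarrow> (nat set \<Rightarrow> real) \<Rightarrow> (nat \<Rightarrow> real) \<Rightarrow> (nat \<Rightarrow> real) \<Rightarrow> real" where
  "ising_pmf d E w h x = ising_weight d E w h x / (\<Sum>y\<in>cube d. ising_weight d E w h y)"

definition ising_graph_class :: "nat \<Rightarrow> nat set set \<Rightarrow> ((nat \<Rightarrow> real) \<Rightarrow> real) set" where
  "ising_graph_class d E = {ising_pmf d E w h | w h. True}"

definition ising_class :: "nat \<Rightarrow> nat \<Rightarrow> ((nat \<Rightarrow> real) \<Rightarrow> real) set" where
  "ising_class d m = (\<Union>E \<in> graphs d m. ising_graph_class d E)"

text \<open>Throughout, \<open>M\<close> is the reference measure (Lebesgue or counting measure), whose space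
  is the sample space.  Distances and risks are extended nonnegative reals because an
  estimator may return arbitrary, possibly non-integrable, functions.\<close>

definition TV :: "'a measure \<Rightarrow> ('a \<Rightarrow> real) \<Rightarrow> ('a \<Rightarrow> real) \<Rightarrow> ennreal" where
  "TV M f g = (\<integral>\<^sup>+ x. ennreal \<bar>f x - g x\<bar> \<partial>M) / 2"

definition iid_samples :: "'a measure \<Rightarrow> nat \<Rightarrow> ('a \<Rightarrow> real) \<Rightarrow> (nat \<Rightarrow> 'a) measure" where
  "iid_samples M n f = PiM {..<n} (\<lambda>_. density M (\<lambda>x. ennreal (f x)))"

text \<open>A randomized estimator \<open>fhat\<close> maps a random seed, drawn from \<open>Q\<close> independently of the
  sample, and the sample to a function on the sample space.  Joint measurability makes its
  expected loss meaningful.\<close>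

definition estimator ::
    "'a measure \<Rightarrow> nat \<Rightarrow> real measure \<Rightarrow> (real \<Rightarrow> (nat \<Rightarrow> 'a) \<Rightarrow> 'a \<Rightarrow> real) \<Rightarrow> bool" where
  "estimator M n Q fhat \<longleftrightarrow> prob_space Q \<and>
     (\<lambda>((r, s), x). fhat r s x) \<in> borel_measurable ((Q \<Otimes>\<^sub>M PiM {..<n} (\<lambda>_. M)) \<Otimes>\<^sub>M M)"

definition risk ::
    "'a measure \<Rightarrow> nat \<Rightarrow> real measure \<Rightarrow> (real \<Rightarrow> (nat \<Rightarrow> 'a) \<Rightarrow> 'a \<Rightarrow> real) \<Rightarrow>
       ('a \<Rightarrow> real) set \<Rightarrow> ennreal" where
  "risk M n Q fhat F = (SUP f\<in>F. \<integral>\<^sup>+ (r, s). TV M (fhat r s) f \<partial>(Q \<Otimes>\<^sub>M iid_samples M n f))"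

definition minimax_risk :: "'a measure \<Rightarrow> nat \<Rightarrow> ('a \<Rightarrow> real) set \<Rightarrow> ennreal" where
  "minimax_risk M n F = Inf {risk M n Q fhat F | Q fhat. estimator M n Q fhat}"

end

theory Submission
  imports Defs
begin

text \<open>
  \<^bold>\<open>Upper bounds.\<close>  A normal or Ising density is the exponential of a linear combination of monomials
  of degree at most two, and its graph leaves at most \<open>2 * m + 2 * d + 1\<close> of them with nonzero
  coefficients.  For two densities \<open>f\<close> and \<open>g\<close> of the class, the set \<open>{f > g}\<close> is therefore a
  halfspace in the few monomials that occur in \<open>f\<close> or \<open>g\<close>, and there are at most
  \<open>d ^ (4 * m)\<close> pairs of graphs.  Linear functionals in \<open>V\<close> variables cut at most \<open>(k + 1) ^ V\<close>
  subsets out of \<open>k\<close> points (\<open>card_halfspace_traces_le\<close>), so these sets have polynomial growth,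
  with an entropy of order \<open>(m + d) * log d\<close>.

  The minimum distance estimator selects a density whose probabilities of all these sets are closest
  to the empirical frequencies.  Its error in total variation is at most twice the uniform deviation
  of the empirical measure over the sets, plus terms of order \<open>1 / n\<close> (\<open>TV_best_le\<close>).
  Symmetrization bounds the expected deviation by Rademacher averages
  (\<open>expected_deviation_le\<close>), and chaining bounds these by \<open>sqrt (entropy / n)\<close> without a further
  factor \<open>log n\<close> (\<open>rademacher_chaining\<close>).  The estimator may choose from a countable family
  because, by Scheffe's lemma, densities with coefficients in a countable dense set are dense in total
  variation (\<open>minimax_risk_exponential_family_le\<close>).  That the normal densities integrate to
  \<open>1\<close> is the normal integral \<open>nn_integral_gaussian\<close>.

  \<^bold>\<open>Lower bounds.\<close>  Both classes contain a family of hypotheses indexed by sign vectors \<open>\<tau>\<close>: the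
  tilts of a product measure (standard normal, or uniform on the cube) by \<open>exp (\<epsilon> * \<Sum>j. \<tau> j * \<xi> j)\<close>.
  Here the \<open>\<xi> j\<close> are either the \<open>d\<close> coordinates, which yields normal laws with shifted means and
  Ising models with external fields, or the products \<open>x a * x b\<close> over the edges of a complete
  bipartite graph with between \<open>m / 2\<close> and \<open>m\<close> edges, if \<open>m > d\<close>.
  Let \<open>k\<close> be the number of statistics.  For
  \<open>\<epsilon>\<close> of order \<open>1 / sqrt (max n k)\<close> the likelihood ratio of \<open>n\<close> samples has a second moment of
  at most \<open>(16/15) ^ k\<close>, while hypotheses whose signs disagree in at least \<open>k / 8\<close> places are
  separated in total variation by a multiple of \<open>\<epsilon> * sqrt k\<close> (\<open>tilt_separation\<close>).  Only a
  proportion \<open>(3/4) ^ k\<close> of the sign vectors is closer to a given one (\<open>card_near_signs\<close>), so no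
  estimator finds the right neighbourhood with probability above \<open>19/20\<close> under every hypothesis
  (\<open>minimax_risk_ge\<close>), and the risk is at least a multiple of \<open>\<epsilon> * sqrt k\<close>, that is, of \<open>min 1 (sqrt (k / n))\<close>.  Besides
  orthonormality of the statistics, all this rests on a single bound for exponential moments, which
  holds for all products of subgaussian laws (\<open>bipartite_mgf\<close>).
\<close>

section \<open>Shattering and sign patterns of linear functionals\<close>

definition shatters :: "'a set set \<Rightarrow> 'a set \<Rightarrow> bool" where
  "shatters T S \<longleftrightarrow> (\<forall>B\<subseteq>S. \<exists>A\<in>T. A \<inter> S = B)"

text \<open>Pajor's form of the Sauer-Shelah lemma.  After a point \<open>x\<close> is split off, the sets that contain
\<open>x\<close> and those that avoid it are two families on the remaining points, and their cardinalities
add up to those of the union and the intersection of the two families.  What the union shatters is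
shattered by \<open>T\<close>; what the intersection shatters stays shattered by \<open>T\<close> when \<open>x\<close> is added.\<close>

lemma card_le_card_shattered:
  assumes "finite U" "T \<subseteq> Pow U"
  shows "card T \<le> card {S. S \<subseteq> U \<and> shatters T S}"
  using assms
proof (induction U arbitrary: T rule: finite_induct)
  case empty
  show ?case
  proof (cases "T = {}")
    case False
    with empty have T: "T = {{}}" by auto
    have "{S. S \<subseteq> {} \<and> shatters T S} = {{}}" using T by (auto simp: shatters_def)
    then show ?thesis using T by simp
  qed simp
next
  case (insert x U)
  define T0 where "T0 = {A\<in>T. x \<notin> A}"
  define T1 where "T1 = (\<lambda>A. A - {x}) ` {A\<in>T. x \<in> A}"
  have fT: "finite T" using insert by (meson finite.insertI finite_Pow_iff finite_subset)
  have sub: "T0 \<union> T1 \<subseteq> Pow U" "T0 \<inter> T1 \<subseteq> Pow U"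
    using insert(4) by (auto simp: T0_def T1_def)
  have f01: "finite T0" "finite T1" using fT by (auto simp: T0_def T1_def)
  have inj: "inj_on (\<lambda>A. A - {x}) {A\<in>T. x \<in> A}"
    by (rule inj_onI) (metis (no_types, lifting) insert_Diff mem_Collect_eq)
  have "T = T0 \<union> {A\<in>T. x \<in> A}" by (auto simp: T0_def)
  then have "card T = card T0 + card {A\<in>T. x \<in> A}"
    using fT by (subst card_Un_disjoint[symmetric]) (auto simp: T0_def)
  also have "card {A\<in>T. x \<in> A} = card T1" unfolding T1_def using inj by (simp add: card_image)
  also have "card T0 + card T1 = card (T0 \<union> T1) + card (T0 \<inter> T1)"
    using card_Un_Int[OF f01] .
  also have "\<dots> \<le> card {S. S \<subseteq> U \<and> shatters (T0 \<union> T1) S} + card {S. S \<subseteq> U \<and> shatters (T0 \<inter> T1) S}"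
    using insert.IH[OF sub(1)] insert.IH[OF sub(2)] by linarith
  also have "card {S. S \<subseteq> U \<and> shatters (T0 \<inter> T1) S}
      = card (insert x ` {S. S \<subseteq> U \<and> shatters (T0 \<inter> T1) S})"
    by (rule card_image[symmetric], rule inj_onI)
       (use insert(2) in \<open>metis (no_types, lifting) insert_ident mem_Collect_eq subsetD\<close>)
  also have "card {S. S \<subseteq> U \<and> shatters (T0 \<union> T1) S} + \<dots>
      = card ({S. S \<subseteq> U \<and> shatters (T0 \<union> T1) S} \<union> insert x ` {S. S \<subseteq> U \<and> shatters (T0 \<inter> T1) S})"
    using insert(1,2) by (intro card_Un_disjoint[symmetric]) auto
  also have "\<dots> \<le> card {S. S \<subseteq> insert x U \<and> shatters T S}"
  proof (rule card_mono)
    show "finite {S. S \<subseteq> insert x U \<and> shatters T S}" using insert(1) by simp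
    have a: "shatters T S" if S: "S \<subseteq> U" "shatters (T0 \<union> T1) S" for S
      unfolding shatters_def
    proof (intro allI impI)
      fix B assume "B \<subseteq> S"
      then obtain A where A: "A \<in> T0 \<union> T1" "A \<inter> S = B" using S(2) unfolding shatters_def by blast
      have x: "x \<notin> S" using S(1) insert(2) by auto
      show "\<exists>A\<in>T. A \<inter> S = B"
        using A x unfolding T0_def T1_def by blast
    qed
    have b: "shatters T (insert x S)" if S: "S \<subseteq> U" "shatters (T0 \<inter> T1) S" for S
      unfolding shatters_def
    proof (intro allI impI)
      fix B assume B: "B \<subseteq> insert x S"
      have x: "x \<notin> S" using S(1) insert(2) by auto
      from B have "B - {x} \<subseteq> S" by auto
      then obtain A where A: "A \<in> T0 \<inter> T1" "A \<inter> S = B - {x}"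
        using S(2) unfolding shatters_def by blast
      show "\<exists>A\<in>T. A \<inter> insert x S = B"
      proof (cases "x \<in> B")
        case True
        from A(1) obtain A' where A': "A' \<in> T" "x \<in> A'" "A = A' - {x}" by (auto simp: T1_def)
        have "A' \<inter> insert x S = B" using A' A(2) True x by auto
        then show ?thesis using A' by auto
      next
        case False
        have "A \<in> T" "x \<notin> A" using A(1) by (auto simp: T0_def)
        moreover have "A \<inter> insert x S = B" using A(2) False \<open>x \<notin> A\<close> by auto
        ultimately show ?thesis by auto
      qed
    qed
    show "{S. S \<subseteq> U \<and> shatters (T0 \<union> T1) S} \<union> insert x ` {S. S \<subseteq> U \<and> shatters (T0 \<inter> T1) S}
        \<subseteq> {S. S \<subseteq> insert x U \<and> shatters T S}"
      using a b by auto
  qed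
  finally show ?case .
qed

lemma card_small_subsets_le:
  assumes "finite U"
  shows "finite {S. S \<subseteq> U \<and> card S \<le> V} \<and> card {S. S \<subseteq> U \<and> card S \<le> V} \<le> (card U + 1) ^ V"
proof (induction V)
  case 0
  have "{S. S \<subseteq> U \<and> card S \<le> 0} = {{}}" using assms finite_subset by fastforce
  then show ?case by simp
next
  case (Suc V)
  let ?X = "{S. S \<subseteq> U \<and> card S \<le> V}"
  let ?g = "\<lambda>(S, z). case z of None \<Rightarrow> S | Some a \<Rightarrow> insert a S"
  have sub: "{S. S \<subseteq> U \<and> card S \<le> Suc V} \<subseteq> ?g ` (?X \<times> (insert None (Some ` U)))"
  proof
    fix S assume "S \<in> {S. S \<subseteq> U \<and> card S \<le> Suc V}"
    then have S: "S \<subseteq> U" "card S \<le> Suc V" by auto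
    have fS: "finite S" using S assms finite_subset by auto
    show "S \<in> ?g ` (?X \<times> (insert None (Some ` U)))"
    proof (cases "card S \<le> V")
      case True
      then show ?thesis using S by (intro image_eqI[of _ _ "(S, None)"]) auto
    next
      case False
      then have "S \<noteq> {}" by auto
      then obtain a where a: "a \<in> S" by auto
      then show ?thesis using S fS
        by (intro image_eqI[of _ _ "(S - {a}, Some a)"]) (auto simp: card_Diff_singleton)
    qed
  qed
  have fin: "finite (?X \<times> (insert None (Some ` U)))" using Suc assms by auto
  have "card {S. S \<subseteq> U \<and> card S \<le> Suc V} \<le> card (?X \<times> (insert None (Some ` U)))"
    using card_mono[OF finite_imageI[OF fin] sub] card_image_le[OF fin] by (rule le_trans)
  also have "\<dots> = card ?X * (card U + 1)"
    using assms by (simp add: card_cartesian_product card_image card_insert_if image_iff)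
  also have "\<dots> \<le> (card U + 1) ^ V * (card U + 1)" using Suc by (intro mult_right_mono) auto
  finally show ?case using sub fin by (auto simp: mult.commute intro: finite_subset)
qed

text \<open>By induction on the number of equations: a pivot eliminates one equation and one unknown.\<close>

lemma linear_dependency:
  fixes a :: "'s \<Rightarrow> 'i \<Rightarrow> real"
  assumes "finite I" "finite S" "card I < card S"
  shows "\<exists>l. (\<exists>s\<in>S. l s \<noteq> 0) \<and> (\<forall>i\<in>I. (\<Sum>s\<in>S. l s * a s i) = 0)"
  using assms
proof (induction I arbitrary: S a rule: finite_induct)
  case empty
  then show ?case by (intro exI[of _ "\<lambda>_. 1"]) (auto simp: card_gt_0_iff)
next
  case (insert x I)
  show ?case
  proof (cases "\<forall>s\<in>S. a s x = 0")
    case True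
    have "card I < card S" using insert by simp
    from insert.IH[OF insert.prems(1) this, of a] True show ?thesis by auto
  next
    case False
    then obtain t where t: "t \<in> S" "a t x \<noteq> 0" by auto
    \<comment> \<open>eliminate coordinate \<open>x\<close> with the pivot row \<open>t\<close>\<close>
    define b where "b = (\<lambda>s i. a s i - a s x / a t x * a t i)"
    have "card I < card (S - {t})" using insert t by (simp add: card_Diff_singleton)
    from insert.IH[OF _ this, of b] insert.prems obtain l where
      l: "\<exists>s\<in>S - {t}. l s \<noteq> 0" "\<And>i. i \<in> I \<Longrightarrow> (\<Sum>s\<in>S - {t}. l s * b s i) = 0" by auto
    define l' where "l' = l(t := - (\<Sum>s\<in>S - {t}. l s * (a s x / a t x)))"
    have eq: "(\<Sum>s\<in>S. l' s * a s i) = (\<Sum>s\<in>S - {t}. l s * b s i)" for i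
    proof -
      have "(\<Sum>s\<in>S. l' s * a s i) = l' t * a t i + (\<Sum>s\<in>S - {t}. l' s * a s i)"
        using insert.prems(1) t by (simp add: sum.remove)
      also have "(\<Sum>s\<in>S - {t}. l' s * a s i) = (\<Sum>s\<in>S - {t}. l s * a s i)"
        by (rule sum.cong) (auto simp: l'_def)
      also have "l' t * a t i = - (\<Sum>s\<in>S - {t}. l s * (a s x / a t x) * a t i)"
        by (simp add: l'_def sum_distrib_right)
      finally show ?thesis by (simp add: b_def algebra_simps sum_subtractf)
    qed
    have "(\<Sum>s\<in>S - {t}. l s * b s x) = 0" using t by (auto simp: b_def intro!: sum.neutral)
    then have "\<forall>i\<in>insert x I. (\<Sum>s\<in>S. l' s * a s i) = 0" using eq l(2) by auto
    moreover have "\<exists>s\<in>S. l' s \<noteq> 0" using l(1) by (auto simp: l'_def)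
    ultimately show ?thesis by blast
  qed
qed

text \<open>Halfspaces shatter no set \<open>S\<close> with more than \<open>card I\<close> points: for a linear dependency
\<open>l\<close> among the vectors \<open>\<phi> s\<close>, with some positive coefficient after a change of sign, the halfspace that picks exactly the points with
\<open>l s > 0\<close> would make every product of \<open>l s\<close> with the value of the functional at \<open>s\<close>
nonnegative and at least one positive, although these products add up to \<open>0\<close>.\<close>

lemma card_halfspace_traces_le:
  fixes \<phi> :: "'a \<Rightarrow> 'i \<Rightarrow> real"
  assumes "finite I" "finite U"
  shows "card {{x\<in>U. (\<Sum>i\<in>I. \<theta> i * \<phi> x i) > 0} |\<theta>. True} \<le> (card U + 1) ^ card I"
proof -
  let ?T = "{{x\<in>U. (\<Sum>i\<in>I. \<theta> i * \<phi> x i) > 0} |\<theta>. True}"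
  have "card ?T \<le> card {S. S \<subseteq> U \<and> shatters ?T S}"
    by (rule card_le_card_shattered) (use assms in auto)
  also have "\<dots> \<le> card {S. S \<subseteq> U \<and> card S \<le> card I}"
  proof (rule card_mono)
    show "finite {S. S \<subseteq> U \<and> card S \<le> card I}" using card_small_subsets_le assms by blast
    have "card S \<le> card I" if S: "S \<subseteq> U" "shatters ?T S" for S
    proof (rule ccontr)
      assume "\<not> card S \<le> card I"
      then have lt: "card I < card S" by simp
      have fS: "finite S" using S(1) assms(2) finite_subset by auto
      from linear_dependency[OF assms(1) fS lt, of \<phi>] obtain l where
        l: "\<exists>s\<in>S. l s \<noteq> 0" "\<forall>i\<in>I. (\<Sum>s\<in>S. l s * \<phi> s i) = 0" by blast
      have main: False if l: "\<exists>s\<in>S. l s > 0" "\<forall>i\<in>I. (\<Sum>s\<in>S. l s * \<phi> s i) = 0" for l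
      proof -
        have "{s\<in>S. l s > 0} \<subseteq> S" by auto
        then obtain \<theta> where \<theta>: "{x\<in>U. (\<Sum>i\<in>I. \<theta> i * \<phi> x i) > 0} \<inter> S = {s\<in>S. l s > 0}"
          using S(2) unfolding shatters_def by blast
        have pos: "l s > 0 \<longleftrightarrow> (\<Sum>i\<in>I. \<theta> i * \<phi> s i) > 0" if "s \<in> S" for s
          using \<theta> that S(1) by blast
        have "(\<Sum>s\<in>S. l s * (\<Sum>i\<in>I. \<theta> i * \<phi> s i)) = (\<Sum>i\<in>I. \<theta> i * (\<Sum>s\<in>S. l s * \<phi> s i))"
          by (subst (2) sum_distrib_left, subst sum.swap) (simp add: sum_distrib_left mult.left_commute)
        also have "\<dots> = 0" using l(2) by simp
        finally have z: "(\<Sum>s\<in>S. l s * (\<Sum>i\<in>I. \<theta> i * \<phi> s i)) = 0" .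
        obtain s0 where s0: "s0 \<in> S" "l s0 > 0" using l(1) by auto
        have "(\<Sum>s\<in>S. l s * (\<Sum>i\<in>I. \<theta> i * \<phi> s i)) > 0"
        proof (rule sum_pos2[OF fS s0(1)])
          show "0 < l s0 * (\<Sum>i\<in>I. \<theta> i * \<phi> s0 i)" using s0 pos by simp
          show "0 \<le> l s * (\<Sum>i\<in>I. \<theta> i * \<phi> s i)" if "s \<in> S" for s
            using pos[OF that] by (cases "l s > 0") (auto simp: not_less intro: mult_nonpos_nonpos)
        qed
        with z show False by simp
      qed
      show False
      proof (cases "\<exists>s\<in>S. l s > 0")
        case True then show ?thesis using main l(2) by blast
      next
        case False
        then have "\<exists>s\<in>S. - l s > 0" using l(1) by (metis neg_0_less_iff_less linorder_neqE_linordered_idom)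
        moreover have "\<forall>i\<in>I. (\<Sum>s\<in>S. - l s * \<phi> s i) = 0" using l(2) by (simp add: sum_negf)
        ultimately show ?thesis using main[of "\<lambda>s. - l s"] by blast
      qed
    qed
    then show "{S. S \<subseteq> U \<and> shatters ?T S} \<subseteq> {S. S \<subseteq> U \<and> card S \<le> card I}" by blast
  qed
  also have "\<dots> \<le> (card U + 1) ^ card I" using card_small_subsets_le assms by blast
  finally show ?thesis .
qed

section \<open>Packing numbers and chaining of Rademacher averages\<close>

text \<open>A polynomial bound on the growth function.  The base \<open>card U + 1\<close> is cruder than the
\<open>e * card U / V\<close> of the Sauer bound; this costs a factor of order \<open>ln V\<close> in the entropy,
which the factor \<open>log d\<close> of the upper rate absorbs.\<close>

definition poly_growth :: "'a set set \<Rightarrow> real \<Rightarrow> nat \<Rightarrow> bool" where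
  "poly_growth \<A> L V \<longleftrightarrow>
     (\<forall>U. finite U \<longrightarrow> real (card ((\<lambda>A. A \<inter> U) ` \<A>)) \<le> L * (real (card U) + 1) ^ V)"

definition signs :: "'i set \<Rightarrow> ('i \<Rightarrow> real) set" where
  "signs J = PiE J (\<lambda>_. {-1, 1})"

text \<open>Up to a term linear in \<open>ln (1 / \<delta>)\<close>, a bound on the logarithm of the \<open>\<delta>\<close>-packing numbers
(in the normalized Hamming distance) of a family with polynomial growth.\<close>

definition growth_entropy :: "real \<Rightarrow> nat \<Rightarrow> real" where
  "growth_entropy L V = 2 * ln L + 2 * real V * ln (4 * real V)"

text \<open>A random \<open>k\<close>-tuple of indices misses the symmetric difference of a given pair with probability
at most \<open>(1 - \<delta>) ^ k\<close>.  By the union bound over the pairs some tuple tells all members of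
\<open>N\<close> apart, so \<open>N\<close> is no larger than its trace on that tuple.\<close>

lemma packing_card_le:
  fixes \<delta> :: real
  assumes grow: "poly_growth T L V" and N: "N \<subseteq> T" "finite N" "\<And>A. A \<in> T \<Longrightarrow> A \<subseteq> {..<n}"
    and L: "L \<ge> 0" and n: "n > 0" and \<delta>: "0 < \<delta>" "\<delta> \<le> 1"
    and sep: "\<And>A B. A \<in> N \<Longrightarrow> B \<in> N \<Longrightarrow> A \<noteq> B \<Longrightarrow> \<delta> * real n \<le> real (card (sym_diff A B))"
    and small: "real (card N)^2 * (1 - \<delta>) ^ k < 1"
  shows "real (card N) \<le> L * (real k + 1) ^ V"
proof -
  let ?X = "\<lambda>S. {xs::nat list. set xs \<subseteq> S \<and> length xs = k}"
  let ?P = "{(A, B) \<in> N \<times> N. A \<noteq> B}"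
  let ?bad = "\<lambda>(A, B). ?X ({..<n} - (sym_diff A B))"
  have fP: "finite ?P" using N by (auto intro: finite_subset[of _ "N \<times> N"])
  have avoid: "real (card (?X ({..<n} - D))) \<le> real n ^ k * (1 - \<delta>) ^ k"
    if D: "D \<subseteq> {..<n}" "\<delta> * real n \<le> real (card D)" for D
  proof -
    have le: "card D \<le> n" using card_mono[OF _ D(1)] by simp
    have "card ({..<n} - D) = n - card D"
      using card_Diff_subset[of D "{..<n}"] D(1) by (simp add: finite_subset)
    then have "real (card (?X ({..<n} - D))) = (real n - real (card D)) ^ k"
      using le by (simp add: card_lists_length_eq of_nat_diff)
    also have "\<dots> \<le> (real n * (1 - \<delta>)) ^ k"
      using D(2) le by (intro power_mono) (auto simp: algebra_simps)
    finally show ?thesis by (simp add: power_mult_distrib)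
  qed
  have cb: "real (card (?bad p)) \<le> real n ^ k * (1 - \<delta>) ^ k" if "p \<in> ?P" for p
  proof -
    obtain A B where p: "p = (A, B)" "A \<in> N" "B \<in> N" "A \<noteq> B" using \<open>p \<in> ?P\<close> by auto
    have "A \<subseteq> {..<n}" "B \<subseteq> {..<n}" using N(1,3) p by auto
    then show ?thesis using avoid[OF _ sep[OF p(2-4)]] p(1) by (simp only: prod.case) blast
  qed
  have "real (card (\<Union>p\<in>?P. ?bad p)) \<le> (\<Sum>p\<in>?P. real (card (?bad p)))"
    unfolding of_nat_sum[symmetric] of_nat_le_iff by (rule card_UN_le[OF fP])
  also have "\<dots> \<le> real (card ?P) * (real n ^ k * (1 - \<delta>) ^ k)"
    using sum_bounded_above[of ?P "\<lambda>p. real (card (?bad p))", OF cb] by simp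
  also have "\<dots> \<le> real (card N)^2 * (real n ^ k * (1 - \<delta>) ^ k)"
  proof (rule mult_right_mono)
    have "card ?P \<le> card (N \<times> N)" using N(2) by (intro card_mono) auto
    then have "real (card ?P) \<le> real (card (N \<times> N))" by (rule of_nat_mono)
    also have "\<dots> = real (card N)^2" by (simp add: card_cartesian_product power2_eq_square)
    finally show "real (card ?P) \<le> real (card N)^2" .
  qed (use \<delta> in auto)
  also have "\<dots> < real n ^ k"
    using mult_strict_left_mono[OF small, of "real n ^ k"] n by (simp add: mult_ac)
  also have "\<dots> = real (card (?X {..<n}))" by (simp add: card_lists_length_eq)
  finally have "card (\<Union>p\<in>?P. ?bad p) < card (?X {..<n})" by simp
  moreover have "finite (\<Union>p\<in>?P. ?bad p)"
    using fP by (auto intro!: finite_lists_length_eq)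
  ultimately have "\<not> ?X {..<n} \<subseteq> (\<Union>p\<in>?P. ?bad p)"
    using leD[OF card_mono] by blast
  then obtain xs where xs: "xs \<in> ?X {..<n}" "xs \<notin> (\<Union>p\<in>?P. ?bad p)" by blast
  have sepd: "\<not> set xs \<subseteq> {..<n} - (sym_diff A B)" if "A \<in> N" "B \<in> N" "A \<noteq> B" for A B
  proof
    assume "set xs \<subseteq> {..<n} - (sym_diff A B)"
    then have "xs \<in> ?bad (A, B)" using xs(1) by auto
    then show False using xs(2) that by blast
  qed
  have xs: "set xs \<subseteq> {..<n}" "length xs = k" using xs(1) by auto
  have inj: "inj_on (\<lambda>A. A \<inter> set xs) N"
  proof (rule inj_onI, rule ccontr)
    fix A B assume "A \<in> N" "B \<in> N" "A \<inter> set xs = B \<inter> set xs" "A \<noteq> B"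
    then show False using xs(1) sepd[of A B] by blast
  qed
  have "(\<lambda>A. A \<inter> set xs) ` T \<subseteq> Pow (set xs)" by auto
  then have "finite ((\<lambda>A. A \<inter> set xs) ` T)" by (rule finite_subset) simp
  then have "card N \<le> card ((\<lambda>A. A \<inter> set xs) ` T)"
    using card_image[OF inj] card_mono[OF _ image_mono[OF N(1)]] by metis
  then have "real (card N) \<le> L * (real (card (set xs)) + 1) ^ V"
    using grow unfolding poly_growth_def by (meson List.finite_set of_nat_mono order_trans)
  also have "\<dots> \<le> L * (real k + 1) ^ V"
    using L xs(2) card_length[of xs] by (intro mult_left_mono power_mono) auto
  finally show ?thesis .
qed

text \<open>With \<open>k\<close> of order \<open>ln (card N) / \<delta>\<close>, the preceding bound becomes an inequality
\<open>y \<le> ln L + V * ln (k + 1)\<close> for \<open>y = ln (card N)\<close> in which \<open>y\<close> also occurs, logarithmically,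
on the right; it is then solved for \<open>y\<close>.\<close>

lemma packing_entropy_le:
  fixes \<delta> :: real
  assumes grow: "poly_growth T L V" and N: "N \<subseteq> T" "finite N" "N \<noteq> {}" "\<And>A. A \<in> T \<Longrightarrow> A \<subseteq> {..<n}"
    and L: "L \<ge> 1" and V: "V \<ge> 1" and n: "n > 0" and \<delta>: "0 < \<delta>" "\<delta> \<le> 1"
    and sep: "\<And>A B. A \<in> N \<Longrightarrow> B \<in> N \<Longrightarrow> A \<noteq> B \<Longrightarrow> \<delta> * real n \<le> real (card (sym_diff A B))"
  shows "ln (card N) \<le> growth_entropy L V + 2 * real V * ln (1 / \<delta>)"
proof -
  define y where "y = ln (real (card N))"
  have cN: "card N \<ge> 1" using N by (simp add: Suc_leI card_gt_0_iff)
  then have y0: "y \<ge> 0" by (simp add: y_def)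
  have ey: "real (card N) = exp y" using cN by (simp add: y_def)
  \<comment> \<open>large enough for \<open>real (card N)^2 * (1 - \<delta>) ^ k < 1\<close>\<close>
  define k where "k = nat \<lceil>2 * y / \<delta>\<rceil> + 1"
  have k1: "2 * y / \<delta> < real k" unfolding k_def using y0 \<delta> by linarith
  have k2: "real k + 1 \<le> 2 * y / \<delta> + 3" unfolding k_def using y0 \<delta> by (simp, linarith?)
  have "(1 - \<delta>) ^ k \<le> exp (- \<delta>) ^ k" using \<delta> exp_ge_add_one_self[of "-\<delta>"] by (intro power_mono) auto
  also have "\<dots> = exp (- (\<delta> * k))" by (simp add: exp_of_nat_mult[symmetric] mult.commute)
  finally have "real (card N)^2 * (1 - \<delta>) ^ k \<le> exp y ^ 2 * exp (- (\<delta> * k))"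
    unfolding ey by (intro mult_left_mono) auto
  also have "\<dots> = exp (2 * y - \<delta> * k)" by (simp add: exp_diff exp_minus field_simps power2_eq_square exp_add[symmetric])
  also have "\<dots> < 1" using k1 \<delta> by (simp add: field_simps)
  finally have "real (card N) \<le> L * (real k + 1) ^ V"
    using packing_card_le[OF grow N(1,2,4) _ n \<delta> sep] L by auto
  also have "\<dots> \<le> L * ((2 * y + 3) / \<delta>) ^ V"
  proof (intro mult_left_mono power_mono)
    have "3 \<le> 3 / \<delta>" using \<delta> by (simp add: field_simps)
    then show "real k + 1 \<le> (2 * y + 3) / \<delta>" using k2 by (simp add: add_divide_distrib)
  qed (use L in auto)
  finally have *: "y \<le> ln (L * ((2 * y + 3) / \<delta>) ^ V)"
    unfolding y_def using cN by (subst ln_le_cancel_iff) (use L \<delta> y0 in \<open>auto simp: y_def intro!: mult_pos_pos divide_pos_pos zero_less_power\<close>)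
  have e: "ln (L * ((2 * y + 3) / \<delta>) ^ V) = ln L + V * (ln (2 * y + 3) + ln (1 / \<delta>))"
    using L \<delta> y0 by (simp add: ln_mult ln_realpow ln_div)
  \<comment> \<open>the tangent of \<open>ln\<close> at \<open>4 * V\<close> absorbs half of \<open>y\<close>\<close>
  have "ln ((2 * y + 3) / (4 * V)) \<le> (2 * y + 3) / (4 * V) - 1"
    using y0 V by (intro ln_le_minus_one) auto
  then have "ln (2 * y + 3) \<le> ln (4 * V) + ((2 * y + 3) / (4 * V) - 1)"
    using y0 V by (simp add: ln_div)
  then have "V * ln (2 * y + 3) \<le> V * (ln (4 * V) + ((2 * y + 3) / (4 * V) - 1))"
    by (intro mult_left_mono) auto
  also have "\<dots> = V * ln (4 * V) + (2 * y + 3) / 4 - V" using V by (simp add: field_simps)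
  also have "\<dots> \<le> V * ln (4 * V) + y / 2"
  proof -
    have "real V \<ge> 1" using V by simp
    then show ?thesis by (simp add: add_divide_distrib)
  qed
  finally have "V * ln (2 * y + 3) \<le> V * ln (4 * V) + y / 2" .
  with * e show ?thesis by (simp add: y_def[symmetric] growth_entropy_def algebra_simps)
qed

text \<open>Hoeffding's lemma for a fair sign.\<close>

lemma cosh_le_exp_square: "(exp x + exp (- x)) / 2 \<le> exp (x\<^sup>2 / 2)" for x :: real
proof -
  have main: "(exp x + exp (- x)) / 2 \<le> exp (x\<^sup>2 / 2)" if "x \<ge> 0" for x :: real
  proof -
    have p: "0 < 1 + (1/2) * (exp (2 * x) - 1)" by (simp add: algebra_simps add_pos_pos)
    have "- (2 * x) * (1/2) + ln (1 + (1/2) * (exp (2 * x) - 1)) \<le> (2 * x)\<^sup>2 / 8"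
      using Hoeffdings_lemma_aux[of "2 * x" "1/2"] that by simp
    then have "ln (1 + (1/2) * (exp (2 * x) - 1)) \<le> x + x\<^sup>2 / 2" by (simp add: power2_eq_square)
    then have "1 + (1/2) * (exp (2 * x) - 1) \<le> exp (x + x\<^sup>2 / 2)" using p by (metis exp_le_cancel_iff exp_ln)
    then have "exp (- x) * (1 + (1/2) * (exp (2 * x) - 1)) \<le> exp (- x) * exp (x + x\<^sup>2 / 2)"
      by (intro mult_left_mono) auto
    also have "\<dots> = exp (x\<^sup>2 / 2)" by (simp add: exp_add[symmetric])
    also have "exp (- x) * (1 + (1/2) * (exp (2 * x) - 1)) = (exp x + exp (- x)) / 2"
      by (simp add: algebra_simps exp_add[symmetric] mult_exp_exp add_divide_distrib)
    finally show ?thesis .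
  qed
  show ?thesis using main[of x] main[of "- x"] by (cases "x \<ge> 0") (auto simp: add.commute)
qed

lemma finite_signs: "finite J \<Longrightarrow> finite (signs J)"
  by (simp add: signs_def finite_PiE)

lemma card_signs: "finite J \<Longrightarrow> card (signs J) = 2 ^ card J"
  by (simp add: signs_def card_PiE flip: numeral_2_eq_2)

lemma sum_exp_signs_le:
  assumes "finite J"
  shows "(\<Sum>\<sigma>\<in>signs J. exp (\<Sum>i\<in>J. \<sigma> i * a i)) \<le> 2 ^ card J * exp ((\<Sum>i\<in>J. (a i)\<^sup>2) / 2)"
proof -
  have "(\<Sum>\<sigma>\<in>signs J. exp (\<Sum>i\<in>J. \<sigma> i * a i)) = (\<Sum>\<sigma>\<in>signs J. \<Prod>i\<in>J. exp (\<sigma> i * a i))"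
    using assms by (simp add: exp_sum)
  also have "\<dots> = (\<Prod>i\<in>J. \<Sum>s\<in>{-1, 1}. exp (s * a i))"
    unfolding signs_def using assms by (subst prod_sum_PiE) auto
  also have "\<dots> = (\<Prod>i\<in>J. exp (a i) + exp (- a i))" by (simp add: add.commute)
  also have "\<dots> \<le> (\<Prod>i\<in>J. 2 * exp ((a i)\<^sup>2 / 2))"
    using cosh_le_exp_square by (intro prod_mono) (auto simp: field_simps add_nonneg_nonneg)
  also have "\<dots> = 2 ^ card J * exp ((\<Sum>i\<in>J. (a i)\<^sup>2) / 2)"
    using assms by (simp add: prod.distrib exp_sum sum_divide_distrib)
  finally show ?thesis .
qed

text \<open>Massart's finite class lemma: the exponential of the maximum is at most the sum of the exponentials,
each of which is subgaussian with variance proxy \<open>v\<close>.\<close>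

lemma rademacher_max_le:
  assumes J: "finite J" and W: "finite W" "W \<noteq> {}" and v: "v > 0"
    and a: "\<And>w. w \<in> W \<Longrightarrow> (\<Sum>i\<in>J. (a w i)\<^sup>2) \<le> v"
  shows "(\<Sum>\<sigma>\<in>signs J. Max ((\<lambda>w. \<bar>\<Sum>i\<in>J. \<sigma> i * a w i\<bar>) ` W)) / 2 ^ card J
           \<le> sqrt (2 * v * ln (2 * card W))"
proof -
  let ?m = "\<lambda>\<sigma>. Max ((\<lambda>w. \<bar>\<Sum>i\<in>J. \<sigma> i * a w i\<bar>) ` W)"
  define l where "l = ln (2 * real (card W))"
  have cW: "card W \<ge> 1" using W by (simp add: Suc_leI card_gt_0_iff)
  have l: "l > 0" using cW by (simp add: l_def)
  \<comment> \<open>the minimizer of \<open>l / t + t * v / 2\<close>\<close>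
  define t where "t = sqrt (2 * l / v)"
  have t: "t > 0" using l v by (simp add: t_def)
  have t2: "t\<^sup>2 = 2 * l / v" using l v by (simp add: t_def)
  define c where "c = l + t\<^sup>2 * v / 2"
  \<comment> \<open>the tangent of \<open>exp\<close> at \<open>c\<close> takes the place of Jensen's inequality\<close>
  have pt: "exp c * (1 + t * ?m \<sigma> - c) \<le>
      (\<Sum>w\<in>W. exp (\<Sum>i\<in>J. \<sigma> i * (t * a w i)) + exp (\<Sum>i\<in>J. \<sigma> i * (- t * a w i)))" for \<sigma>
  proof -
    have "?m \<sigma> \<in> (\<lambda>w. \<bar>\<Sum>i\<in>J. \<sigma> i * a w i\<bar>) ` W" using W by (intro Max_in) auto
    then obtain w where w: "w \<in> W" "?m \<sigma> = \<bar>\<Sum>i\<in>J. \<sigma> i * a w i\<bar>" by auto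
    have "exp c * (1 + t * ?m \<sigma> - c) \<le> exp c * exp (t * ?m \<sigma> - c)"
      using exp_ge_add_one_self[of "t * ?m \<sigma> - c"] by (intro mult_left_mono) (linarith, simp)
    also have "\<dots> = exp (t * ?m \<sigma>)" by (simp add: exp_add[symmetric])
    also have "\<dots> \<le> exp (t * (\<Sum>i\<in>J. \<sigma> i * a w i)) + exp (- t * (\<Sum>i\<in>J. \<sigma> i * a w i))"
      unfolding w(2) by (cases "0 \<le> (\<Sum>i\<in>J. \<sigma> i * a w i)") (auto simp: abs_if)
    also have "\<dots> = exp (\<Sum>i\<in>J. \<sigma> i * (t * a w i)) + exp (\<Sum>i\<in>J. \<sigma> i * (- t * a w i))"
      by (simp add: sum_distrib_left mult.left_commute sum_negf)
    also have "\<dots> \<le> (\<Sum>w\<in>W. exp (\<Sum>i\<in>J. \<sigma> i * (t * a w i)) + exp (\<Sum>i\<in>J. \<sigma> i * (- t * a w i)))"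
      using w W by (intro member_le_sum) (auto intro: add_nonneg_nonneg)
    finally show ?thesis .
  qed
  have mgf: "(\<Sum>\<sigma>\<in>signs J. exp (\<Sum>i\<in>J. \<sigma> i * (s * a w i))) \<le> 2 ^ card J * exp (t\<^sup>2 * v / 2)"
    if "w \<in> W" "s\<^sup>2 = t\<^sup>2" for w s
  proof -
    have "(\<Sum>i\<in>J. (s * a w i)\<^sup>2) = t\<^sup>2 * (\<Sum>i\<in>J. (a w i)\<^sup>2)"
      by (simp add: power_mult_distrib sum_distrib_left that)
    also have "\<dots> \<le> t\<^sup>2 * v" using a[OF that(1)] by (intro mult_left_mono) auto
    finally have "2 ^ card J * exp ((\<Sum>i\<in>J. (s * a w i)\<^sup>2) / 2) \<le> 2 ^ card J * exp (t\<^sup>2 * v / 2)"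
      by simp
    with sum_exp_signs_le[OF J, of "\<lambda>i. s * a w i"] show ?thesis by (rule order_trans)
  qed
  have "(\<Sum>\<sigma>\<in>signs J. exp c * (1 + t * ?m \<sigma> - c)) \<le> (\<Sum>\<sigma>\<in>signs J. \<Sum>w\<in>W.
      exp (\<Sum>i\<in>J. \<sigma> i * (t * a w i)) + exp (\<Sum>i\<in>J. \<sigma> i * (- t * a w i)))"
    by (rule sum_mono) (rule pt)
  also have "\<dots> = (\<Sum>w\<in>W. (\<Sum>\<sigma>\<in>signs J. exp (\<Sum>i\<in>J. \<sigma> i * (t * a w i)))
      + (\<Sum>\<sigma>\<in>signs J. exp (\<Sum>i\<in>J. \<sigma> i * (- t * a w i))))"
    by (subst sum.swap) (simp add: sum.distrib)
  also have "\<dots> \<le> (\<Sum>w\<in>W. 2 ^ card J * exp (t\<^sup>2 * v / 2) + 2 ^ card J * exp (t\<^sup>2 * v / 2))"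
    by (intro sum_mono add_mono mgf) auto
  also have "\<dots> = 2 ^ card J * (2 * card W * exp (t\<^sup>2 * v / 2))" by simp
  also have "2 * card W * exp (t\<^sup>2 * v / 2) = exp c"
    using cW by (simp add: c_def l_def exp_add)
  also have "(\<Sum>\<sigma>\<in>signs J. exp c * (1 + t * ?m \<sigma> - c))
      = exp c * (2 ^ card J * (1 - c) + t * (\<Sum>\<sigma>\<in>signs J. ?m \<sigma>))"
    using J by (simp add: sum_distrib_left[symmetric] sum.distrib sum_subtractf card_signs algebra_simps)
  finally have "2 ^ card J * (1 - c) + t * (\<Sum>\<sigma>\<in>signs J. ?m \<sigma>) \<le> 2 ^ card J"
    by (simp add: mult.commute)
  then have "t * ((\<Sum>\<sigma>\<in>signs J. ?m \<sigma>) / 2 ^ card J) \<le> c"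
    by (simp add: field_simps)
  also have "c = t * sqrt (2 * v * l)"
  proof -
    have "t * sqrt (2 * v * l) = sqrt ((2 * l / v) * (2 * v * l))" by (simp only: t_def real_sqrt_mult)
    also have "(2 * l / v) * (2 * v * l) = (2 * l)\<^sup>2" using v by (simp add: field_simps power2_eq_square)
    also have "sqrt ((2 * l)\<^sup>2) = 2 * l" using l by (subst real_sqrt_abs) simp
    finally show ?thesis using l v by (simp add: c_def t2)
  qed
  finally show ?thesis using t unfolding l_def by (simp only: mult_le_cancel_left_pos of_nat_mult of_nat_numeral)
qed

text \<open>A separated subset of maximal cardinality is a covering, as any uncovered point could be added.\<close>

lemma exists_separated_net:
  fixes \<rho> :: "'b \<Rightarrow> 'b \<Rightarrow> real"
  assumes T: "finite T" "T \<noteq> {}"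
    and sym: "\<And>A B. \<rho> A B = \<rho> B A"
  shows "\<exists>N. N \<subseteq> T \<and> N \<noteq> {} \<and>
    (\<forall>A\<in>N. \<forall>B\<in>N. A \<noteq> B \<longrightarrow> r \<le> \<rho> A B) \<and>
    (\<forall>A\<in>T. A \<in> N \<or> (\<exists>B\<in>N. \<rho> A B < r))"
proof -
  let ?sep = "\<lambda>N. N \<subseteq> T \<and> (\<forall>A\<in>N. \<forall>B\<in>N. A \<noteq> B \<longrightarrow> r \<le> \<rho> A B)"
  have "?sep {}" by auto
  moreover have "\<forall>N. ?sep N \<longrightarrow> card N < Suc (card T)" using T by (auto simp: less_Suc_eq_le intro: card_mono)
  ultimately have "\<exists>N. ?sep N \<and> (\<forall>N'. ?sep N' \<longrightarrow> card N' \<le> card N)"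
    by (rule ex_has_greatest_nat[of ?sep "{}" card "Suc (card T)"])
  then obtain N where N: "?sep N" "\<And>N'. ?sep N' \<Longrightarrow> card N' \<le> card N" by auto
  have fN: "finite N" using N(1) T finite_subset by auto
  have cov: "A \<in> N \<or> (\<exists>B\<in>N. \<rho> A B < r)" if "A \<in> T" for A
  proof (rule ccontr)
    assume *: "\<not> ?thesis"
    then have "?sep (insert A N)" using N(1) that sym by (auto simp: not_less)
    from N(2)[OF this] * fN show False by auto
  qed
  have "N \<noteq> {}" using cov T by blast
  then show ?thesis using N(1) cov by (intro exI[of _ N]) simp
qed

text \<open>Chaining along nets at the scales \<open>(1/4) ^ j\<close>.  Passing from level \<open>j\<close> to the next one adds
Rademacher sums with at most \<open>(1/4) ^ j * n\<close> nonzero coefficients, and the logarithm of their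
number grows only linearly in \<open>j\<close>.  The increments are therefore dominated by \<open>(j + 1) / 2 ^ j\<close>,
which is summable; a union bound at a single scale would lose a factor \<open>ln n\<close>.  As soon as
\<open>(1/4) ^ j * n < 1\<close>, the net is the whole family.\<close>

lemma rademacher_chaining:
  assumes grow: "poly_growth T L V" and T: "T \<noteq> {}" "\<And>A. A \<in> T \<Longrightarrow> A \<subseteq> {..<n}"
    and L: "L \<ge> 1" and V: "V \<ge> 1" and n: "n > 0"
  shows "(\<Sum>\<sigma>\<in>signs {..<n}. Max ((\<lambda>A. \<bar>\<Sum>i<n. \<sigma> i * indicator A i\<bar>) ` T)) / 2 ^ n
           \<le> 16 * sqrt (n * growth_entropy L V)"
proof -
  define H where "H = growth_entropy L V"
  define R where "R = (\<lambda>\<sigma> A. \<Sum>i<n. \<sigma> i * indicat_real A i)"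
  have indic: "(\<Sum>i<n. indicat_real D i) = real (card D)" if "D \<subseteq> {..<n}" for D
    using that by (simp add: indicator_def sum.If_cases Int_absorb1 flip: Int_def)
  have fT: "finite T" using T(2) by (meson Pow_iff finite_Pow_iff finite_lessThan finite_subset subsetI)
  have V4: "2 * real V * ln 4 \<le> 2 * real V * ln (4 * real V)" using V by (intro mult_left_mono) auto
  have H1: "2 * real V * ln 4 \<le> H" using V4 ln_ge_zero[OF L] unfolding H_def growth_entropy_def by linarith
  have "ln 2 \<le> 1 * (2 * ln (4 :: real))" using ln_le_cancel_iff[of 2 "4 :: real"] ln_ge_zero[of "2 :: real"] by linarith
  also have "\<dots> \<le> real V * (2 * ln 4)" using V by (intro mult_right_mono) auto
  finally have H2: "ln 2 \<le> H" using H1 by (simp add: mult_ac)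
  have H0: "H > 0" using H2 by (smt (verit) ln_gt_zero)
  define d where "d = (\<lambda>A B :: nat set. real (card (sym_diff A B)))"
  define net where "net = (\<lambda>j N. N \<subseteq> T \<and> N \<noteq> {} \<and>
      (\<forall>A\<in>N. \<forall>B\<in>N. A \<noteq> B \<longrightarrow> (1/4)^j * real n \<le> d A B) \<and>
      (\<forall>A\<in>T. A \<in> N \<or> (\<exists>B\<in>N. d A B < (1/4)^j * real n)))"
  have "\<exists>N. net j N" for j
  proof -
    have "d A B = d B A" for A B by (simp add: d_def Un_commute)
    from exists_separated_net[OF fT T(1), of d, OF this] show ?thesis unfolding net_def .
  qed
  then have "net j (SOME N. net j N)" for j by (rule someI_ex)
  then obtain N where net: "\<And>j. net j (N j)" by (rule that)
  have N: "N j \<subseteq> T" "N j \<noteq> {}" for j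
    using net[of j] by (simp_all add: net_def)
  have N_sep: "(1/4)^j * real n \<le> real (card (sym_diff A B))" if "A \<in> N j" "B \<in> N j" "A \<noteq> B" for A B j
    using net[of j] that by (simp add: net_def d_def)
  have N_cover: "A \<in> N j \<or> (\<exists>B\<in>N j. real (card (sym_diff A B)) < (1/4)^j * real n)" if "A \<in> T" for A j
    using net[of j] that by (simp add: net_def d_def)
  have fN: "finite (N j)" for j using N(1) fT by (rule finite_subset)
  have ent: "ln (2 * card (N j)) \<le> 2 * H * (1 + real j)" for j
  proof -
    have c: "card (N j) \<ge> 1" using N(2) fN by (simp add: Suc_leI card_gt_0_iff)
    have "ln (card (N j)) \<le> H + 2 * real V * ln (1 / (1/4)^j)"
      unfolding H_def by (rule packing_entropy_le[OF grow N(1) fN N(2) T(2) L V n]) (auto simp: N_sep power_le_one)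
    also have "ln (1 / (1/4)^j :: real) = j * ln 4" by (simp add: ln_realpow power_one_over)
    also have "2 * real V * (j * ln 4) \<le> H * j" using mult_right_mono[OF H1, of "real j"] by (simp add: mult_ac)
    finally have "ln (card (N j)) \<le> H * (1 + real j)" by (simp add: algebra_simps)
    moreover have "H * 1 \<le> H * (1 + real j)" using H0 by (intro mult_left_mono) auto
    moreover have "ln (2 * card (N j)) = ln 2 + ln (card (N j))" using c by (simp add: ln_mult)
    ultimately show ?thesis using H2 by linarith
  qed
  define E where "E = (\<lambda>N. (\<Sum>\<sigma>\<in>signs {..<n}. Max ((\<lambda>A. \<bar>R \<sigma> A\<bar>) ` N)) / 2 ^ n)"
  have q: "sqrt (2 * ((4 * (1/4)^j) * real n) * (2 * H * (1 + real j))) \<le> 4 * sqrt (n * H) * ((1 + real j) / 2 ^ j)" for j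
  proof (rule real_le_lsqrt)
    have "2 * ((4 * (1/4)^j) * real n) * (2 * H * (1 + real j)) = 16 * (n * H) * ((1 + real j) / 4 ^ j)"
      by (simp add: power_one_over)
    also have "\<dots> \<le> 16 * (n * H) * ((1 + real j)\<^sup>2 / 4 ^ j)"
      using H0 by (intro mult_left_mono divide_right_mono) (auto simp: power2_eq_square)
    also have "\<dots> = (4 * sqrt (n * H) * ((1 + real j) / 2 ^ j))\<^sup>2"
      using H0 by (simp add: power_mult_distrib power_divide power_mult[symmetric] mult.commute[of j] power_mult)
    finally show "2 * ((4 * (1/4)^j) * real n) * (2 * H * (1 + real j)) \<le> (4 * sqrt (n * H) * ((1 + real j) / 2 ^ j))\<^sup>2" .
  qed (use H0 in auto)
  have max_bound: "sqrt (2 * v * ln (2 * card (N j))) \<le> 4 * sqrt (n * H) * ((1 + real j) / 2 ^ j)"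
    if "v = (4 * (1/4)^j) * real n" for v j
  proof -
    have "2 * v * ln (2 * card (N j)) \<le> 2 * v * (2 * H * (1 + real j))"
      using ent[of j] that by (intro mult_left_mono) auto
    then have "sqrt (2 * v * ln (2 * card (N j))) \<le> sqrt (2 * v * (2 * H * (1 + real j)))" by simp
    then show ?thesis using q[of j] unfolding that by linarith
  qed
  \<comment> \<open>\<open>4 - (j + 3) / 2 ^ j\<close> is the sum of \<open>(1 + i) / 2 ^ i\<close> over \<open>i \<le> j\<close>\<close>
  have E: "E (N j) \<le> 4 * sqrt (n * H) * (4 - (real j + 3) / 2 ^ j)" for j
  proof (induction j)
    case 0
    have "E (N 0) \<le> sqrt (2 * (4 * (1/4)^0 * n) * ln (2 * card (N 0)))"
      unfolding E_def R_def
    proof (rule rademacher_max_le[where J="{..<n}", unfolded card_lessThan])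
      have "(\<Sum>i<n. (indicat_real w i)\<^sup>2) \<le> (\<Sum>i<n. 1)" for w
        by (intro sum_mono) (simp add: indicator_def)
      then show "(\<Sum>i<n. (indicat_real w i)\<^sup>2) \<le> 4 * (1/4)^0 * real n" for w
        by (rule order_trans) simp
    qed (use fN N n in auto)
    also have "\<dots> \<le> 4 * sqrt (n * H) * ((1 + real 0) / 2 ^ 0)" by (rule max_bound) simp
    finally show ?case by simp
  next
    case (Suc j)
    have "\<exists>B\<in>N j. real (card (sym_diff A B)) \<le> (1/4)^j * real n" if "A \<in> N (Suc j)" for A
      using N_cover[of A j] that N(1)[of "Suc j"] by force
    then obtain p where p: "\<And>A. A \<in> N (Suc j) \<Longrightarrow> p A \<in> N j"
      "\<And>A. A \<in> N (Suc j) \<Longrightarrow> real (card (sym_diff A (p A))) \<le> (1/4)^j * real n" by metis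
    let ?a = "\<lambda>A i. indicat_real A i - indicat_real (p A) i"
    have "Max ((\<lambda>A. \<bar>R \<sigma> A\<bar>) ` N (Suc j)) \<le> Max ((\<lambda>A. \<bar>R \<sigma> A\<bar>) ` N j)
        + Max ((\<lambda>A. \<bar>\<Sum>i<n. \<sigma> i * ?a A i\<bar>) ` N (Suc j))" for \<sigma>
    proof (rule Max.boundedI)
      fix y assume "y \<in> (\<lambda>A. \<bar>R \<sigma> A\<bar>) ` N (Suc j)"
      then obtain A where A: "A \<in> N (Suc j)" "y = \<bar>R \<sigma> A\<bar>" by auto
      have "R \<sigma> A = R \<sigma> (p A) + (\<Sum>i<n. \<sigma> i * ?a A i)"
        unfolding R_def sum.distrib[symmetric] by (rule sum.cong) (auto simp: algebra_simps)
      then have "y \<le> \<bar>R \<sigma> (p A)\<bar> + \<bar>\<Sum>i<n. \<sigma> i * ?a A i\<bar>" using A by simp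
      also have "\<dots> \<le> Max ((\<lambda>A. \<bar>R \<sigma> A\<bar>) ` N j) + Max ((\<lambda>A. \<bar>\<Sum>i<n. \<sigma> i * ?a A i\<bar>) ` N (Suc j))"
        using A p(1) fN by (intro add_mono Max_ge) auto
      finally show "y \<le> \<dots>" .
    qed (use fN N in auto)
    then have "(\<Sum>\<sigma>\<in>signs {..<n}. Max ((\<lambda>A. \<bar>R \<sigma> A\<bar>) ` N (Suc j))) \<le>
       (\<Sum>\<sigma>\<in>signs {..<n}. Max ((\<lambda>A. \<bar>R \<sigma> A\<bar>) ` N j)
        + Max ((\<lambda>A. \<bar>\<Sum>i<n. \<sigma> i * ?a A i\<bar>) ` N (Suc j)))"
      by (intro sum_mono) auto
    then have "E (N (Suc j)) \<le> E (N j) +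
        (\<Sum>\<sigma>\<in>signs {..<n}. Max ((\<lambda>A. \<bar>\<Sum>i<n. \<sigma> i * ?a A i\<bar>) ` N (Suc j))) / 2 ^ n"
      unfolding E_def by (simp add: sum.distrib add_divide_distrib[symmetric] divide_right_mono)
    also have "(\<Sum>\<sigma>\<in>signs {..<n}. Max ((\<lambda>A. \<bar>\<Sum>i<n. \<sigma> i * ?a A i\<bar>) ` N (Suc j))) / 2 ^ n
        \<le> sqrt (2 * (4 * (1/4)^Suc j * n) * ln (2 * card (N (Suc j))))"
    proof (rule rademacher_max_le[where J="{..<n}", unfolded card_lessThan])
      fix A assume A: "A \<in> N (Suc j)"
      have sub: "A \<subseteq> {..<n}" "p A \<subseteq> {..<n}" using A p(1) N(1) T(2) by blast+
      have "(\<Sum>i<n. (?a A i)\<^sup>2) = (\<Sum>i<n. indicat_real (sym_diff A (p A)) i)"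
        by (rule sum.cong) (auto simp: indicator_def)
      also have "\<dots> = real (card (sym_diff A (p A)))"
        using sub by (subst indic) auto
      also have "\<dots> \<le> 4 * (1/4)^Suc j * n" using p(2)[OF A] by simp
      finally show "(\<Sum>i<n. (?a A i)\<^sup>2) \<le> 4 * (1/4)^Suc j * n" .
    qed (use fN N n in auto)
    also have "\<dots> \<le> 4 * sqrt (n * H) * ((1 + real (Suc j)) / 2 ^ Suc j)"
      by (rule max_bound) simp
    also have "E (N j) + \<dots> \<le> 4 * sqrt (n * H) * (4 - (real j + 3) / 2 ^ j)
        + 4 * sqrt (n * H) * ((1 + real (Suc j)) / 2 ^ Suc j)"
      using Suc by simp
    also have "\<dots> = 4 * sqrt (n * H) * (4 - (real (Suc j) + 3) / 2 ^ Suc j)"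
      by (simp add: field_simps)
    finally show ?case by simp
  qed
  obtain J where J: "(1/4)^J * real n < 1"
  proof -
    obtain J where "(1/4 :: real)^J < 1 / n" using real_arch_pow_inv[of "1 / n" "1/4"] n by auto
    then show ?thesis using n that by (simp add: field_simps)
  qed
  have "N J = T"
  proof
    show "T \<subseteq> N J"
    proof
      fix A assume A: "A \<in> T"
      show "A \<in> N J"
      proof (rule ccontr)
        assume "A \<notin> N J"
        then obtain B where B: "B \<in> N J" "real (card (sym_diff A B)) < (1/4)^J * real n"
          using N_cover[OF A, of J] by auto
        then have "card (sym_diff A B) = 0" using J by linarith
        moreover have "A \<subseteq> {..<n}" "B \<subseteq> {..<n}" using A B(1) N(1) T(2) by auto
        then have "finite (sym_diff A B)" using finite_subset[OF _ finite_lessThan] by simp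
        ultimately have "(A - B) \<union> (B - A) = {}" by (simp only: card_0_eq)
        then have "A = B" by blast
        with B \<open>A \<notin> N J\<close> show False by simp
      qed
    qed
  qed (rule N(1))
  then have "E T \<le> 4 * sqrt (n * H) * (4 - (real J + 3) / 2 ^ J)" using E[of J] by simp
  also have "\<dots> \<le> 4 * sqrt (n * H) * 4" using H0 by (intro mult_left_mono) auto
  finally show ?thesis by (simp add: E_def R_def H_def)
qed

section \<open>Uniform deviation of the empirical measure\<close>

text \<open>Transfers a growth bound from sets of points to the sets of sample indices that they pick out.\<close>

lemma poly_growth_index:
  assumes "poly_growth \<A> L V" "L \<ge> 0"
  shows "poly_growth ((\<lambda>A. {i\<in>I. z i \<in> A}) ` \<A>) L V"
  unfolding poly_growth_def
proof (intro allI impI)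
  fix U :: "'b set" assume U: "finite U"
  let ?W = "z ` (U \<inter> I)"
  have fW: "finite ?W" using U by simp
  have "(\<lambda>A. A \<inter> U) ` (\<lambda>A. {i\<in>I. z i \<in> A}) ` \<A> = (\<lambda>B. {i\<in>I \<inter> U. z i \<in> B}) ` (\<lambda>A. A \<inter> ?W) ` \<A>"
    unfolding image_image by (intro image_cong) auto
  moreover have "finite ((\<lambda>A. A \<inter> ?W) ` \<A>)"
    by (rule finite_subset[of _ "Pow ?W"]) (use fW in auto)
  ultimately have "card ((\<lambda>A. A \<inter> U) ` (\<lambda>A. {i\<in>I. z i \<in> A}) ` \<A>) \<le> card ((\<lambda>A. A \<inter> ?W) ` \<A>)"
    by (simp only: card_image_le)
  also have "real (card ((\<lambda>A. A \<inter> ?W) ` \<A>)) \<le> L * (real (card ?W) + 1) ^ V"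
    using assms(1) fW unfolding poly_growth_def by blast
  also have "\<dots> \<le> L * (real (card U) + 1) ^ V"
  proof (intro mult_left_mono power_mono)
    have "card ?W \<le> card (U \<inter> I)" using U by (intro card_image_le) auto
    also have "\<dots> \<le> card U" using U by (intro card_mono) auto
    finally show "real (card ?W) + 1 \<le> real (card U) + 1" by simp
  qed (use assms in auto)
  finally show "real (card ((\<lambda>A. A \<inter> U) ` (\<lambda>A. {i\<in>I. z i \<in> A}) ` \<A>)) \<le> L * (real (card U) + 1) ^ V"
    by simp
qed

lemma rademacher_average_le:
  assumes grow: "poly_growth (range A) L V" and L: "L \<ge> 1" and V: "V \<ge> 1" and n: "n > 0"
  shows "(\<Sum>\<sigma>\<in>signs {..<n}. SUP i. \<bar>\<Sum>j<n. \<sigma> j * indicat_real (A i) (z j)\<bar>) / 2 ^ n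
           \<le> 16 * sqrt (n * growth_entropy L V)"
proof -
  let ?T = "(\<lambda>A. {j\<in>{..<n}. z j \<in> A}) ` range A"
  have fT: "finite ?T" by (rule finite_subset[of _ "Pow {..<n}"]) auto
  have eq: "(SUP i. \<bar>\<Sum>j<n. \<sigma> j * indicat_real (A i) (z j)\<bar>) =
      Max ((\<lambda>B. \<bar>\<Sum>j<n. \<sigma> j * indicat_real B j\<bar>) ` ?T)" for \<sigma> :: "nat \<Rightarrow> real"
  proof -
    have "(\<Sum>j<n. \<sigma> j * indicat_real (A i) (z j)) = (\<Sum>j<n. \<sigma> j * indicat_real {j\<in>{..<n}. z j \<in> A i} j)" for i
      by (rule sum.cong) (auto simp: indicator_def)
    then have "range (\<lambda>i. \<bar>\<Sum>j<n. \<sigma> j * indicat_real (A i) (z j)\<bar>) = (\<lambda>B. \<bar>\<Sum>j<n. \<sigma> j * indicat_real B j\<bar>) ` ?T"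
      by (simp add: image_image)
    then show ?thesis using fT by (simp add: cSup_eq_Max)
  qed
  show ?thesis unfolding eq
    by (rule rademacher_chaining[OF poly_growth_index[OF grow]]) (use L V n in auto)
qed

lemma empirical_mean_bounds:
  "0 \<le> (\<Sum>j<n. indicat_real A (s j)) / real n" "(\<Sum>j<n. indicat_real A (s j)) / real n \<le> 1"
proof -
  have "(\<Sum>j<n. indicat_real A (s j)) \<le> (\<Sum>j<n. 1)" by (intro sum_mono) (auto simp: indicator_def)
  then show "(\<Sum>j<n. indicat_real A (s j)) / real n \<le> 1" by (simp add: divide_le_eq)
qed (intro divide_nonneg_nonneg sum_nonneg, auto)

locale empirical_process = prob_space P for P :: "'a measure" +
  fixes A :: "nat \<Rightarrow> 'a set" and n :: nat and L :: real and V :: nat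
  assumes A [measurable]: "\<And>i. A i \<in> sets P"
    and grow: "poly_growth (range A) L V" and L: "L \<ge> 1" and V: "V \<ge> 1" and n: "n > 0"
begin

definition deviation :: "(nat \<Rightarrow> 'a) \<Rightarrow> real" where
  "deviation s = (SUP i. \<bar>(\<Sum>j<n. indicator (A i) (s j)) / n - prob (A i)\<bar>)"

text \<open>The points \<open>z n, \<dots>, z (2 * n - 1)\<close> form the ghost sample.\<close>

definition ghost_sup :: "(nat \<Rightarrow> real) \<Rightarrow> (nat \<Rightarrow> 'a) \<Rightarrow> real" where
  "ghost_sup \<sigma> z = (SUP i. \<bar>\<Sum>j<n. \<sigma> j * (indicat_real (A i) (z j) - indicat_real (A i) (z (n + j)))\<bar>)"

lemma deviation_le_1: "\<bar>(\<Sum>j<n. indicat_real (A i) (s j)) / n - prob (A i)\<bar> \<le> 1"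
  using empirical_mean_bounds[where A = "A i" and s = s and n = n] prob_le_1[of "A i"] measure_nonneg[of P "A i"] by linarith

lemma bdd_deviation: "bdd_above (range (\<lambda>i. \<bar>(\<Sum>j<n. indicat_real (A i) (s j)) / n - prob (A i)\<bar>))"
  using deviation_le_1 by (intro bdd_aboveI2)

lemma deviation_upper: "\<bar>(\<Sum>j<n. indicat_real (A i) (s j)) / n - prob (A i)\<bar> \<le> deviation s"
  unfolding deviation_def by (rule cSUP_upper[OF UNIV_I bdd_deviation])

lemma deviation_bounds: "0 \<le> deviation s" "deviation s \<le> 1"
  using deviation_upper[of 0 s] deviation_le_1 unfolding deviation_def
  by (auto intro: cSUP_least order_trans[OF abs_ge_zero])

lemma ghost_le_n:
  assumes "\<sigma> \<in> signs {..<n}"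
  shows "\<bar>\<Sum>j<n. \<sigma> j * (indicat_real (A i) (z j) - indicat_real (A i) (z (n + j)))\<bar> \<le> n"
proof -
  have "\<bar>\<Sum>j<n. \<sigma> j * (indicat_real (A i) (z j) - indicat_real (A i) (z (n + j)))\<bar> \<le> (\<Sum>j<n. 1)"
    using assms by (intro order_trans[OF sum_abs] sum_mono) (force simp: signs_def indicator_def PiE_iff)
  then show ?thesis by simp
qed

lemma bdd_ghost:
  assumes "\<sigma> \<in> signs {..<n}"
  shows "bdd_above (range (\<lambda>i. \<bar>\<Sum>j<n. \<sigma> j * (indicat_real (A i) (z j) - indicat_real (A i) (z (n + j)))\<bar>))"
  using ghost_le_n[OF assms] by (intro bdd_aboveI2)

lemma ghost_upper:
  assumes "\<sigma> \<in> signs {..<n}"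
  shows "\<bar>\<Sum>j<n. \<sigma> j * (indicat_real (A i) (z j) - indicat_real (A i) (z (n + j)))\<bar> \<le> ghost_sup \<sigma> z"
  unfolding ghost_sup_def by (rule cSUP_upper[OF UNIV_I bdd_ghost[OF assms]])

lemma ghost_bounds:
  assumes "\<sigma> \<in> signs {..<n}"
  shows "0 \<le> ghost_sup \<sigma> z" "ghost_sup \<sigma> z \<le> n"
  using ghost_upper[OF assms, of 0 z] ghost_le_n[OF assms] unfolding ghost_sup_def
  by (auto intro: cSUP_least order_trans[OF abs_ge_zero])

abbreviation "iid I \<equiv> PiM I (\<lambda>_::nat. P)"

lemma prob_space_Pi: "prob_space (iid I)"
  by (rule prob_space_PiM) unfold_locales

lemma deviation_measurable [measurable]: "deviation \<in> borel_measurable (iid {..<n})"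
  unfolding deviation_def
  by (intro borel_measurable_cSUP countableI_type bdd_deviation) measurable

lemma ghost_measurable [measurable]:
  "\<sigma> \<in> signs {..<n} \<Longrightarrow> ghost_sup \<sigma> \<in> borel_measurable (iid {..<2 * n})"
  unfolding ghost_sup_def
  by (intro borel_measurable_cSUP countableI_type bdd_ghost) measurable

lemma sum_ghost_le:
  "(\<Sum>\<sigma>\<in>signs {..<n}. ghost_sup \<sigma> z) / 2 ^ n \<le> 32 * sqrt (n * growth_entropy L V)"
proof -
  let ?S = "\<lambda>\<sigma> z. SUP i. \<bar>\<Sum>j<n. \<sigma> j * indicat_real (A i) (z j)\<bar>"
  have bdd: "bdd_above (range (\<lambda>i. \<bar>\<Sum>j<n. \<sigma> j * indicat_real (A i) (z j)\<bar>))"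
    if "\<sigma> \<in> signs {..<n}" for \<sigma> and z :: "nat \<Rightarrow> 'a"
  proof (intro bdd_aboveI2)
    fix i
    show "\<bar>\<Sum>j<n. \<sigma> j * indicat_real (A i) (z j)\<bar> \<le> (\<Sum>j<n. 1)"
      using that by (intro order_trans[OF sum_abs] sum_mono) (force simp: signs_def indicator_def PiE_iff)
  qed
  have "ghost_sup \<sigma> z \<le> ?S \<sigma> z + ?S \<sigma> (\<lambda>j. z (n + j))" if \<sigma>: "\<sigma> \<in> signs {..<n}" for \<sigma>
    unfolding ghost_sup_def
  proof (rule cSUP_least)
    fix i
    have "(\<Sum>j<n. \<sigma> j * (indicat_real (A i) (z j) - indicat_real (A i) (z (n + j)))) =
       (\<Sum>j<n. \<sigma> j * indicat_real (A i) (z j)) - (\<Sum>j<n. \<sigma> j * indicat_real (A i) (z (n + j)))"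
      unfolding sum_subtractf[symmetric] by (rule sum.cong) (auto simp: algebra_simps)
    moreover have "\<bar>\<Sum>j<n. \<sigma> j * indicat_real (A i) (z j)\<bar> \<le> ?S \<sigma> z"
      by (rule cSUP_upper[OF UNIV_I bdd[OF \<sigma>]])
    moreover have "\<bar>\<Sum>j<n. \<sigma> j * indicat_real (A i) (z (n + j))\<bar> \<le> ?S \<sigma> (\<lambda>j. z (n + j))"
      by (rule cSUP_upper[OF UNIV_I bdd[OF \<sigma>]])
    ultimately show "\<bar>\<Sum>j<n. \<sigma> j * (indicat_real (A i) (z j) - indicat_real (A i) (z (n + j)))\<bar>
        \<le> ?S \<sigma> z + ?S \<sigma> (\<lambda>j. z (n + j))" by linarith
  qed simp
  then have "(\<Sum>\<sigma>\<in>signs {..<n}. ghost_sup \<sigma> z) \<le> (\<Sum>\<sigma>\<in>signs {..<n}. ?S \<sigma> z + ?S \<sigma> (\<lambda>j. z (n + j)))"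
    by (rule sum_mono)
  then have "(\<Sum>\<sigma>\<in>signs {..<n}. ghost_sup \<sigma> z) / 2 ^ n \<le>
     (\<Sum>\<sigma>\<in>signs {..<n}. ?S \<sigma> z) / 2 ^ n + (\<Sum>\<sigma>\<in>signs {..<n}. ?S \<sigma> (\<lambda>j. z (n + j))) / 2 ^ n"
    by (simp add: sum.distrib add_divide_distrib[symmetric] divide_right_mono)
  also have "\<dots> \<le> 16 * sqrt (n * growth_entropy L V) + 16 * sqrt (n * growth_entropy L V)"
    by (intro add_mono rademacher_average_le grow L V n)
  finally show ?thesis by simp
qed

lemma integrable_ghost:
  assumes "\<sigma> \<in> signs {..<n}"
  shows "integrable (iid {..<2 * n}) (ghost_sup \<sigma>)"
proof -
  interpret Z: prob_space "iid {..<2 * n}" by (rule prob_space_Pi)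
  show ?thesis using ghost_bounds[OF assms] ghost_measurable[OF assms]
    by (intro Z.integrable_const_bound[where B = n]) auto
qed

text \<open>Exchanging the \<open>j\<close>-th sample with the \<open>j\<close>-th ghost sample wherever \<open>\<sigma> j = -1\<close>
  preserves the product measure.\<close>

lemma ghost_swap:
  assumes \<sigma>: "\<sigma> \<in> signs {..<n}"
  shows "(\<integral>z. ghost_sup \<sigma> z \<partial>iid {..<2 * n}) = (\<integral>z. ghost_sup (\<lambda>j\<in>{..<n}. 1) z \<partial>iid {..<2 * n})"
proof -
  \<comment> \<open>the involution of the index set that exchanges \<open>k\<close> and \<open>n + k\<close> where \<open>\<sigma> k = -1\<close>\<close>
  define f where "f = (\<lambda>k. if k < n then (if \<sigma> k = 1 then k else n + k)
                           else if k < 2 * n then (if \<sigma> (k - n) = 1 then k else k - n) else k)"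
  have one: "(\<lambda>j\<in>{..<n}. 1) \<in> signs {..<n}" by (auto simp: signs_def)
  have inj: "inj_on f {..<2 * n}" unfolding f_def by (rule inj_onI) (auto split: if_splits)
  have fI: "f \<in> {..<2 * n} \<rightarrow> {..<2 * n}" by (auto simp: f_def)
  have D: "distr (iid {..<2 * n}) (iid {..<2 * n}) (\<lambda>\<omega>. \<lambda>k\<in>{..<2 * n}. \<omega> (f k)) = iid {..<2 * n}"
    by (rule distr_PiM_reindex[OF _ inj fI]) unfold_locales
  have pt: "ghost_sup (\<lambda>j\<in>{..<n}. 1) (\<lambda>k\<in>{..<2 * n}. z (f k)) = ghost_sup \<sigma> z" for z
  proof -
    have "(\<Sum>j<n. (\<lambda>j\<in>{..<n}. 1) j * (indicat_real (A i) ((\<lambda>k\<in>{..<2 * n}. z (f k)) j)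
          - indicat_real (A i) ((\<lambda>k\<in>{..<2 * n}. z (f k)) (n + j))))
       = (\<Sum>j<n. \<sigma> j * (indicat_real (A i) (z j) - indicat_real (A i) (z (n + j))))" for i
    proof (rule sum.cong)
      fix j assume j: "j \<in> {..<n}"
      have "\<sigma> j = -1 \<or> \<sigma> j = 1" using \<sigma> j by (auto simp: signs_def PiE_iff)
      then show "(\<lambda>j\<in>{..<n}. 1) j * (indicat_real (A i) ((\<lambda>k\<in>{..<2 * n}. z (f k)) j)
          - indicat_real (A i) ((\<lambda>k\<in>{..<2 * n}. z (f k)) (n + j)))
          = \<sigma> j * (indicat_real (A i) (z j) - indicat_real (A i) (z (n + j)))"
        using j by (auto simp: f_def)
    qed simp
    then show ?thesis unfolding ghost_sup_def by simp
  qed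
  have m: "(\<lambda>\<omega>. \<lambda>k\<in>{..<2 * n}. \<omega> (f k)) \<in> iid {..<2 * n} \<rightarrow>\<^sub>M iid {..<2 * n}"
    using fI by (intro measurable_restrict measurable_component_singleton) auto
  have "(\<integral>z. ghost_sup (\<lambda>j\<in>{..<n}. 1) z \<partial>iid {..<2 * n}) =
        (\<integral>z. ghost_sup (\<lambda>j\<in>{..<n}. 1) z \<partial>distr (iid {..<2 * n}) (iid {..<2 * n}) (\<lambda>\<omega>. \<lambda>k\<in>{..<2 * n}. \<omega> (f k)))"
    unfolding D ..
  also have "\<dots> = (\<integral>z. ghost_sup (\<lambda>j\<in>{..<n}. 1) (\<lambda>k\<in>{..<2 * n}. z (f k)) \<partial>iid {..<2 * n})"
    by (rule integral_distr[OF m ghost_measurable[OF one]])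
  finally show ?thesis by (simp add: pt)
qed

text \<open>The integral equals its average over all sign vectors, because exchanging samples preserves the
law; for fixed points this average is a Rademacher average.\<close>

lemma ghost_integral_le:
  "(\<integral>z. ghost_sup (\<lambda>j\<in>{..<n}. 1) z \<partial>iid {..<2 * n}) \<le> 32 * sqrt (n * growth_entropy L V)"
proof -
  interpret Z: prob_space "iid {..<2 * n}" by (rule prob_space_Pi)
  let ?I = "\<integral>z. ghost_sup (\<lambda>j\<in>{..<n}. 1) z \<partial>iid {..<2 * n}"
  have "?I = (\<Sum>\<sigma>\<in>signs {..<n}. ?I) / 2 ^ n" by (simp add: card_signs)
  also have "(\<Sum>\<sigma>\<in>signs {..<n}. ?I) = (\<Sum>\<sigma>\<in>signs {..<n}. \<integral>z. ghost_sup \<sigma> z \<partial>iid {..<2 * n})"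
    by (intro sum.cong refl ghost_swap[symmetric])
  also have "\<dots> = (\<integral>z. (\<Sum>\<sigma>\<in>signs {..<n}. ghost_sup \<sigma> z) \<partial>iid {..<2 * n})"
    by (intro Bochner_Integration.integral_sum[symmetric] integrable_ghost)
  also have "\<dots> / 2 ^ n = (\<integral>z. (\<Sum>\<sigma>\<in>signs {..<n}. ghost_sup \<sigma> z) / 2 ^ n \<partial>iid {..<2 * n})" by simp
  also have "\<dots> \<le> (\<integral>z. 32 * sqrt (n * growth_entropy L V) \<partial>iid {..<2 * n})"
    by (intro integral_mono sum_ghost_le integrable_divide Bochner_Integration.integrable_sum integrable_ghost) auto
  finally show ?thesis by (simp add: Z.prob_space del: restrict_apply)
qed

text \<open>Symmetrization: integrating over an independent ghost sample turns \<open>prob (A i)\<close> into an empirical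
frequency, so the expected deviation is at most the expected supremum of the differences of two
empirical frequencies.\<close>

theorem expected_deviation_le:
  "(\<integral>s. deviation s \<partial>iid {..<n}) \<le> 32 * sqrt (growth_entropy L V / n)"
proof -
  let ?J = "{n..<2 * n}"
  interpret S: prob_space "iid {..<n}" by (rule prob_space_Pi)
  interpret Y: prob_space "iid ?J" by (rule prob_space_Pi)
  interpret Z: prob_space "iid {..<2 * n}" by (rule prob_space_Pi)
  interpret PP: product_sigma_finite "\<lambda>_::nat. P" by unfold_locales
  let ?one = "\<lambda>j\<in>{..<n}. 1 :: real"
  have one: "?one \<in> signs {..<n}" by (auto simp: signs_def)
  have un: "{..<n} \<union> ?J = {..<2 * n}" by auto
  have m: "(\<lambda>(s, y). merge {..<n} ?J (s, y)) \<in> iid {..<n} \<Otimes>\<^sub>M iid ?J \<rightarrow>\<^sub>M iid {..<2 * n}"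
    using measurable_merge[of "{..<n}" ?J "\<lambda>_. P"] unfolding un by simp
  let ?g = "\<lambda>s y. ghost_sup ?one (merge {..<n} ?J (s, y))"
  have gm: "(\<lambda>(s, y). ?g s y) \<in> borel_measurable (iid {..<n} \<Otimes>\<^sub>M iid ?J)"
    using measurable_compose[OF m ghost_measurable[OF one]] by (simp add: case_prod_beta')
  have gi: "integrable (iid ?J) (?g s)" if "s \<in> space (iid {..<n})" for s
  proof (rule Y.integrable_const_bound[where B = n])
    show "?g s \<in> borel_measurable (iid ?J)"
      using measurable_compose[OF measurable_Pair1'[OF that] gm] by simp
  qed (use ghost_bounds[OF one] in auto)
  have pt: "n * deviation s \<le> (\<integral>y. ?g s y \<partial>iid ?J)" if s: "s \<in> space (iid {..<n})" for s
  proof -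
    have "\<bar>(\<Sum>j<n. indicat_real (A i) (s j)) / n - prob (A i)\<bar> \<le> (\<integral>y. ?g s y \<partial>iid ?J) / n" for i
    proof -
      have e: "(\<integral>y. indicat_real (A i) (y (n + j)) \<partial>iid ?J) = prob (A i)"
        "integrable (iid ?J) (\<lambda>y. indicat_real (A i) (y (n + j)))" if "j < n" for j
      proof -
        have c: "n + j \<in> ?J" using that by simp
        have cm: "(\<lambda>y. y (n + j)) \<in> iid ?J \<rightarrow>\<^sub>M P" using measurable_component_singleton[OF c] .
        have "(\<integral>y. indicat_real (A i) (y (n + j)) \<partial>iid ?J) = (\<integral>x. indicat_real (A i) x \<partial>distr (iid ?J) P (\<lambda>y. y (n + j)))"
          by (rule integral_distr[OF cm, symmetric]) simp
        also have "distr (iid ?J) P (\<lambda>y. y (n + j)) = P"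
          by (rule distr_PiM_component[OF _ c]) unfold_locales
        finally show "(\<integral>y. indicat_real (A i) (y (n + j)) \<partial>iid ?J) = prob (A i)" by simp
        show "integrable (iid ?J) (\<lambda>y. indicat_real (A i) (y (n + j)))"
          using measurable_compose[OF cm, of "indicat_real (A i)" borel]
          by (intro Y.integrable_const_bound[where B = 1]) (auto simp: indicator_def)
      qed
      let ?d = "\<lambda>y. (\<Sum>j<n. indicat_real (A i) (s j) - indicat_real (A i) (y (n + j)))"
      have di: "integrable (iid ?J) ?d" by (intro Bochner_Integration.integrable_sum Bochner_Integration.integrable_diff e) auto
      have "(\<integral>y. ?d y \<partial>iid ?J) = (\<Sum>j<n. indicat_real (A i) (s j) - prob (A i))"
        using e by (subst Bochner_Integration.integral_sum)
          (auto intro!: sum.cong simp: Y.prob_space)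
      also have "\<dots> = n * ((\<Sum>j<n. indicat_real (A i) (s j)) / n - prob (A i))"
        using n by (simp add: sum_subtractf field_simps)
      finally have "n * \<bar>(\<Sum>j<n. indicat_real (A i) (s j)) / n - prob (A i)\<bar> = \<bar>\<integral>y. ?d y \<partial>iid ?J\<bar>"
        by (simp add: abs_mult)
      also have "\<dots> \<le> (\<integral>y. \<bar>?d y\<bar> \<partial>iid ?J)" by (rule integral_abs_bound)
      also have "\<dots> \<le> (\<integral>y. ?g s y \<partial>iid ?J)"
      proof (rule integral_mono[OF _ gi[OF s]])
        fix y
        have "?d y = (\<Sum>j<n. ?one j * (indicat_real (A i) (merge {..<n} ?J (s, y) j)
            - indicat_real (A i) (merge {..<n} ?J (s, y) (n + j))))"
          by (rule sum.cong) (auto simp: merge_def)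
        then show "\<bar>?d y\<bar> \<le> ?g s y" using ghost_upper[OF one] by simp
      qed (use di in auto)
      finally show ?thesis using n by (simp add: field_simps)
    qed
    then have "deviation s \<le> (\<integral>y. ?g s y \<partial>iid ?J) / n"
      unfolding deviation_def by (intro cSUP_least) auto
    then show ?thesis using n by (simp add: field_simps)
  qed
  have gpair: "integrable (iid {..<2 * n}) (ghost_sup ?one)" by (rule integrable_ghost[OF one])
  have fold: "(\<integral>z. ghost_sup ?one z \<partial>iid {..<2 * n}) = (\<integral>s. (\<integral>y. ?g s y \<partial>iid ?J) \<partial>iid {..<n})"
  proof -
    have "{..<n} \<inter> ?J = {}" by auto
    from PP.product_integral_fold[OF this, of "ghost_sup ?one"] gpair show ?thesis unfolding un by simp
  qed
  have "n * (\<integral>s. deviation s \<partial>iid {..<n}) = (\<integral>s. n * deviation s \<partial>iid {..<n})" by simp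
  also have "\<dots> \<le> (\<integral>s. (\<integral>y. ?g s y \<partial>iid ?J) \<partial>iid {..<n})"
  proof (rule integral_mono[OF _ _ pt])
    have "integrable (iid {..<n}) deviation"
      using deviation_bounds by (intro S.integrable_const_bound[where B = 1]) auto
    then show "integrable (iid {..<n}) (\<lambda>s. n * deviation s)" by simp
    have "(\<integral>y. ?g s y \<partial>iid ?J) \<le> n" if "s \<in> space (iid {..<n})" for s
    proof -
      have "(\<integral>y. ?g s y \<partial>iid ?J) \<le> (\<integral>y. n \<partial>iid ?J)"
        using ghost_bounds[OF one] by (intro integral_mono gi that) auto
      then show ?thesis by (simp add: Y.prob_space)
    qed
    moreover have "0 \<le> (\<integral>y. ?g s y \<partial>iid ?J)" for s
      using ghost_bounds[OF one] by (intro Bochner_Integration.integral_nonneg) auto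
    ultimately show "integrable (iid {..<n}) (\<lambda>s. \<integral>y. ?g s y \<partial>iid ?J)"
      by (intro S.integrable_const_bound[where B = n] Y.borel_measurable_lebesgue_integral[OF gm]) auto
  qed
  also have "\<dots> \<le> 32 * sqrt (n * growth_entropy L V)"
    using ghost_integral_le unfolding fold .
  finally have "(\<integral>s. deviation s \<partial>iid {..<n}) \<le> 32 * (sqrt (n * growth_entropy L V) / n)"
    using n by (simp add: field_simps)
  also have "sqrt (n * growth_entropy L V) / n = sqrt (growth_entropy L V / n)"
    using n by (simp add: real_sqrt_mult real_sqrt_divide field_simps)
  finally show ?thesis .
qed

end

section \<open>Total variation distance and the minimum distance estimator\<close>

definition prob_density :: "'a measure \<Rightarrow> ('a \<Rightarrow> real) \<Rightarrow> bool" where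
  "prob_density M f \<longleftrightarrow> f \<in> borel_measurable M \<and> (\<forall>x\<in>space M. 0 \<le> f x) \<and>
     (\<integral>\<^sup>+ x. ennreal (f x) \<partial>M) = 1"

lemma prob_densityD:
  assumes "prob_density M f"
  shows "f \<in> borel_measurable M" "\<And>x. x \<in> space M \<Longrightarrow> 0 \<le> f x" "(\<integral>\<^sup>+ x. ennreal (f x) \<partial>M) = 1"
    "integrable M f" "integral\<^sup>L M f = 1" "prob_space (density M (\<lambda>x. ennreal (f x)))"
proof -
  show m: "f \<in> borel_measurable M" and nn: "\<And>x. x \<in> space M \<Longrightarrow> 0 \<le> f x"
    and i: "(\<integral>\<^sup>+ x. ennreal (f x) \<partial>M) = 1"
    using assms by (auto simp: prob_density_def)
  have AE: "AE x in M. 0 \<le> f x" using nn by auto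
  show int: "integrable M f" using integrableI_nonneg[OF m AE] i by simp
  show "integral\<^sup>L M f = 1" using nn_integral_eq_integral[OF int AE] i
    by (metis enn2real_ennreal enn2real_1 integral_nonneg_AE AE)
  show "prob_space (density M (\<lambda>x. ennreal (f x)))"
    using m i by (intro prob_spaceI) (simp add: emeasure_density cong: nn_integral_cong)
qed

lemma TV_commute: "TV M f g = TV M g f"
  by (simp add: TV_def abs_minus_commute)

lemma TV_triangle:
  assumes [measurable]: "f \<in> borel_measurable M" "g \<in> borel_measurable M" "h \<in> borel_measurable M"
  shows "TV M f h \<le> TV M f g + TV M g h"
proof -
  have "(\<integral>\<^sup>+ x. ennreal \<bar>f x - h x\<bar> \<partial>M) \<le> (\<integral>\<^sup>+ x. ennreal \<bar>f x - g x\<bar> + ennreal \<bar>g x - h x\<bar> \<partial>M)"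
    by (intro nn_integral_mono) (simp flip: ennreal_plus)
  also have "\<dots> = (\<integral>\<^sup>+ x. ennreal \<bar>f x - g x\<bar> \<partial>M) + (\<integral>\<^sup>+ x. ennreal \<bar>g x - h x\<bar> \<partial>M)"
    by (intro nn_integral_add) auto
  finally show ?thesis unfolding TV_def
    by (metis add_divide_distrib_ennreal divide_right_mono_ennreal)
qed

lemma TV_eq_integral:
  assumes "prob_density M f" "prob_density M g"
  shows "TV M f g = ennreal ((\<integral>x. \<bar>f x - g x\<bar> \<partial>M) / 2)"
proof -
  note prob_densityD(4)[OF assms(1), THEN Bochner_Integration.integrable_diff, OF prob_densityD(4)[OF assms(2)]]
  then have "(\<integral>\<^sup>+ x. ennreal \<bar>f x - g x\<bar> \<partial>M) = ennreal (\<integral>x. \<bar>f x - g x\<bar> \<partial>M)"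
    by (intro nn_integral_eq_integral) auto
  then show ?thesis by (simp add: TV_def ennreal_divide_numeral)
qed

lemma measure_prob_density:
  assumes "prob_density M f" "A \<in> sets M"
  shows "measure (density M (\<lambda>x. ennreal (f x))) A = (\<integral>x. f x * indicator A x \<partial>M)"
proof -
  note f = prob_densityD[OF assms(1)]
  have "integrable M (\<lambda>x. f x * indicator A x)" by (rule integrable_real_mult_indicator[OF assms(2) f(4)])
  then have "(\<integral>\<^sup>+ x. ennreal (f x * indicator A x) \<partial>M) = ennreal (\<integral>x. f x * indicator A x \<partial>M)"
    using f(2) by (intro nn_integral_eq_integral) auto
  moreover have "(\<integral>\<^sup>+ x. ennreal (f x * indicator A x) \<partial>M) = (\<integral>\<^sup>+ x. ennreal (f x) * indicator A x \<partial>M)"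
    by (intro nn_integral_cong) (auto simp: indicator_def)
  moreover have "0 \<le> (\<integral>x. f x * indicator A x \<partial>M)"
    using f(2) by (intro integral_nonneg_AE AE_I2) auto
  ultimately show ?thesis using f(1) assms(2) by (simp add: measure_def emeasure_density)
qed

lemma measure_diff_le_TV:
  assumes f: "prob_density M f" and g: "prob_density M g" and A: "A \<in> sets M"
  shows "\<bar>measure (density M (\<lambda>x. ennreal (f x))) A - measure (density M (\<lambda>x. ennreal (g x))) A\<bar>
           \<le> (\<integral>x. \<bar>f x - g x\<bar> \<partial>M) / 2"
    and "A = {x\<in>space M. f x > g x} \<Longrightarrow>
      measure (density M (\<lambda>x. ennreal (f x))) A - measure (density M (\<lambda>x. ennreal (g x))) A
           = (\<integral>x. \<bar>f x - g x\<bar> \<partial>M) / 2"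
proof -
  note F = prob_densityD[OF f] and G = prob_densityD[OF g]
  have i: "integrable M (\<lambda>x. f x - g x)" using F G by simp
  let ?h = "\<lambda>x. f x - g x"
  have iA: "integrable M (\<lambda>x. f x * indicator A x)" "integrable M (\<lambda>x. g x * indicator A x)"
    "integrable M (\<lambda>x. \<bar>?h x\<bar> * indicator A x)"
    by (rule integrable_real_mult_indicator[OF A]; use F G i in simp)+
  have e: "measure (density M (\<lambda>x. ennreal (f x))) A - measure (density M (\<lambda>x. ennreal (g x))) A
      = (\<integral>x. ?h x * indicator A x \<partial>M)"
    using iA by (simp add: measure_prob_density[OF f A] measure_prob_density[OF g A] algebra_simps)
  \<comment> \<open>\<open>f - g\<close> integrates to \<open>0\<close>, so \<open>2 * (f - g) * 1_A\<close> may be replaced by \<open>(f - g) * (2 * 1_A - 1)\<close>\<close>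
  have z: "(\<integral>x. ?h x \<partial>M) = 0" using F G by simp
  have ih: "integrable M (\<lambda>x. ?h x * indicator A x)"
    by (rule integrable_real_mult_indicator[OF A i])
  have t: "2 * (\<integral>x. ?h x * indicator A x \<partial>M) = (\<integral>x. ?h x * (2 * indicator A x - 1) \<partial>M)"
  proof -
    have "(\<integral>x. ?h x * (2 * indicator A x - 1) \<partial>M) = (\<integral>x. 2 * (?h x * indicator A x) - ?h x \<partial>M)"
      by (intro Bochner_Integration.integral_cong) (auto simp: algebra_simps)
    also have "\<dots> = 2 * (\<integral>x. ?h x * indicator A x \<partial>M) - (\<integral>x. ?h x \<partial>M)"
      using ih i by (subst Bochner_Integration.integral_diff) auto
    finally show ?thesis using z by simp
  qed
  have "\<bar>\<integral>x. ?h x * (2 * indicator A x - 1) \<partial>M\<bar> \<le> (\<integral>x. \<bar>?h x * (2 * indicator A x - 1)\<bar> \<partial>M)"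
    by (rule integral_abs_bound)
  also have "\<dots> = (\<integral>x. \<bar>?h x\<bar> \<partial>M)"
    by (intro Bochner_Integration.integral_cong) (auto simp: abs_mult indicator_def)
  finally show "\<bar>measure (density M (\<lambda>x. ennreal (f x))) A - measure (density M (\<lambda>x. ennreal (g x))) A\<bar>
           \<le> (\<integral>x. \<bar>?h x\<bar> \<partial>M) / 2"
    using e t by linarith
  assume A': "A = {x\<in>space M. f x > g x}"
  have "(\<integral>x. ?h x * (2 * indicator A x - 1) \<partial>M) = (\<integral>x. \<bar>?h x\<bar> \<partial>M)"
    by (intro Bochner_Integration.integral_cong) (auto simp: A' indicator_def)
  then show "measure (density M (\<lambda>x. ennreal (f x))) A - measure (density M (\<lambda>x. ennreal (g x))) A
           = (\<integral>x. \<bar>?h x\<bar> \<partial>M) / 2"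
    using e t by linarith
qed

text \<open>The densities \<open>g i\<close> are the candidates of the estimator.  Their being countably many makes the
suprema over the sets \<open>{g i > g j}\<close>, and the choice of a candidate, measurable.\<close>

locale minimum_distance = sigma_finite_measure M for M :: "'a measure" +
  fixes g :: "nat \<Rightarrow> 'a \<Rightarrow> real" and n :: nat and L :: real and V :: nat
  assumes g: "\<And>i. prob_density M (g i)"
    and grow: "poly_growth {{x\<in>space M. g i x > g j x} | i j. True} L V"
    and L: "L \<ge> 1" and V: "V \<ge> 1" and n: "n > 0"
begin

definition yatracos :: "nat \<Rightarrow> 'a set" where
  "yatracos k = (case prod_decode k of (i, j) \<Rightarrow> {x\<in>space M. g i x > g j x})"

lemma g_measurable [measurable]: "g i \<in> borel_measurable M"
  using prob_densityD(1)[OF g] .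

lemma yatracos_sets [measurable]: "yatracos k \<in> sets M"
  unfolding yatracos_def by (cases "prod_decode k") simp

lemma yatracos_encode: "yatracos (prod_encode (i, j)) = {x\<in>space M. g i x > g j x}"
  by (simp add: yatracos_def)

lemma range_yatracos: "range yatracos = {{x\<in>space M. g i x > g j x} | i j. True}"
proof (intro equalityI subsetI)
  fix A assume "A \<in> range yatracos"
  then obtain k where k: "A = yatracos k" by auto
  obtain i j where "prod_decode k = (i, j)" by force
  then have "A = {x\<in>space M. g i x > g j x}" using k by (simp add: yatracos_def)
  then show "A \<in> {{x\<in>space M. g i x > g j x} | i j. True}" by blast
next
  fix A assume "A \<in> {{x\<in>space M. g i x > g j x} | i j. True}"
  then obtain i j where "A = yatracos (prod_encode (i, j))" by (auto simp: yatracos_encode)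
  then show "A \<in> range yatracos" by blast
qed

definition law :: "('a \<Rightarrow> real) \<Rightarrow> 'a measure" where
  "law f = density M (\<lambda>x. ennreal (f x))"

definition fit :: "nat \<Rightarrow> (nat \<Rightarrow> 'a) \<Rightarrow> real" where
  "fit i s = (SUP k. \<bar>measure (law (g i)) (yatracos k) - (\<Sum>j<n. indicator (yatracos k) (s j)) / n\<bar>)"

text \<open>The infimum need not be attained, whence the slack \<open>1 / n\<close>; it is of smaller order than the
rate.\<close>

definition best :: "(nat \<Rightarrow> 'a) \<Rightarrow> nat" where
  "best s = (LEAST i. fit i s \<le> (INF j. fit j s) + 1 / n)"

lemma law_prob: "prob_density M f \<Longrightarrow> prob_space (law f)"
  unfolding law_def by (rule prob_densityD)

lemma fit_term_le_1: "\<bar>measure (law (g i)) (yatracos k) - (\<Sum>j<n. indicator (yatracos k) (s j)) / n\<bar> \<le> 1"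
proof -
  interpret prob_space "law (g i)" by (rule law_prob[OF g])
  show ?thesis
    using prob_le_1[of "yatracos k"] measure_nonneg[of "law (g i)" "yatracos k"] empirical_mean_bounds[where A = "yatracos k" and s = s and n = n] by linarith
qed

lemma bdd_fit: "bdd_above (range (\<lambda>k. \<bar>measure (law (g i)) (yatracos k) - (\<Sum>j<n. indicat_real (yatracos k) (s j)) / n\<bar>))"
  using fit_term_le_1 by (intro bdd_aboveI2)

lemma fit_upper: "\<bar>measure (law (g i)) (yatracos k) - (\<Sum>j<n. indicator (yatracos k) (s j)) / n\<bar> \<le> fit i s"
  unfolding fit_def by (rule cSUP_upper[OF UNIV_I bdd_fit])

lemma fit_nonneg: "0 \<le> fit i s"
  using fit_upper[of i 0 s] by linarith

lemma bdd_below_fit: "bdd_below (range (\<lambda>i. fit i s))"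
  using fit_nonneg by (intro bdd_belowI2)

lemma best_le: "fit (best s) s \<le> fit i s + 1 / n"
proof -
  have "\<exists>i. fit i s < (INF j. fit j s) + 1 / n"
    using cInf_lessD[of "range (\<lambda>i. fit i s)" "(INF j. fit j s) + 1 / n"] n by auto
  then have "fit (best s) s \<le> (INF j. fit j s) + 1 / n"
    unfolding best_def by (metis (mono_tags, lifting) LeastI less_imp_le)
  also have "(INF j. fit j s) \<le> fit i s" by (rule cINF_lower[OF bdd_below_fit UNIV_I])
  finally show ?thesis by simp
qed

lemma fit_measurable [measurable]: "fit i \<in> borel_measurable (PiM {..<n} (\<lambda>_. M))"
  unfolding fit_def by (intro borel_measurable_cSUP countableI_type bdd_fit) measurable

lemma best_measurable [measurable]: "best \<in> measurable (PiM {..<n} (\<lambda>_. M)) (count_space UNIV)"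
proof -
  define m where "m = (\<lambda>s. INF j. fit j s)"
  have [measurable]: "m \<in> borel_measurable (PiM {..<n} (\<lambda>_. M))"
    unfolding m_def by (intro borel_measurable_cINF countableI_type bdd_below_fit) measurable
  have best: "best = (\<lambda>s. LEAST i. \<not> m s + 1 / n < fit i s)"
    by (simp add: best_def m_def fun_eq_iff not_less)
  show ?thesis unfolding best by measurable
qed

lemma estimator_best: "estimator M n (return borel 0) (\<lambda>r s. g (best s))"
  unfolding estimator_def
proof
  show "prob_space (return borel (0 :: real))" by (rule prob_space_return) simp
  have "(\<lambda>p. g (best (snd (fst p))) (snd p)) \<in>
      borel_measurable ((return borel (0 :: real) \<Otimes>\<^sub>M PiM {..<n} (\<lambda>_. M)) \<Otimes>\<^sub>M M)"
    by (rule measurable_compose_countable[where g="\<lambda>p. best (snd (fst p))" and f="\<lambda>i p. g i (snd p)"]) measurable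
  then show "(\<lambda>((r, s), x). g (best s) x) \<in>
      borel_measurable ((return borel (0 :: real) \<Otimes>\<^sub>M PiM {..<n} (\<lambda>_. M)) \<Otimes>\<^sub>M M)"
    by (simp add: case_prod_beta')
qed

text \<open>The argument of Devroye and Lugosi.  Two candidates differ in total variation by the difference of
the probabilities that they give to a single Yatracos set, and both the selected candidate and the
candidate near \<open>f\<close> match the empirical frequency of that set up to the fit of the latter and the
slack.\<close>

lemma TV_best_le:
  assumes f: "prob_density M f" and i: "TV M f (g i) \<le> ennreal (1 / n)"
  shows "TV M (g (best s)) f \<le> ennreal (4 / n + 2 * (SUP k. \<bar>(\<Sum>j<n. indicator (yatracos k) (s j)) / n - measure (law f) (yatracos k)\<bar>))"
proof -
  define dev where "dev = (SUP k. \<bar>(\<Sum>j<n. indicator (yatracos k) (s j)) / n - measure (law f) (yatracos k)\<bar>)"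
  interpret f: prob_space "law f" by (rule law_prob[OF f])
  have dev: "\<bar>(\<Sum>j<n. indicator (yatracos k) (s j)) / n - measure (law f) (yatracos k)\<bar> \<le> dev" for k
    unfolding dev_def
  proof (rule cSUP_upper[OF UNIV_I], rule bdd_aboveI2)
    show "\<bar>(\<Sum>j<n. indicator (yatracos k) (s j)) / n - measure (law f) (yatracos k)\<bar> \<le> 1" for k
      using f.prob_le_1[of "yatracos k"] measure_nonneg[of "law f" "yatracos k"] empirical_mean_bounds[where A = "yatracos k" and s = s and n = n] by linarith
  qed
  let ?b = "best s"
  let ?tv = "\<lambda>f g. (\<integral>x. \<bar>f x - g x\<bar> \<partial>M) / 2"
  have i': "?tv f (g i) \<le> 1 / n"
    using i unfolding TV_eq_integral[OF f g] by (subst (asm) ennreal_le_iff) simp_all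
  have fit_i: "fit i s \<le> 1 / n + dev"
    unfolding fit_def
  proof (rule cSUP_least)
    fix k
    have "\<bar>measure (law (g i)) (yatracos k) - measure (law f) (yatracos k)\<bar> \<le> ?tv (g i) f"
      unfolding law_def by (rule measure_diff_le_TV(1)[OF g f yatracos_sets])
    also have "\<dots> \<le> 1 / n" using i' by (simp add: abs_minus_commute)
    finally show "\<bar>measure (law (g i)) (yatracos k) - (\<Sum>j<n. indicator (yatracos k) (s j)) / n\<bar> \<le> 1 / n + dev"
      using dev[of k] by linarith
  qed simp
  let ?k = "prod_encode (?b, i)"
  have "?tv (g ?b) (g i) = measure (law (g ?b)) (yatracos ?k) - measure (law (g i)) (yatracos ?k)"
    unfolding law_def by (rule measure_diff_le_TV(2)[OF g g yatracos_sets yatracos_encode, symmetric])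
  also have "\<dots> \<le> fit ?b s + fit i s"
    using fit_upper[of ?b ?k s] fit_upper[of i ?k s] by linarith
  also have "\<dots> \<le> 3 / n + 2 * dev" using best_le[of s i] fit_i by (simp add: field_simps)
  finally have "TV M (g ?b) (g i) \<le> ennreal (3 / n + 2 * dev)"
    unfolding TV_eq_integral[OF g g] by (rule ennreal_leI)
  then have "TV M (g ?b) (g i) + TV M (g i) f \<le> ennreal (3 / n + 2 * dev) + ennreal (1 / n)"
    using i by (intro add_mono) (simp_all add: TV_commute[of M "g i" f])
  moreover have "TV M (g ?b) f \<le> TV M (g ?b) (g i) + TV M (g i) f"
    using prob_densityD(1)[OF f] by (intro TV_triangle) auto
  ultimately have "TV M (g ?b) f \<le> ennreal (3 / n + 2 * dev) + ennreal (1 / n)" by simp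
  also have "\<dots> = ennreal (4 / n + 2 * dev)"
    using order_trans[OF abs_ge_zero dev] by (subst ennreal_plus[symmetric]) (auto simp: add_divide_distrib[symmetric])
  finally show ?thesis unfolding dev_def .
qed

lemma TV_best_le_1:
  assumes f: "prob_density M f"
  shows "TV M (g (best s)) f \<le> 1"
proof -
  let ?A = "{x\<in>space M. g (best s) x > f x}"
  have A: "?A \<in> sets M" using prob_densityD(1)[OF f] by measurable
  interpret f: prob_space "law f" by (rule law_prob[OF f])
  interpret b: prob_space "law (g (best s))" by (rule law_prob[OF g])
  have "(\<integral>x. \<bar>g (best s) x - f x\<bar> \<partial>M) / 2 = measure (law (g (best s))) ?A - measure (law f) ?A"
    unfolding law_def by (rule measure_diff_le_TV(2)[OF g f A refl, symmetric])
  also have "\<dots> \<le> 1" using b.prob_le_1[of ?A] measure_nonneg[of "law f" ?A] by linarith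
  finally show ?thesis unfolding TV_eq_integral[OF g f] by (metis ennreal_1 ennreal_leI)
qed

lemma minimax_risk_le:
  assumes F: "\<And>f. f \<in> F \<Longrightarrow> prob_density M f"
    and dense: "\<And>f \<eta>. f \<in> F \<Longrightarrow> \<eta> > 0 \<Longrightarrow> \<exists>i. TV M f (g i) \<le> ennreal \<eta>"
  shows "minimax_risk M n F \<le> ennreal (min 1 (68 * sqrt (growth_entropy L V / n)))"
proof -
  let ?H = "growth_entropy L V"
  have "minimax_risk M n F \<le> risk M n (return borel 0) (\<lambda>r s. g (best s)) F"
    unfolding minimax_risk_def using estimator_best by (intro Inf_lower) blast
  also have "\<dots> \<le> ennreal (min 1 (68 * sqrt (?H / n)))"
    unfolding risk_def
  proof (rule SUP_least)
    fix f assume "f \<in> F"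
    note f = F[OF this]
    obtain i where i: "TV M f (g i) \<le> ennreal (1 / n)" using dense[OF \<open>f \<in> F\<close>, of "1 / n"] n by auto
    have sets_law: "sets (law f) = sets M" by (simp add: law_def)
    interpret law: prob_space "law f" by (rule law_prob[OF f])
    have "poly_growth (range yatracos) L V" unfolding range_yatracos by (rule grow)
    then interpret empirical_process "law f" yatracos n L V
      by unfold_locales (simp_all only: sets_law yatracos_sets L V n)
    interpret Q: prob_space "return borel (0 :: real)" by (rule prob_space_return) simp
    interpret S: prob_space "iid {..<n}" by (rule prob_space_Pi)
    have iid: "iid_samples M n f = iid {..<n}" by (simp add: iid_samples_def law_def)
    define R where "R = (\<integral>\<^sup>+ (r, s). TV M (g (best s)) f \<partial>(return borel (0 :: real) \<Otimes>\<^sub>M iid_samples M n f))"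
    have snd: "(\<integral>\<^sup>+ p. h (snd p) \<partial>(return borel (0 :: real) \<Otimes>\<^sub>M iid {..<n})) = (\<integral>\<^sup>+ s. h s \<partial>iid {..<n})"
      if [measurable]: "h \<in> borel_measurable (iid {..<n})" for h
      by (subst S.nn_integral_fst[symmetric]) (auto simp: Q.emeasure_space_1)
    have R1: "R \<le> 1"
    proof -
      have "R \<le> (\<integral>\<^sup>+ p. 1 \<partial>(return borel (0 :: real) \<Otimes>\<^sub>M iid {..<n}))"
        unfolding R_def iid using TV_best_le_1[OF f] by (intro nn_integral_mono) auto
      also have "\<dots> = 1" by (subst snd) (auto simp: S.emeasure_space_1)
      finally show ?thesis .
    qed
    have "R \<le> (\<integral>\<^sup>+ p. ennreal (4 / n + 2 * deviation (snd p)) \<partial>(return borel (0 :: real) \<Otimes>\<^sub>M iid {..<n}))"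
      unfolding R_def iid deviation_def using TV_best_le[OF f i] by (intro nn_integral_mono) auto
    also have "\<dots> = (\<integral>\<^sup>+ s. ennreal (4 / n + 2 * deviation s) \<partial>iid {..<n})"
      by (rule snd[of "\<lambda>s. ennreal (4 / n + 2 * deviation s)"]) measurable
    also have "\<dots> = ennreal (\<integral>s. 4 / n + 2 * deviation s \<partial>iid {..<n})"
    proof (rule nn_integral_eq_integral)
      show "integrable (iid {..<n}) (\<lambda>s. 4 / n + 2 * deviation s)"
        using deviation_bounds by (intro S.integrable_const_bound[where B = "4 / n + 2"]) (auto intro: add_mono)
    qed (use deviation_bounds in auto)
    also have "(\<integral>s. 4 / n + 2 * deviation s \<partial>iid {..<n}) = 4 / n + 2 * (\<integral>s. deviation s \<partial>iid {..<n})"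
    proof -
      have "integrable (iid {..<n}) deviation"
        using deviation_bounds by (intro S.integrable_const_bound[where B = 1]) auto
      then show ?thesis by (simp add: S.prob_space)
    qed
    also have "ennreal \<dots> \<le> ennreal (68 * sqrt (?H / n))"
    proof (rule ennreal_leI)
      have "1 \<le> 2 * ln (4 :: real)"
      proof -
        have "exp (1 / 2 :: real) \<le> 4"
          using exp_le exp_le_cancel_iff[of "1 / 2 :: real" 1] by linarith
        then have "1 / 2 \<le> ln (4 :: real)" by (subst ln_ge_iff) auto
        then show ?thesis by simp
      qed
      also have "\<dots> \<le> 2 * real V * ln (4 * real V)"
        using V by (intro mult_mono) auto
      also have "\<dots> \<le> ?H" using L by (simp add: growth_entropy_def)
      finally have H: "1 \<le> ?H" .
      have "1 / real n = sqrt (1 / n * (1 / n))" by (simp only: real_sqrt_abs2) simp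
      also have "\<dots> \<le> sqrt (?H * (1 / n))"
      proof (intro real_sqrt_le_mono mult_right_mono)
        have "1 / real n \<le> 1" using n by simp
        then show "1 / real n \<le> ?H" using H by linarith
      qed simp
      finally show "4 / n + 2 * (\<integral>s. deviation s \<partial>iid {..<n}) \<le> 68 * sqrt (?H / n)"
        using expected_deviation_le by simp
    qed
    finally show "R \<le> ennreal (min 1 (68 * sqrt (?H / n)))"
      using R1 by (simp add: min_def)
  qed
  finally show ?thesis .
qed

end

section \<open>Sparse exponential families\<close>

lemma countable_dense_subset:
  fixes S :: "'a :: {metric_space, second_countable_topology} set"
  obtains D where "countable D" "D \<subseteq> S" "\<And>x. x \<in> S \<Longrightarrow> \<exists>X. (\<forall>k::nat. X k \<in> D) \<and> X \<longlonglongrightarrow> x"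
proof -
  obtain B :: "'a set set" where B: "countable B" "topological_basis B"
    using ex_countable_basis by blast
  define D where "D = (\<lambda>b. SOME x. x \<in> b \<inter> S) ` {b\<in>B. b \<inter> S \<noteq> {}}"
  have pick: "(SOME x. x \<in> b \<inter> S) \<in> b \<inter> S" if "b \<inter> S \<noteq> {}" for b
    using that by (metis some_in_eq)
  have "\<exists>X. (\<forall>k::nat. X k \<in> D) \<and> X \<longlonglongrightarrow> x" if x: "x \<in> S" for x
  proof -
    have "x \<in> closure D"
    proof (rule closure_iff_nhds_not_empty[THEN iffD2], intro allI impI)
      fix A U assume A: "U \<subseteq> A" "open U" "x \<in> U"
      then obtain b where b: "b \<in> B" "x \<in> b" "b \<subseteq> U" using topological_basisE[OF B(2)] by metis
      then have "(SOME x. x \<in> b \<inter> S) \<in> D" using x unfolding D_def by blast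
      moreover have "(SOME x. x \<in> b \<inter> S) \<in> b" using pick[of b] b(2) x by blast
      ultimately show "D \<inter> A \<noteq> {}" using b(3) A(1) by blast
    qed
    then show ?thesis by (simp add: closure_sequential)
  qed
  moreover have "countable D" using B(1) unfolding D_def by auto
  moreover have "D \<subseteq> S" unfolding D_def using pick by blast
  ultimately show ?thesis using that by blast
qed

text \<open>There is no separate normalizing constant: a constant feature takes its place.\<close>

definition exp_density :: "('a \<Rightarrow> 'i \<Rightarrow> real) \<Rightarrow> 'i set \<Rightarrow> ('i \<Rightarrow> real) \<Rightarrow> 'a \<Rightarrow> real" where
  "exp_density \<phi> S \<theta> x = exp (\<Sum>p\<in>S. \<theta> p * \<phi> x p)"

text \<open>Convergence of the coefficients gives pointwise convergence of the densities, and Scheffe's lemma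
turns this into convergence in total variation.\<close>

lemma exp_density_tendsto:
  fixes \<phi> :: "'a \<Rightarrow> ('i :: countable) \<Rightarrow> real"
  assumes "\<And>k. prob_density M (exp_density \<phi> S (\<theta> k))" "prob_density M (exp_density \<phi> S \<theta>')"
    and lim: "\<theta> \<longlonglongrightarrow> \<theta>'"
  shows "(\<lambda>k. TV M (exp_density \<phi> S (\<theta> k)) (exp_density \<phi> S \<theta>')) \<longlonglongrightarrow> 0"
proof -
  have c: "(\<lambda>k. \<theta> k p) \<longlonglongrightarrow> \<theta>' p" for p
    using continuous_on_tendsto_compose[OF continuous_on_product_coordinates lim] by simp
  have "(\<lambda>k. \<integral>\<^sup>+ x. norm (exp_density \<phi> S (\<theta> k) x - exp_density \<phi> S \<theta>' x) \<partial>M) \<longlonglongrightarrow> 0"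
  proof (rule Scheffe_lemma2)
    show "AE x in M. (\<lambda>k. exp_density \<phi> S (\<theta> k) x) \<longlonglongrightarrow> exp_density \<phi> S \<theta>' x"
      unfolding exp_density_def by (intro AE_I2 tendsto_intros c)
    have n: "(\<integral>\<^sup>+ x. norm (exp_density \<phi> S t x) \<partial>M) = (\<integral>\<^sup>+ x. exp_density \<phi> S t x \<partial>M)" for t
      by (simp add: exp_density_def)
    show "(\<integral>\<^sup>+ x. norm (exp_density \<phi> S (\<theta> k) x) \<partial>M) \<le> (\<integral>\<^sup>+ x. norm (exp_density \<phi> S \<theta>' x) \<partial>M)" for k
      using prob_densityD(3)[OF assms(1)] prob_densityD(3)[OF assms(2)] by (simp only: n order_refl)
  qed (use prob_densityD[OF assms(1)] prob_densityD[OF assms(2)] in auto)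
  moreover have "inverse (2 :: ennreal) < \<top>"
  proof -
    have "inverse (ennreal 2) = ennreal (inverse 2)" by (rule inverse_ennreal) simp
    then show ?thesis by (simp only: ennreal_numeral ennreal_less_top)
  qed
  ultimately have "(\<lambda>k. inverse 2 * (\<integral>\<^sup>+ x. norm (exp_density \<phi> S (\<theta> k) x - exp_density \<phi> S \<theta>' x) \<partial>M))
      \<longlonglongrightarrow> inverse 2 * 0"
    by (intro ennreal_tendsto_cmult)
  then show ?thesis by (simp add: TV_def divide_ennreal_def mult.commute)
qed

lemma prob_density_cong:
  assumes "\<And>x. x \<in> space M \<Longrightarrow> f x = g x"
  shows "prob_density M f \<longleftrightarrow> prob_density M g"
  unfolding prob_density_def using assms
  by (metis (no_types, lifting) measurable_cong nn_integral_cong)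

lemma TV_cong:
  assumes "\<And>x. x \<in> space M \<Longrightarrow> f x = g x"
  shows "TV M f h = TV M g h"
  unfolding TV_def using assms by (simp cong: nn_integral_cong)

text \<open>The set \<open>{f > g}\<close> compares two exponents, so it is a halfspace in the features that occur in
\<open>f\<close> or in \<open>g\<close>; the number of pairs of supports enters as a factor.\<close>

lemma poly_growth_exp_density:
  fixes \<phi> :: "'a \<Rightarrow> 'i \<Rightarrow> real"
  assumes SS: "finite \<S>" "\<And>S. S \<in> \<S> \<Longrightarrow> finite S \<and> card S \<le> D"
    and G: "\<And>g. g \<in> G \<Longrightarrow> \<exists>S\<in>\<S>. \<exists>\<theta>. g = exp_density \<phi> S \<theta>"
  shows "poly_growth {{x\<in>space M. f x > g x} | f g. f \<in> G \<and> g \<in> G} ((real (card \<S>))\<^sup>2) (2 * D)"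
  unfolding poly_growth_def
proof (intro allI impI)
  fix U :: "'a set" assume U: "finite U"
  let ?A = "{{x\<in>space M. f x > g x} | f g. f \<in> G \<and> g \<in> G}"
  let ?U = "U \<inter> space M"
  let ?H = "\<lambda>(S, T). {{x\<in>?U. (\<Sum>p\<in>S \<union> T. \<theta> p * \<phi> x p) > 0} |\<theta>. True}"
  have fH: "finite (?H q)" for q
    by (rule finite_subset[of _ "Pow U"]) (use U in \<open>auto split: prod.splits\<close>)
  have "(\<lambda>A. A \<inter> U) ` ?A \<subseteq> (\<Union>q\<in>\<S> \<times> \<S>. ?H q)"
  proof
    fix B assume "B \<in> (\<lambda>A. A \<inter> U) ` ?A"
    then obtain f g where fg: "f \<in> G" "g \<in> G" "B = {x\<in>space M. f x > g x} \<inter> U" by auto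
    obtain S a T b where S: "S \<in> \<S>" "f = exp_density \<phi> S a" and T: "T \<in> \<S>" "g = exp_density \<phi> T b"
      using G[OF fg(1)] G[OF fg(2)] by blast
    have fin: "finite S" "finite T" using SS S T by auto
    let ?\<theta> = "\<lambda>p. (if p \<in> S then a p else 0) - (if p \<in> T then b p else 0)"
    have "f x > g x \<longleftrightarrow> (\<Sum>p\<in>S \<union> T. ?\<theta> p * \<phi> x p) > 0" for x
    proof -
      have s1: "(\<Sum>p\<in>S. a p * \<phi> x p) = (\<Sum>p\<in>S \<union> T. (if p \<in> S then a p else 0) * \<phi> x p)"
        by (rule sum.mono_neutral_cong_left) (use fin in auto)
      have s2: "(\<Sum>p\<in>T. b p * \<phi> x p) = (\<Sum>p\<in>S \<union> T. (if p \<in> T then b p else 0) * \<phi> x p)"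
        by (rule sum.mono_neutral_cong_left) (use fin in auto)
      have "(\<Sum>p\<in>S \<union> T. ?\<theta> p * \<phi> x p) = (\<Sum>p\<in>S. a p * \<phi> x p) - (\<Sum>p\<in>T. b p * \<phi> x p)"
        unfolding s1 s2 sum_subtractf[symmetric] by (rule sum.cong) (auto simp: algebra_simps)
      then show ?thesis unfolding S(2) T(2) exp_density_def by simp
    qed
    then have "B = {x\<in>?U. (\<Sum>p\<in>S \<union> T. ?\<theta> p * \<phi> x p) > 0}" unfolding fg(3) by blast
    then have "B \<in> ?H (S, T)" unfolding prod.case mem_Collect_eq by (intro exI[of _ ?\<theta>]) simp
    then show "B \<in> (\<Union>q\<in>\<S> \<times> \<S>. ?H q)" using S T by blast
  qed
  moreover have "finite (\<Union>q\<in>\<S> \<times> \<S>. ?H q)" using SS(1) fH by blast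
  ultimately have "card ((\<lambda>A. A \<inter> U) ` ?A) \<le> card (\<Union>q\<in>\<S> \<times> \<S>. ?H q)" by (rule card_mono[rotated])
  also have "\<dots> \<le> (\<Sum>q\<in>\<S> \<times> \<S>. card (?H q))" using SS(1) by (intro card_UN_le) auto
  also have "\<dots> \<le> (\<Sum>q\<in>\<S> \<times> \<S>. (card U + 1) ^ (2 * D))"
  proof (rule sum_mono)
    fix q assume "q \<in> \<S> \<times> \<S>"
    then obtain S T where q: "q = (S, T)" "S \<in> \<S>" "T \<in> \<S>" by auto
    have "card (?H q) \<le> (card ?U + 1) ^ card (S \<union> T)"
      unfolding q(1) prod.case using SS q U by (intro card_halfspace_traces_le) auto
    also have "\<dots> \<le> (card U + 1) ^ card (S \<union> T)"
      using U by (intro power_mono add_mono card_mono) auto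
    also have "\<dots> \<le> (card U + 1) ^ (2 * D)"
    proof (rule power_increasing)
      have "card (S \<union> T) \<le> card S + card T" by (rule card_Un_le)
      also have "\<dots> \<le> 2 * D" using SS(2)[OF q(2)] SS(2)[OF q(3)] by simp
      finally show "card (S \<union> T) \<le> 2 * D" .
    qed simp
    finally show "card (?H q) \<le> (card U + 1) ^ (2 * D)" .
  qed
  also have "\<dots> = (card \<S>)\<^sup>2 * (card U + 1) ^ (2 * D)"
    by (simp add: card_cartesian_product power2_eq_square)
  finally have "real (card ((\<lambda>A. A \<inter> U) ` ?A)) \<le> real ((card \<S>)\<^sup>2 * (card U + 1) ^ (2 * D))"
    by (rule of_nat_mono)
  then show "real (card ((\<lambda>A. A \<inter> U) ` ?A)) \<le> (real (card \<S>))\<^sup>2 * (real (card U) + 1) ^ (2 * D)"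
    by (simp add: add.commute)
qed

text \<open>The candidates are the densities whose coefficients lie in countable sets, one for each support,
that are dense among all coefficient vectors of densities with that support.\<close>

theorem minimax_risk_exponential_family_le:
  fixes \<phi> :: "'a \<Rightarrow> ('i :: countable) \<Rightarrow> real"
  assumes M: "sigma_finite_measure M"
    and SS: "finite \<S>" "\<And>S. S \<in> \<S> \<Longrightarrow> finite S \<and> card S \<le> D" and D: "D \<ge> 1"
    and F: "\<And>f. f \<in> F \<Longrightarrow> prob_density M f \<and> (\<exists>S\<in>\<S>. \<exists>\<theta>. \<forall>x\<in>space M. f x = exp_density \<phi> S \<theta> x)"
    and n: "n > 0"
  shows "minimax_risk M n F
    \<le> ennreal (min 1 (68 * sqrt (growth_entropy ((real (card \<S>))\<^sup>2) (2 * D) / n)))"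
proof -
  interpret sigma_finite_measure M by (rule M)
  define \<Theta> where "\<Theta> S = {\<theta>. prob_density M (exp_density \<phi> S \<theta>)}" for S
  have "\<exists>D. countable D \<and> D \<subseteq> \<Theta> S \<and> (\<forall>x\<in>\<Theta> S. \<exists>X. (\<forall>k::nat. X k \<in> D) \<and> X \<longlonglongrightarrow> x)" for S
    by (rule countable_dense_subset[of "\<Theta> S"]) blast
  then obtain N where N: "\<And>S. countable (N S)" "\<And>S. N S \<subseteq> \<Theta> S"
    "\<And>S \<theta>. \<theta> \<in> \<Theta> S \<Longrightarrow> \<exists>X. (\<forall>k::nat. X k \<in> N S) \<and> X \<longlonglongrightarrow> \<theta>" by metis
  define G where "G = (\<Union>S\<in>\<S>. exp_density \<phi> S ` N S)"
  have G: "countable G" unfolding G_def using SS(1) N(1) by (simp add: countable_finite)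
  have dense: "\<exists>g\<in>G. TV M f g \<le> ennreal \<eta>" if f: "f \<in> F" and \<eta>: "\<eta> > 0" for f \<eta>
  proof -
    obtain S \<theta> where S: "S \<in> \<S>" "\<And>x. x \<in> space M \<Longrightarrow> f x = exp_density \<phi> S \<theta> x" using F[OF f] by blast
    have pd: "prob_density M (exp_density \<phi> S \<theta>)" using F[OF f] prob_density_cong[of M f "exp_density \<phi> S \<theta>"] S(2) by blast
    then have "\<theta> \<in> \<Theta> S" by (simp add: \<Theta>_def)
    then obtain X where X: "\<And>k::nat. X k \<in> N S" "X \<longlonglongrightarrow> \<theta>" using N(3) by blast
    have "(\<lambda>k. TV M (exp_density \<phi> S (X k)) (exp_density \<phi> S \<theta>)) \<longlonglongrightarrow> 0"
      using X(1) N(2) by (intro exp_density_tendsto[OF _ pd X(2)]) (auto simp: \<Theta>_def)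
    then have "\<forall>\<^sub>F k in sequentially. TV M (exp_density \<phi> S (X k)) (exp_density \<phi> S \<theta>) < ennreal \<eta>"
      using \<eta> by (intro order_tendstoD(2)) auto
    then obtain k where k: "TV M (exp_density \<phi> S (X k)) (exp_density \<phi> S \<theta>) < ennreal \<eta>"
      using eventually_happens'[OF sequentially_bot] by blast
    have "TV M f (exp_density \<phi> S (X k)) = TV M (exp_density \<phi> S (X k)) (exp_density \<phi> S \<theta>)"
      using TV_cong[of M f "exp_density \<phi> S \<theta>", OF S(2)] TV_commute by metis
    moreover have "exp_density \<phi> S (X k) \<in> G" unfolding G_def using S(1) X(1) by blast
    ultimately show ?thesis using k by (metis less_imp_le)
  qed
  show ?thesis
  proof (cases "F = {}")
    case True
    have "minimax_risk M n F \<le> 0"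
    proof -
      have "prob_space (return borel (0 :: real))" by (rule prob_space_return) simp
      then have "estimator M n (return borel 0) (\<lambda>_ _ _. 0)"
        by (simp add: estimator_def case_prod_beta')
      then have "minimax_risk M n F \<le> risk M n (return borel 0) (\<lambda>_ _ _. 0) F"
        unfolding minimax_risk_def by (intro Inf_lower) blast
      then show ?thesis by (simp add: risk_def True bot_ennreal)
    qed
    then show ?thesis by simp
  next
    case False
    then obtain f where "f \<in> F" by blast
    from dense[OF this, of 1] have Gne: "G \<noteq> {}" by auto
    obtain S where "S \<in> \<S>" using F[OF \<open>f \<in> F\<close>] by blast
    then have cS: "card \<S> \<ge> 1" using SS(1) by (auto simp: Suc_le_eq card_gt_0_iff)
    define g where "g = from_nat_into G"
    have rg: "range g = G" unfolding g_def using range_from_nat_into[OF Gne G] .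
    have gd: "prob_density M (g i)" for i
    proof -
      have "g i \<in> G" using rg by blast
      then obtain S \<theta> where "\<theta> \<in> N S" "g i = exp_density \<phi> S \<theta>" unfolding G_def by blast
      then show ?thesis using N(2)[of S] unfolding \<Theta>_def by auto
    qed
    have sets: "{{x\<in>space M. g i x > g j x} | i j. True} = {{x\<in>space M. f x > h x} | f h. f \<in> G \<and> h \<in> G}"
      unfolding rg[symmetric] by blast
    have grow: "poly_growth {{x\<in>space M. g i x > g j x} | i j. True} ((real (card \<S>))\<^sup>2) (2 * D)"
      unfolding sets by (rule poly_growth_exp_density[OF SS]) (auto simp: G_def)
    have "1 \<le> real (card \<S>)" using cS by simp
    then have K: "1 \<le> (real (card \<S>))\<^sup>2" by (rule one_le_power)
    interpret minimum_distance M g n "(real (card \<S>))\<^sup>2" "2 * D"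
      by unfold_locales (use gd grow K D n in auto)
    show ?thesis
    proof (rule minimax_risk_le)
      show "prob_density M f" if "f \<in> F" for f using F[OF that] by blast
      show "\<exists>i. TV M f (g i) \<le> ennreal \<eta>" if "f \<in> F" "\<eta> > 0" for f \<eta>
        using dense[OF that] unfolding rg[symmetric] by blast
    qed
  qed
qed

section \<open>Normalization of multivariate normal densities\<close>

definition quad_form :: "nat \<Rightarrow> real mat \<Rightarrow> (nat \<Rightarrow> real) \<Rightarrow> real" where
  "quad_form d K z = (\<Sum>i<d. \<Sum>j<d. K $$ (i, j) * z i * z j)"

lemma scalar_prod_mult_mat_vec:
  assumes "K \<in> carrier_mat d d" "v \<in> carrier_vec d"
  shows "scalar_prod v (K *\<^sub>v v) = quad_form d K (\<lambda>i. v $ i)"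
proof -
  have "scalar_prod v (K *\<^sub>v v) = (\<Sum>i<d. v $ i * (\<Sum>j<d. K $$ (i, j) * v $ j))"
    using assms by (auto simp: scalar_prod_def atLeast0LessThan mult_mat_vec_def intro!: sum.cong)
  also have "\<dots> = quad_form d K (\<lambda>i. v $ i)"
    by (auto simp: quad_form_def sum_distrib_left mult_ac intro!: sum.cong)
  finally show ?thesis .
qed

lemma pos_def_mat_iff:
  "pos_def_mat d K \<longleftrightarrow> K \<in> carrier_mat d d \<and> (\<forall>i<d. \<forall>j<d. K $$ (i, j) = K $$ (j, i)) \<and>
     (\<forall>z. (\<exists>i<d. z i \<noteq> 0) \<longrightarrow> quad_form d K z > 0)"
proof (cases "K \<in> carrier_mat d d")
  case True
  have "transpose_mat K = K \<longleftrightarrow> (\<forall>i<d. \<forall>j<d. K $$ (i, j) = K $$ (j, i))"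
  proof
    assume "transpose_mat K = K"
    then show "\<forall>i<d. \<forall>j<d. K $$ (i, j) = K $$ (j, i)"
      using True by (metis carrier_matD index_transpose_mat(1))
  next
    assume "\<forall>i<d. \<forall>j<d. K $$ (i, j) = K $$ (j, i)"
    then show "transpose_mat K = K" using True by (intro eq_matI) auto
  qed
  moreover have "(\<forall>v \<in> carrier_vec d. v \<noteq> 0\<^sub>v d \<longrightarrow> scalar_prod v (K *\<^sub>v v) > 0) \<longleftrightarrow>
      (\<forall>z. (\<exists>i<d. z i \<noteq> 0) \<longrightarrow> quad_form d K z > 0)" (is "?A \<longleftrightarrow> ?B")
  proof
    assume A: ?A
    show ?B
    proof (intro allI impI)
      fix z :: "nat \<Rightarrow> real" assume z: "\<exists>i<d. z i \<noteq> 0"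
      have "Matrix.vec d z \<noteq> 0\<^sub>v d" using z by (metis index_vec index_zero_vec(1))
      then have "scalar_prod (Matrix.vec d z) (K *\<^sub>v Matrix.vec d z) > 0" using A by simp
      moreover have "quad_form d K (\<lambda>i. Matrix.vec d z $ i) = quad_form d K z"
        unfolding quad_form_def by (intro sum.cong) auto
      ultimately show "quad_form d K z > 0" using True by (simp add: scalar_prod_mult_mat_vec)
    qed
  next
    assume B: ?B
    show ?A
    proof (intro ballI impI)
      fix v :: "real Matrix.vec" assume v: "v \<in> carrier_vec d" "v \<noteq> 0\<^sub>v d"
      then have "\<exists>i<d. v $ i \<noteq> 0" by (metis carrier_vecD eq_vecI index_zero_vec)
      then show "scalar_prod v (K *\<^sub>v v) > 0" using B v True by (simp add: scalar_prod_mult_mat_vec)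
    qed
  qed
  ultimately show ?thesis using True by (simp add: pos_def_mat_def)
qed (simp add: pos_def_mat_def)

lemma nn_integral_gaussian_1d:
  fixes a b m :: real
  assumes "a > 0"
  shows "(\<integral>\<^sup>+ y. ennreal (exp (- (a * (y - m)\<^sup>2) / 2 + b * (y - m))) \<partial>lborel)
      = ennreal (sqrt (2 * pi / a) * exp (b\<^sup>2 / (2 * a)))"
proof -
  let ?N = "normal_density (m + b / a) (1 / sqrt a)"
  have e: "exp (- (a * (y - m)\<^sup>2) / 2 + b * (y - m)) = sqrt (2 * pi / a) * exp (b\<^sup>2 / (2 * a)) * ?N y" for y
  proof -
    have sq: "(1 / sqrt a)\<^sup>2 = 1 / a" using assms by (simp add: power_divide)
    have "- (a * (y - m)\<^sup>2) / 2 + b * (y - m) = b\<^sup>2 / (2 * a) + - (y - (m + b / a))\<^sup>2 / (2 * (1 / sqrt a)\<^sup>2)"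
      unfolding sq using assms by (simp add: field_simps power2_eq_square)
    then have "exp (- (a * (y - m)\<^sup>2) / 2 + b * (y - m))
        = exp (b\<^sup>2 / (2 * a)) * exp (- (y - (m + b / a))\<^sup>2 / (2 * (1 / sqrt a)\<^sup>2))"
      by (simp only: exp_add)
    moreover have "sqrt (2 * pi * (1 / sqrt a)\<^sup>2) = sqrt (2 * pi / a)" unfolding sq by simp
    ultimately show ?thesis unfolding normal_density_def using assms by simp
  qed
  have "(\<integral>\<^sup>+ y. ennreal (?N y) \<partial>lborel) = 1"
    using prob_space.emeasure_space_1[OF prob_space_normal_density[of "1 / sqrt a" "m + b / a"]] assms
    by (simp add: emeasure_density)
  then show ?thesis unfolding e using assms
    by (simp add: ennreal_mult' nn_integral_cmult)
qed

text \<open>Column operations with the last column clear the rest of the last row; they amount to a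
multiplication by a unit triangular matrix.\<close>

lemma det_schur:
  fixes K :: "real mat"
  assumes K: "K \<in> carrier_mat (Suc d) (Suc d)" and a: "K $$ (d, d) \<noteq> 0"
  shows "Determinant.det K = K $$ (d, d) *
    Determinant.det (mat d d (\<lambda>(i, j). K $$ (i, j) - K $$ (i, d) * K $$ (d, j) / K $$ (d, d)))"
proof -
  let ?a = "K $$ (d, d)"
  let ?S = "mat d d (\<lambda>(i, j). K $$ (i, j) - K $$ (i, d) * K $$ (d, j) / ?a)"
  define A where "A = mat d d (\<lambda>(i, j). K $$ (i, j))"
  define B where "B = mat d 1 (\<lambda>(i, j). K $$ (i, d))"
  define C where "C = mat 1 d (\<lambda>(i, j). K $$ (d, j))"
  define D where "D = mat 1 1 (\<lambda>(i, j). ?a)"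
  define E where "E = mat 1 d (\<lambda>(i, j). - K $$ (d, j) / ?a)"
  have c: "A \<in> carrier_mat d d" "B \<in> carrier_mat d 1" "C \<in> carrier_mat 1 d" "D \<in> carrier_mat 1 1"
    "E \<in> carrier_mat 1 d" by (simp_all add: A_def B_def C_def D_def E_def)
  have Kb: "K = four_block_mat A B C D"
    using K by (intro eq_matI) (auto simp: A_def B_def C_def D_def four_block_mat_def Let_def less_Suc_eq)
  let ?T = "four_block_mat (1\<^sub>m d) (0\<^sub>m d 1) E (1\<^sub>m 1)"
  have T: "?T \<in> carrier_mat (Suc d) (Suc d)"
    using four_block_carrier_mat[of "1\<^sub>m d" d d "1\<^sub>m 1" 1 1] by simp
  have dT: "Determinant.det ?T = 1"
    using det_four_block_mat_upper_right_zero[of "1\<^sub>m d" d "0\<^sub>m d 1" 1 E "1\<^sub>m 1"] c by simp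
  have "K * ?T = four_block_mat (A * 1\<^sub>m d + B * E) (A * 0\<^sub>m d 1 + B * 1\<^sub>m 1)
      (C * 1\<^sub>m d + D * E) (C * 0\<^sub>m d 1 + D * 1\<^sub>m 1)"
    unfolding Kb by (rule mult_four_block_mat) (use c in auto)
  also have "A * 1\<^sub>m d + B * E = ?S"
    by (rule eq_matI) (use c in \<open>auto simp: A_def B_def E_def scalar_prod_def\<close>)
  also have "C * 1\<^sub>m d + D * E = 0\<^sub>m 1 d"
    by (rule eq_matI) (use c a in \<open>auto simp: C_def D_def E_def scalar_prod_def\<close>)
  also have "A * 0\<^sub>m d 1 + B * 1\<^sub>m 1 = B" using c by simp
  also have "C * 0\<^sub>m d 1 + D * 1\<^sub>m 1 = D" using c by simp
  finally have KT: "K * ?T = four_block_mat ?S B (0\<^sub>m 1 d) D" .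
  have "Determinant.det K = Determinant.det (K * ?T)" using det_mult[OF K T] dT by simp
  also have "\<dots> = Determinant.det ?S * Determinant.det D"
    unfolding KT by (rule det_four_block_mat_lower_left_zero) (use c in auto)
  also have "Determinant.det D = ?a" by (simp add: D_def det_single)
  finally show ?thesis by simp
qed

lemma quad_form_Suc:
  assumes sym: "\<And>i. i < d \<Longrightarrow> K $$ (d, i) = K $$ (i, d)"
  shows "quad_form (Suc d) K z = quad_form d K z + 2 * z d * (\<Sum>i<d. K $$ (i, d) * z i) + K $$ (d, d) * (z d)\<^sup>2"
proof -
  have "(\<Sum>j<d. K $$ (d, j) * z d * z j) = z d * (\<Sum>i<d. K $$ (i, d) * z i)"
    using sym by (simp add: sum_distrib_left mult_ac)
  moreover have "(\<Sum>i<d. K $$ (i, d) * z i * z d) = z d * (\<Sum>i<d. K $$ (i, d) * z i)"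
    by (simp add: sum_distrib_left mult_ac)
  ultimately show ?thesis by (simp add: quad_form_def sum.distrib power2_eq_square)
qed

lemma quad_form_schur:
  assumes sym: "\<And>i. i < d \<Longrightarrow> K $$ (d, i) = K $$ (i, d)"
  shows "quad_form d (mat d d (\<lambda>(i, j). K $$ (i, j) - K $$ (i, d) * K $$ (d, j) / K $$ (d, d))) z
    = quad_form d K z - (\<Sum>i<d. K $$ (i, d) * z i)\<^sup>2 / K $$ (d, d)"
proof -
  have "(\<Sum>i<d. K $$ (i, d) * z i)\<^sup>2 / K $$ (d, d)
      = (\<Sum>i<d. \<Sum>j<d. K $$ (i, d) * K $$ (d, j) / K $$ (d, d) * z i * z j)"
    using sym by (auto simp: power2_eq_square sum_product sum_divide_distrib intro!: sum.cong)
  then show ?thesis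
    by (auto simp: quad_form_def sum_subtractf[symmetric] algebra_simps intro!: sum.cong)
qed

text \<open>By induction on the dimension.  Integrating out the last coordinate completes a square and leaves
the normal integral for the Schur complement of the last diagonal entry, which is positive definite
again; the determinant loses the same factor.\<close>

lemma nn_integral_gaussian:
  assumes "pos_def_mat d K"
  shows "Determinant.det K > 0 \<and> (\<integral>\<^sup>+ x. ennreal (exp (- quad_form d K (\<lambda>i. x i - \<mu> i) / 2)) \<partial>lborel_pow d)
     = ennreal ((2 * pi) powr (real d / 2) / sqrt (Determinant.det K))"
  using assms
proof (induction d arbitrary: K)
  case 0
  have "K \<in> carrier_mat 0 0" using 0 by (simp add: pos_def_mat_def)
  then have "Determinant.det K = 1" by simp
  then show ?case by (simp add: quad_form_def PiM_empty nn_integral_count_space_finite)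
next
  case (Suc d)
  note K = Suc.prems[unfolded pos_def_mat_iff]
  define a where "a = K $$ (d, d)"
  have sym: "K $$ (d, i) = K $$ (i, d)" if "i < d" for i using K that by auto
  let ?S = "mat d d (\<lambda>(i, j). K $$ (i, j) - K $$ (i, d) * K $$ (d, j) / K $$ (d, d))"
  have a: "a > 0"
  proof -
    let ?z = "\<lambda>i. if i = d then 1 else 0 :: real"
    have "quad_form (Suc d) K ?z > 0" using K by (metis (mono_tags) lessI zero_neq_one)
    moreover have "quad_form d K ?z = 0" by (simp add: quad_form_def)
    moreover have "(\<Sum>i<d. K $$ (i, d) * ?z i) = 0" by (intro sum.neutral) auto
    ultimately show ?thesis by (simp add: quad_form_Suc[of d K, OF sym] a_def)
  qed
  have S: "pos_def_mat d ?S"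
    unfolding pos_def_mat_iff
  proof (intro conjI allI impI)
    fix z :: "nat \<Rightarrow> real" assume z: "\<exists>i<d. z i \<noteq> 0"
    let ?k = "\<Sum>i<d. K $$ (i, d) * z i"
    \<comment> \<open>the last coordinate minimizes the form for given \<open>z\<close>, and the minimum is the Schur complement\<close>
    let ?z = "z(d := - ?k / a)"
    have "\<exists>i<Suc d. ?z i \<noteq> 0" using z by auto
    then have "quad_form (Suc d) K ?z > 0" using K by blast
    moreover have "quad_form d K ?z = quad_form d K z" by (auto simp: quad_form_def intro!: sum.cong)
    moreover have "(\<Sum>i<d. K $$ (i, d) * ?z i) = ?k" by (auto intro!: sum.cong)
    ultimately have "quad_form d K z + 2 * (- ?k / a) * ?k + a * (- ?k / a)\<^sup>2 > 0"
      by (simp add: quad_form_Suc[of d K, OF sym] a_def)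
    then have "quad_form d K z - ?k\<^sup>2 / a > 0" using a by (simp add: power2_eq_square field_simps)
    then show "quad_form d ?S z > 0" by (simp add: quad_form_schur[of d K, OF sym] a_def)
  qed (use K in auto)
  have det: "Determinant.det K = a * Determinant.det ?S"
    unfolding a_def by (rule det_schur) (use K a a_def in auto)
  interpret product_sigma_finite "\<lambda>_::nat. lborel :: real measure" by unfold_locales
  have inner: "(\<integral>\<^sup>+ y. ennreal (exp (- quad_form (Suc d) K (\<lambda>i. (x(d := y)) i - \<mu> i) / 2)) \<partial>lborel)
     = ennreal (sqrt (2 * pi / a)) * ennreal (exp (- quad_form d ?S (\<lambda>i. x i - \<mu> i) / 2))" for x
  proof -
    let ?z = "\<lambda>i. x i - \<mu> i"
    let ?k = "\<Sum>i<d. K $$ (i, d) * ?z i"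
    have q: "- quad_form (Suc d) K (\<lambda>i. (x(d := y)) i - \<mu> i) / 2
       = - quad_form d K ?z / 2 + (- (a * (y - \<mu> d)\<^sup>2) / 2 + (- ?k) * (y - \<mu> d))" for y
    proof -
      have "quad_form d K (\<lambda>i. (x(d := y)) i - \<mu> i) = quad_form d K ?z"
        by (auto simp: quad_form_def intro!: sum.cong)
      moreover have "(\<Sum>i<d. K $$ (i, d) * ((x(d := y)) i - \<mu> i)) = ?k" by (auto intro!: sum.cong)
      ultimately have "quad_form (Suc d) K (\<lambda>i. (x(d := y)) i - \<mu> i)
          = quad_form d K ?z + 2 * (y - \<mu> d) * ?k + a * (y - \<mu> d)\<^sup>2"
        unfolding a_def by (simp only: quad_form_Suc[of d K, OF sym] fun_upd_same)
      moreover have "- (r + 2 * w * k + a * w\<^sup>2) / 2 = - r / 2 + (- (a * w\<^sup>2) / 2 + (- k) * w)" for r w k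
        by (simp add: field_simps)
      ultimately show ?thesis by (simp only:)
    qed
    have "(\<integral>\<^sup>+ y. ennreal (exp (- quad_form (Suc d) K (\<lambda>i. (x(d := y)) i - \<mu> i) / 2)) \<partial>lborel)
      = (\<integral>\<^sup>+ y. ennreal (exp (- quad_form d K ?z / 2)) *
          ennreal (exp (- (a * (y - \<mu> d)\<^sup>2) / 2 + (- ?k) * (y - \<mu> d))) \<partial>lborel)"
      unfolding q exp_add by (simp add: ennreal_mult)
    also have "\<dots> = ennreal (exp (- quad_form d K ?z / 2)) * ennreal (sqrt (2 * pi / a) * exp ((- ?k)\<^sup>2 / (2 * a)))"
      by (subst nn_integral_cmult) (simp_all only: nn_integral_gaussian_1d[OF a], measurable)
    also have "\<dots> = ennreal (sqrt (2 * pi / a)) * ennreal (exp (- quad_form d K ?z / 2 + (- ?k)\<^sup>2 / (2 * a)))"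
      unfolding exp_add using a by (simp add: ennreal_mult mult.left_commute)
    also have "- quad_form d K ?z / 2 + (- ?k)\<^sup>2 / (2 * a) = - quad_form d ?S ?z / 2"
      by (simp add: quad_form_schur[of d K, OF sym] a_def diff_divide_distrib)
    finally show ?thesis .
  qed
  have meas: "(\<lambda>x. ennreal (exp (- quad_form (Suc d) K (\<lambda>i. x i - \<mu> i) / 2))) \<in> borel_measurable (lborel_pow (Suc d))"
    unfolding quad_form_def by measurable
  have "(\<integral>\<^sup>+ x. ennreal (exp (- quad_form (Suc d) K (\<lambda>i. x i - \<mu> i) / 2)) \<partial>lborel_pow (Suc d))
     = (\<integral>\<^sup>+ x. (\<integral>\<^sup>+ y. ennreal (exp (- quad_form (Suc d) K (\<lambda>i. (x(d := y)) i - \<mu> i) / 2)) \<partial>lborel) \<partial>lborel_pow d)"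
    using product_nn_integral_insert[of "{..<d}" d "\<lambda>x. ennreal (exp (- quad_form (Suc d) K (\<lambda>i. x i - \<mu> i) / 2))"] meas
    by (simp add: lessThan_Suc)
  also have "\<dots> = ennreal (sqrt (2 * pi / a)) *
      (\<integral>\<^sup>+ x. ennreal (exp (- quad_form d ?S (\<lambda>i. x i - \<mu> i) / 2)) \<partial>lborel_pow d)"
    unfolding inner by (rule nn_integral_cmult) (unfold quad_form_def, measurable)
  also have "\<dots> = ennreal (sqrt (2 * pi / a)) * ennreal ((2 * pi) powr (real d / 2) / sqrt (Determinant.det ?S))"
    using Suc.IH[OF S] by simp
  also have "\<dots> = ennreal ((2 * pi) powr (real (Suc d) / 2) / sqrt (Determinant.det K))"
  proof -
    have "(2 * pi) powr (real (Suc d) / 2) = (2 * pi) powr (1 / 2) * (2 * pi) powr (real d / 2)"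
      by (simp add: powr_add[symmetric] add_divide_distrib)
    also have "(2 * pi) powr (1 / 2) = sqrt (2 * pi)" by (simp add: powr_half_sqrt)
    finally show ?thesis using a Suc.IH[OF S] unfolding det
      by (simp add: ennreal_mult[symmetric] real_sqrt_mult real_sqrt_divide)
  qed
  finally show ?case using a Suc.IH[OF S] unfolding det by simp
qed

lemma pos_def_inverse:
  assumes "pos_def_mat d S"
  shows "inv_mat S \<in> carrier_mat d d" "S * inv_mat S = 1\<^sub>m d" "inv_mat S * S = 1\<^sub>m d"
    "pos_def_mat d (inv_mat S)" "Determinant.det S = 1 / Determinant.det (inv_mat S)"
proof -
  have S: "S \<in> carrier_mat d d" "transpose_mat S = S"
    "\<And>v. v \<in> carrier_vec d \<Longrightarrow> v \<noteq> 0\<^sub>v d \<Longrightarrow> scalar_prod v (S *\<^sub>v v) > 0"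
    using assms by (auto simp: pos_def_mat_def)
  have "Determinant.det S > 0" using nn_integral_gaussian[OF assms] by blast
  then have "S \<in> Units (ring_mat TYPE(real) d ())"
    using det_non_zero_imp_unit[OF S(1)] by simp
  then obtain K where K: "mat_inverse S = Some K" using mat_inverse(1)[OF S(1), where b = "()"] by (cases "mat_inverse S") auto
  from mat_inverse(2)[OF S(1) K] have K': "S * K = 1\<^sub>m d" "K * S = 1\<^sub>m d" "K \<in> carrier_mat d d" by auto
  show c: "inv_mat S \<in> carrier_mat d d" "S * inv_mat S = 1\<^sub>m d" "inv_mat S * S = 1\<^sub>m d"
    using K K' by simp_all
  have "Determinant.det S * Determinant.det (inv_mat S) = 1"
    using det_mult[OF S(1) c(1)] c(2) by simp
  then show "Determinant.det S = 1 / Determinant.det (inv_mat S)"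
    by (metis mult_zero_right nonzero_eq_divide_eq zero_neq_one)
  let ?K = "inv_mat S"
  have "transpose_mat ?K = transpose_mat ?K * (S * ?K)" using c by simp
  also have "\<dots> = (transpose_mat ?K * transpose_mat S) * ?K"
    unfolding S(2) using c S(1) by (intro assoc_mult_mat[symmetric]) auto
  also have "transpose_mat ?K * transpose_mat S = transpose_mat (S * ?K)"
    using transpose_mult[OF S(1) c(1)] by simp
  also have "\<dots> = 1\<^sub>m d" using c by simp
  finally have t: "transpose_mat ?K = ?K" using c by simp
  have "scalar_prod v (?K *\<^sub>v v) > 0" if v: "v \<in> carrier_vec d" "v \<noteq> 0\<^sub>v d" for v
  proof -
    let ?w = "?K *\<^sub>v v"
    have w: "?w \<in> carrier_vec d" using c v by simp
    have Sw: "S *\<^sub>v ?w = v"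
      using assoc_mult_mat_vec[OF S(1) c(1) v(1)] c(2) v(1) by simp
    have "?w \<noteq> 0\<^sub>v d"
    proof
      assume "?w = 0\<^sub>v d"
      then have "v = S *\<^sub>v 0\<^sub>v d" using Sw by simp
      also have "\<dots> = 0\<^sub>v d" using S(1) by auto
      finally show False using v by simp
    qed
    then have "scalar_prod ?w (S *\<^sub>v ?w) > 0" by (rule S(3)[OF w])
    then show ?thesis unfolding Sw using comm_scalar_prod[OF w v(1)] by simp
  qed
  then show "pos_def_mat d ?K" using c t by (simp add: pos_def_mat_def)
qed

lemma inv_mat_involution:
  assumes "pos_def_mat d S"
  shows "inv_mat (inv_mat S) = S"
proof -
  note i = pos_def_inverse[OF assms] and j = pos_def_inverse[OF pos_def_inverse(4)[OF assms]]
  have S: "S \<in> carrier_mat d d" using assms by (simp add: pos_def_mat_def)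
  have "inv_mat (inv_mat S) = (S * inv_mat S) * inv_mat (inv_mat S)" using i j by simp
  also have "\<dots> = S * (inv_mat S * inv_mat (inv_mat S))" by (rule assoc_mult_mat[OF S i(1) j(1)])
  also have "\<dots> = S" using S j by simp
  finally show ?thesis .
qed

lemma mvn_density_eq:
  assumes "\<mu> \<in> carrier_vec d" "pos_def_mat d S"
  shows "mvn_density d \<mu> S x = exp (- quad_form d (inv_mat S) (\<lambda>i. x i - \<mu> $ i) / 2) /
      ((2 * pi) powr (real d / 2) / sqrt (Determinant.det (inv_mat S)))"
proof -
  note i = pos_def_inverse[OF assms(2)]
  have "scalar_prod (Matrix.vec d x - \<mu>) (inv_mat S *\<^sub>v (Matrix.vec d x - \<mu>))
      = quad_form d (inv_mat S) (\<lambda>i. (Matrix.vec d x - \<mu>) $ i)"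
    using i assms by (intro scalar_prod_mult_mat_vec) auto
  also have "\<dots> = quad_form d (inv_mat S) (\<lambda>i. x i - \<mu> $ i)"
    using assms unfolding quad_form_def by (intro sum.cong) auto
  finally show ?thesis unfolding mvn_density_def i(5) by (simp add: real_sqrt_divide)
qed

lemma prob_density_mvn:
  assumes "\<mu> \<in> carrier_vec d" "pos_def_mat d S"
  shows "prob_density (lborel_pow d) (mvn_density d \<mu> S)"
proof -
  define q where "q = (\<lambda>x. exp (- quad_form d (inv_mat S) (\<lambda>i. x i - \<mu> $ i) / 2))"
  define c where "c = (2 * pi) powr (real d / 2) / sqrt (Determinant.det (inv_mat S))"
  note g = nn_integral_gaussian[OF pos_def_inverse(4)[OF assms(2)], of "\<lambda>i. \<mu> $ i"]
  have c: "c > 0" using g by (simp add: c_def)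
  have int: "(\<integral>\<^sup>+ x. ennreal (q x) \<partial>lborel_pow d) = ennreal c" unfolding q_def c_def using g by blast
  have eq: "mvn_density d \<mu> S = (\<lambda>x. q x / c)"
    using mvn_density_eq[OF assms] by (simp add: fun_eq_iff q_def c_def)
  have m: "q \<in> borel_measurable (lborel_pow d)"
    unfolding q_def quad_form_def by measurable
  have q: "q x \<ge> 0" for x by (simp add: q_def)
  have "(\<integral>\<^sup>+ x. ennreal (q x / c) \<partial>lborel_pow d) = (\<integral>\<^sup>+ x. ennreal (q x) / ennreal c \<partial>lborel_pow d)"
    using c q by (simp add: divide_ennreal)
  also have "\<dots> = (\<integral>\<^sup>+ x. ennreal (q x) \<partial>lborel_pow d) / ennreal c"
    by (rule nn_integral_divide[OF measurable_compose[OF m measurable_ennreal]])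
  also have "\<dots> = 1" unfolding int using c by (simp add: divide_ennreal)
  finally show ?thesis unfolding prob_density_def eq using m c q by auto
qed

section \<open>Upper bounds for normal and Ising models\<close>

text \<open>The additional coordinate \<open>1\<close> makes linear and constant terms products of two coordinates.\<close>

definition coord :: "nat \<Rightarrow> (nat \<Rightarrow> real) \<Rightarrow> nat \<Rightarrow> real" where
  "coord d x i = (if i < d then x i else 1)"

definition monomial :: "nat \<Rightarrow> (nat \<Rightarrow> real) \<Rightarrow> nat \<times> nat \<Rightarrow> real" where
  "monomial d x p = coord d x (fst p) * coord d x (snd p)"

definition edge_pairs :: "nat \<Rightarrow> nat set set \<Rightarrow> (nat \<times> nat) set" where
  "edge_pairs d E = {(i, j). i < j \<and> j < d \<and> {i, j} \<in> E}"

text \<open>Both orders of an edge are listed, so that the entries of a symmetric matrix serve directly as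
coefficients.\<close>

definition quad_support :: "nat \<Rightarrow> nat set set \<Rightarrow> (nat \<times> nat) set" where
  "quad_support d E = {(i, j). i < d \<and> j < d \<and> (i = j \<or> {i, j} \<in> E)}"

definition model_support :: "nat \<Rightarrow> nat set set \<Rightarrow> (nat \<times> nat) set" where
  "model_support d E = quad_support d E \<union> (\<lambda>i. (i, d)) ` {..d}"

lemma finite_quad_support: "finite (quad_support d E)"
  by (rule finite_subset[of _ "{..<d} \<times> {..<d}"]) (auto simp: quad_support_def)

lemma bij_edge_pairs:
  assumes "E \<in> graphs d m"
  shows "bij_betw (\<lambda>(i, j). {i, j}) (edge_pairs d E) E"
proof (rule bij_betwI')
  fix p q assume "p \<in> edge_pairs d E" "q \<in> edge_pairs d E"
  then show "((\<lambda>(i, j). {i, j}) p = (\<lambda>(i, j). {i, j}) q) = (p = q)"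
    by (auto simp: edge_pairs_def doubleton_eq_iff split: prod.splits)
next
  fix p assume "p \<in> edge_pairs d E"
  then show "(\<lambda>(i, j). {i, j}) p \<in> E" by (auto simp: edge_pairs_def)
next
  fix e assume e: "e \<in> E"
  then have "card e = 2" "e \<subseteq> {..<d}" using assms by (auto simp: graphs_def)
  then obtain a b where ab: "e = {a, b}" "a \<noteq> b" by (auto simp: card_2_iff)
  define i j where "i = min a b" and "j = max a b"
  have "e = {i, j}" "i < j" using ab by (auto simp: i_def j_def min_def max_def)
  moreover have "j < d" using \<open>e \<subseteq> {..<d}\<close> \<open>e = {i, j}\<close> by auto
  ultimately have "(i, j) \<in> edge_pairs d E" "e = (\<lambda>(i, j). {i, j}) (i, j)" using e by (auto simp: edge_pairs_def)
  then show "\<exists>x\<in>edge_pairs d E. e = (\<lambda>(i, j). {i, j}) x" by blast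
qed

lemma card_model_support:
  assumes "E \<in> graphs d m"
  shows "finite (model_support d E) \<and> card (model_support d E) \<le> 2 * m + 2 * d + 1"
proof
  show "finite (model_support d E)" by (simp add: model_support_def finite_quad_support)
  have cE: "card (edge_pairs d E) = m"
    using bij_betw_same_card[OF bij_edge_pairs[OF assms]] assms by (simp add: graphs_def)
  have fe: "finite (edge_pairs d E)"
    by (rule finite_subset[of _ "{..<d} \<times> {..<d}"]) (auto simp: edge_pairs_def)
  have sub: "model_support d E \<subseteq> (edge_pairs d E \<union> prod.swap ` edge_pairs d E) \<union>
      ((\<lambda>i. (i, i)) ` {..<d} \<union> (\<lambda>i. (i, d)) ` {..d})" (is "_ \<subseteq> (?A \<union> ?B) \<union> (?C \<union> ?D)")
  proof
    fix p assume p: "p \<in> model_support d E"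
    obtain i j where ij: "p = (i, j)" by (cases p)
    show "p \<in> (?A \<union> ?B) \<union> (?C \<union> ?D)"
    proof (cases "p \<in> ?D")
      case False
      then have q: "i < d" "j < d" "i = j \<or> {i, j} \<in> E"
        using p ij by (auto simp: model_support_def quad_support_def)
      consider "i = j" | "i < j" | "j < i" by linarith
      then show ?thesis
      proof cases
        case 3
        then have "(j, i) \<in> edge_pairs d E" using q by (auto simp: edge_pairs_def insert_commute)
        then have "prod.swap (j, i) \<in> ?B" by (rule imageI)
        then show ?thesis using ij by simp
      qed (use q ij in \<open>auto simp: edge_pairs_def\<close>)
    qed simp
  qed
  have "card (model_support d E) \<le> card ((?A \<union> ?B) \<union> (?C \<union> ?D))"
    using fe by (intro card_mono sub) auto
  also have "\<dots> \<le> card (?A \<union> ?B) + card (?C \<union> ?D)" by (rule card_Un_le)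
  also have "\<dots> \<le> (card ?A + card ?B) + (card ?C + card ?D)" by (intro add_mono card_Un_le)
  also have "\<dots> \<le> (m + m) + (d + Suc d)"
    using card_image_le[OF fe, of prod.swap] card_image_le[of "{..<d}" "\<lambda>i. (i, i)"]
      card_image_le[of "{..d}" "\<lambda>i. (i, d)"] cE by (intro add_mono) simp_all
  finally show "card (model_support d E) \<le> 2 * m + 2 * d + 1" by simp
qed

lemma card_graphs: "card (graphs d m) = (d choose 2) choose m"
proof -
  have f: "finite {e. e \<subseteq> {..<d} \<and> card e = 2}" by (rule finite_subset[of _ "Pow {..<d}"]) auto
  have "card {e. e \<subseteq> {..<d} \<and> card e = 2} = d choose 2"
    using n_subsets[of "{..<d}" 2] by simp
  then show ?thesis unfolding graphs_def using n_subsets[OF f, of m] by simp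
qed

lemma finite_graphs: "finite (graphs d m)"
  by (rule finite_subset[of _ "Pow (Pow {..<d})"]) (auto simp: graphs_def)

lemma sum_model_support:
  assumes \<theta>: "\<And>i j. \<theta> (i, j) = (if j < d then q i j else if i < d then l i else c)"
  shows "(\<Sum>p\<in>model_support d E. \<theta> p * monomial d x p)
    = (\<Sum>(i, j)\<in>quad_support d E. q i j * x i * x j) + (\<Sum>i<d. l i * x i) + c"
proof -
  have "(\<Sum>p\<in>model_support d E. \<theta> p * monomial d x p) =
     (\<Sum>p\<in>quad_support d E. \<theta> p * monomial d x p) + (\<Sum>p\<in>(\<lambda>i. (i, d)) ` {..d}. \<theta> p * monomial d x p)"
    unfolding model_support_def
    by (rule sum.union_disjoint) (auto simp: finite_quad_support, auto simp: quad_support_def)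
  also have "(\<Sum>p\<in>quad_support d E. \<theta> p * monomial d x p) = (\<Sum>(i, j)\<in>quad_support d E. q i j * x i * x j)"
    by (rule sum.cong) (auto simp: quad_support_def monomial_def coord_def \<theta>)
  also have "(\<Sum>p\<in>(\<lambda>i. (i, d)) ` {..d}. \<theta> p * monomial d x p) = (\<Sum>i\<le>d. \<theta> (i, d) * monomial d x (i, d))"
    by (subst sum.reindex) (auto simp: inj_on_def)
  also have "\<dots> = (\<Sum>i<d. l i * x i) + c"
    by (auto simp: lessThan_Suc_atMost[symmetric] monomial_def coord_def \<theta> intro!: sum.cong)
  finally show ?thesis by simp
qed

lemma normal_class_exp_density:
  assumes "f \<in> normal_class d m"
  shows "prob_density (lborel_pow d) f \<and>
    (\<exists>S\<in>model_support d ` graphs d m. \<exists>\<theta>. \<forall>x\<in>space (lborel_pow d). f x = exp_density (monomial d) S \<theta> x)"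
proof -
  obtain E \<mu> \<Sigma> where E: "E \<in> graphs d m" and f: "f = mvn_density d \<mu> \<Sigma>" and \<mu>: "\<mu> \<in> carrier_vec d"
    and \<Sigma>: "pos_def_mat d \<Sigma>"
    and zero: "\<And>i j. i < d \<Longrightarrow> j < d \<Longrightarrow> i \<noteq> j \<Longrightarrow> {i, j} \<notin> E \<Longrightarrow> inv_mat \<Sigma> $$ (i, j) = 0"
    using assms by (auto simp: normal_class_def normal_graph_class_def)
  define K where "K = inv_mat \<Sigma>"
  have symK: "K $$ (i, j) = K $$ (j, i)" if "i < d" "j < d" for i j
    using pos_def_inverse(4)[OF \<Sigma>] that by (auto simp: pos_def_mat_iff K_def)
  define c where "c = (2 * pi) powr (real d / 2) / sqrt (Determinant.det K)"
  have c: "c > 0" using nn_integral_gaussian[OF pos_def_inverse(4)[OF \<Sigma>]] by (simp add: c_def K_def)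
  define l where "l = (\<lambda>i. \<Sum>j<d. K $$ (i, j) * \<mu> $ j)"
  define r where "r = quad_form d K (\<lambda>i. \<mu> $ i)"
  define \<theta> where "\<theta> = (\<lambda>(i, j). if j < d then - K $$ (i, j) / 2 else if i < d then l i else - r / 2 - ln c)"
  have "f x = exp_density (monomial d) (model_support d E) \<theta> x" for x
  proof -
    let ?q = "\<Sum>i<d. \<Sum>j<d. K $$ (i, j) * x i * x j"
    have "(\<Sum>i<d. \<Sum>j<d. K $$ (i, j) * \<mu> $ i * x j) = (\<Sum>j<d. \<Sum>i<d. K $$ (i, j) * \<mu> $ i * x j)"
      by (rule sum.swap)
    also have "\<dots> = (\<Sum>i<d. l i * x i)"
      unfolding l_def sum_distrib_right using symK by (intro sum.cong refl) auto
    finally have l1: "(\<Sum>i<d. \<Sum>j<d. K $$ (i, j) * \<mu> $ i * x j) = (\<Sum>i<d. l i * x i)" .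
    have l2: "(\<Sum>i<d. \<Sum>j<d. K $$ (i, j) * x i * \<mu> $ j) = (\<Sum>i<d. l i * x i)"
      unfolding l_def sum_distrib_right by (intro sum.cong refl) (simp add: mult_ac)
    have "quad_form d K (\<lambda>i. x i - \<mu> $ i) = ?q - (\<Sum>i<d. \<Sum>j<d. K $$ (i, j) * \<mu> $ i * x j)
       - (\<Sum>i<d. \<Sum>j<d. K $$ (i, j) * x i * \<mu> $ j) + r"
      unfolding quad_form_def r_def sum_subtractf[symmetric] sum.distrib[symmetric]
      by (intro sum.cong refl) (simp add: algebra_simps)
    then have q: "quad_form d K (\<lambda>i. x i - \<mu> $ i) = ?q - 2 * (\<Sum>i<d. l i * x i) + r"
      unfolding l1 l2 by simp
    have "(\<Sum>(i, j)\<in>quad_support d E. - K $$ (i, j) / 2 * x i * x j) = (\<Sum>(i, j)\<in>{..<d} \<times> {..<d}. - K $$ (i, j) / 2 * x i * x j)"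
    proof (rule sum.mono_neutral_left)
      show "\<forall>p\<in>{..<d} \<times> {..<d} - quad_support d E. (case p of (i, j) \<Rightarrow> - K $$ (i, j) / 2 * x i * x j) = 0"
        using zero by (fastforce simp: quad_support_def K_def)
    qed (auto simp: quad_support_def)
    also have "\<dots> = - ?q / 2"
      by (simp add: sum.cartesian_product[symmetric] sum_negf[symmetric] sum_divide_distrib)
    finally have sq: "(\<Sum>(i, j)\<in>quad_support d E. - K $$ (i, j) / 2 * x i * x j) = - ?q / 2" .
    have s: "(\<Sum>p\<in>model_support d E. \<theta> p * monomial d x p) = - ?q / 2 + (\<Sum>i<d. l i * x i) + (- r / 2 - ln c)"
    proof -
      have "\<theta> (i, j) = (if j < d then - K $$ (i, j) / 2 else if i < d then l i else - r / 2 - ln c)" for i j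
        by (simp add: \<theta>_def)
      from sum_model_support[of \<theta> d "\<lambda>i j. - K $$ (i, j) / 2" l "- r / 2 - ln c" x E, OF this]
      show ?thesis by (simp only: sq)
    qed
    have "f x = exp (- quad_form d K (\<lambda>i. x i - \<mu> $ i) / 2) / c"
      using mvn_density_eq[OF \<mu> \<Sigma>, of x] by (simp add: f K_def c_def)
    also have "\<dots> = exp (- quad_form d K (\<lambda>i. x i - \<mu> $ i) / 2 - ln c)" using c by (simp add: exp_diff)
    also have "- quad_form d K (\<lambda>i. x i - \<mu> $ i) / 2 - ln c = (\<Sum>p\<in>model_support d E. \<theta> p * monomial d x p)"
      unfolding s q by (simp add: field_simps)
    finally show ?thesis by (simp add: exp_density_def)
  qed
  then show ?thesis using E prob_density_mvn[OF \<mu> \<Sigma>] f by blast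
qed

lemma finite_cube: "finite (cube d)"
  by (simp add: cube_def finite_PiE)

lemma cube_nonempty: "cube d \<noteq> {}"
  by (simp add: cube_def PiE_eq_empty_iff)

lemma prob_density_count_space:
  assumes "finite A" "\<And>x. x \<in> A \<Longrightarrow> 0 \<le> f x"
  shows "prob_density (count_space A) f \<longleftrightarrow> (\<Sum>x\<in>A. f x) = 1"
proof -
  have "(\<integral>\<^sup>+ x. ennreal (f x) \<partial>count_space A) = ennreal (\<Sum>x\<in>A. f x)"
    using assms by (simp add: nn_integral_count_space_finite sum_ennreal)
  then show ?thesis using assms(2) by (simp add: prob_density_def)
qed

lemma prob_density_ising: "prob_density (count_space (cube d)) (ising_pmf d E w h)"
proof -
  have "(\<Sum>y\<in>cube d. ising_weight d E w h y) > 0"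
    using finite_cube cube_nonempty by (intro sum_pos) (auto simp: ising_weight_def)
  then show ?thesis
    by (subst prob_density_count_space)
       (auto simp: finite_cube ising_pmf_def ising_weight_def sum_divide_distrib[symmetric] intro!: divide_nonneg_nonneg sum_nonneg)
qed

lemma ising_class_exp_density:
  assumes "f \<in> ising_class d m"
  shows "prob_density (count_space (cube d)) f \<and>
    (\<exists>S\<in>model_support d ` graphs d m. \<exists>\<theta>. \<forall>x\<in>space (count_space (cube d)). f x = exp_density (monomial d) S \<theta> x)"
proof -
  obtain E w h where E: "E \<in> graphs d m" and f: "f = ising_pmf d E w h"
    using assms by (auto simp: ising_class_def ising_graph_class_def)
  define Z where "Z = (\<Sum>y\<in>cube d. ising_weight d E w h y)"
  have Z: "Z > 0" unfolding Z_def
    using finite_cube cube_nonempty by (intro sum_pos) (auto simp: ising_weight_def)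
  define q where "q = (\<lambda>i j. if (i, j) \<in> edge_pairs d E then w {i, j} else 0 :: real)"
  define \<theta> where "\<theta> = (\<lambda>(i, j). if j < d then q i j else if i < d then h i else - ln Z)"
  have "f x = exp_density (monomial d) (model_support d E) \<theta> x" for x
  proof -
    have "(\<Sum>(i, j)\<in>quad_support d E. q i j * x i * x j) = (\<Sum>(i, j)\<in>edge_pairs d E. q i j * x i * x j)"
      by (rule sum.mono_neutral_right[OF finite_quad_support])
         (auto simp: quad_support_def edge_pairs_def q_def split: if_splits)
    also have "\<dots> = (\<Sum>p\<in>edge_pairs d E. (\<lambda>e. w e * (\<Prod>i\<in>e. x i)) ((\<lambda>(i, j). {i, j}) p))"
      by (rule sum.cong) (auto simp: q_def edge_pairs_def)
    also have "\<dots> = (\<Sum>e\<in>E. w e * (\<Prod>i\<in>e. x i))"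
      by (rule sum.reindex_bij_betw[OF bij_edge_pairs[OF E]])
    finally have s: "(\<Sum>p\<in>model_support d E. \<theta> p * monomial d x p)
        = (\<Sum>e\<in>E. w e * (\<Prod>i\<in>e. x i)) + (\<Sum>i<d. h i * x i) + - ln Z"
      using sum_model_support[of \<theta> d q h "- ln Z" x E] by (simp add: \<theta>_def)
    have "f x = ising_weight d E w h x / Z" by (simp add: f ising_pmf_def Z_def)
    then show ?thesis unfolding exp_density_def s exp_add exp_minus exp_ln[OF Z]
      by (simp add: ising_weight_def exp_add divide_inverse)
  qed
  then show ?thesis using E prob_density_ising f by blast
qed

text \<open>There are at most \<open>d ^ (2 * m)\<close> supports, and the dimension is of order \<open>m + d \<le> d\<^sup>2\<close>, so
that its logarithm is a multiple of \<open>ln d\<close>.\<close>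

lemma growth_entropy_model_le:
  assumes d: "d \<ge> 2" and m: "m \<le> d choose 2"
  shows "growth_entropy ((real (card (model_support d ` graphs d m)))\<^sup>2) (2 * (2 * m + 2 * d + 1))
      \<le> 92 * ((real m + real d) * ln (real d))"
proof -
  let ?c = "card (model_support d ` graphs d m)"
  have ln_d: "0 \<le> ln (real d)" using d by simp
  have "d choose 2 \<le> d ^ 2" using binomial_le_pow[OF d] .
  have "?c \<le> card (graphs d m)" by (intro card_image_le finite_graphs)
  also have "\<dots> \<le> (d choose 2) ^ m" unfolding card_graphs by (rule binomial_le_pow[OF m])
  also have "\<dots> \<le> (d ^ 2) ^ m" using \<open>d choose 2 \<le> d ^ 2\<close> by (rule power_mono) simp
  finally have c: "?c \<le> d ^ (2 * m)" by (simp add: power_mult)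
  have "ln (real ?c) \<le> 2 * m * ln (real d)"
  proof (cases "?c = 0")
    case False
    then have "ln (real ?c) \<le> ln (real (d ^ (2 * m)))" using c by (subst ln_le_cancel_iff) (use d in auto)
    then show ?thesis using d by (simp add: ln_realpow)
  qed (use ln_d in simp)
  moreover have "ln ((real ?c)\<^sup>2) = 2 * ln (real ?c)"
    by (cases "?c = 0") (simp_all add: ln_realpow)
  ultimately have L: "ln ((real ?c)\<^sup>2) \<le> 4 * m * ln (real d)" by simp
  have "even (d * (d - 1))" by (cases "even d") auto
  then have "2 * (d choose 2) = d * (d - 1)" by (simp add: choose_two)
  then have "2 * m + 2 * d \<le> d * (d - 1) + 2 * d" using m by simp
  also have "\<dots> \<le> 2 * d\<^sup>2" using d by (cases d) (auto simp: power2_eq_square)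
  finally have md: "m + d \<le> d\<^sup>2" by simp
  let ?V = "2 * (2 * m + 2 * d + 1)"
  have V: "?V \<le> 6 * (m + d)" using d by simp
  have "4 * ?V \<le> 2 ^ 5 * d\<^sup>2" using V md by simp
  also have "\<dots> \<le> d ^ 5 * d\<^sup>2" using power_mono[OF d, of 5] by (intro mult_right_mono) auto
  also have "\<dots> = d ^ 7" by (simp flip: power_add)
  finally have "real (4 * ?V) \<le> real (d ^ 7)" by (rule of_nat_mono)
  then have "ln (real (4 * ?V)) \<le> ln (real (d ^ 7))" by (subst ln_le_cancel_iff) (use d in auto)
  then have ln4V: "ln (4 * real ?V) \<le> 7 * ln (real d)" using d by (simp add: ln_realpow)
  have "2 * real ?V * ln (4 * real ?V) \<le> 2 * real ?V * (7 * ln (real d))"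
    using ln4V by (intro mult_left_mono) auto
  also have "\<dots> \<le> 2 * real (6 * (m + d)) * (7 * ln (real d))"
    using of_nat_mono[OF V, where 'a=real] ln_d by (intro mult_right_mono mult_left_mono) auto
  finally have "growth_entropy ((real ?c)\<^sup>2) ?V \<le> 2 * (4 * m * ln (real d)) + 2 * real (6 * (m + d)) * (7 * ln (real d))"
    unfolding growth_entropy_def using L by linarith
  also have "\<dots> \<le> 92 * ((real m + real d) * ln (real d))"
    using ln_d by (simp add: algebra_simps)
  finally show ?thesis .
qed

lemma upper_rate:
  assumes "d \<ge> 2" "m \<le> d choose 2" "n \<ge> 1"
    and "R \<le> ennreal (min 1 (68 * sqrt (growth_entropy ((real (card (model_support d ` graphs d m)))\<^sup>2)
              (2 * (2 * m + 2 * d + 1)) / n)))"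
  shows "R \<le> ennreal (680 * min 1 (sqrt ((real m + real d) * ln (real d) / real n)))"
proof -
  let ?y = "(real m + real d) * ln (real d) / real n"
  have "growth_entropy ((real (card (model_support d ` graphs d m)))\<^sup>2) (2 * (2 * m + 2 * d + 1)) / n \<le> 100 * ?y"
  proof -
    have "0 \<le> (real m + real d) * ln (real d)" using assms(1) by simp
    then have "growth_entropy ((real (card (model_support d ` graphs d m)))\<^sup>2) (2 * (2 * m + 2 * d + 1))
        \<le> 100 * ((real m + real d) * ln (real d))"
      using growth_entropy_model_le[OF assms(1,2)] by linarith
    then show ?thesis using divide_right_mono by fastforce
  qed
  then have "sqrt (growth_entropy ((real (card (model_support d ` graphs d m)))\<^sup>2) (2 * (2 * m + 2 * d + 1)) / n)
      \<le> sqrt (10\<^sup>2 * ?y)" by (intro real_sqrt_le_mono) simp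
  also have "\<dots> = 10 * sqrt ?y" by (simp only: real_sqrt_mult real_sqrt_abs)
  finally have "min 1 (68 * sqrt (growth_entropy ((real (card (model_support d ` graphs d m)))\<^sup>2)
              (2 * (2 * m + 2 * d + 1)) / n)) \<le> 680 * min 1 (sqrt ?y)" by (simp add: min_def)
  then show ?thesis using assms(4) ennreal_leI order_trans by blast
qed

lemma sigma_finite_lborel_pow: "sigma_finite_measure (lborel_pow d)"
proof -
  interpret product_sigma_finite "\<lambda>_::nat. lborel :: real measure" by unfold_locales
  show ?thesis by (rule sigma_finite) simp
qed

lemma sigma_finite_count_cube: "sigma_finite_measure (count_space (cube d))"
  by (rule sigma_finite_measure_count_space_finite[OF finite_cube])

theorem normal_upper_bound:
  assumes "d \<ge> 2" "m \<le> d choose 2" "n \<ge> 1"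
  shows "minimax_risk (lborel_pow d) n (normal_class d m)
           \<le> ennreal (680 * min 1 (sqrt ((real m + real d) * ln (real d) / real n)))"
proof (rule upper_rate[OF assms],
    rule minimax_risk_exponential_family_le[OF sigma_finite_lborel_pow, where \<phi> = "monomial d"])
  fix S assume "S \<in> model_support d ` graphs d m"
  then obtain E where "S = model_support d E" "E \<in> graphs d m" by auto
  then show "finite S \<and> card S \<le> 2 * m + 2 * d + 1" using card_model_support by simp
next
  fix f assume "f \<in> normal_class d m"
  note normal_class_exp_density[OF this]
  then show "prob_density (lborel_pow d) f \<and> (\<exists>S\<in>model_support d ` graphs d m.
      \<exists>\<theta>. \<forall>x\<in>space (lborel_pow d). f x = exp_density (monomial d) S \<theta> x)" .
qed (use assms(3) in \<open>simp_all add: finite_graphs\<close>)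

theorem ising_upper_bound:
  assumes "d \<ge> 2" "m \<le> d choose 2" "n \<ge> 1"
  shows "minimax_risk (count_space (cube d)) n (ising_class d m)
           \<le> ennreal (680 * min 1 (sqrt ((real m + real d) * ln (real d) / real n)))"
proof (rule upper_rate[OF assms],
    rule minimax_risk_exponential_family_le[OF sigma_finite_count_cube, where \<phi> = "monomial d"])
  fix S assume "S \<in> model_support d ` graphs d m"
  then obtain E where "S = model_support d E" "E \<in> graphs d m" by auto
  then show "finite S \<and> card S \<le> 2 * m + 2 * d + 1" using card_model_support by simp
next
  fix f assume "f \<in> ising_class d m"
  note ising_class_exp_density[OF this]
  then show "prob_density (count_space (cube d)) f \<and> (\<exists>S\<in>model_support d ` graphs d m.
      \<exists>\<theta>. \<forall>x\<in>space (count_space (cube d)). f x = exp_density (monomial d) S \<theta> x)" .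
qed (use assms(3) in \<open>simp_all add: finite_graphs\<close>)

section \<open>Testing many hypotheses\<close>

lemma PiM_density:
  assumes I: "finite I" and N: "sigma_finite_measure N" and w [measurable]: "w \<in> borel_measurable N"
    and D: "sigma_finite_measure (density N w)"
  shows "PiM I (\<lambda>_. density N w) = density (PiM I (\<lambda>_. N)) (\<lambda>s. \<Prod>i\<in>I. w (s i))"
proof -
  interpret N: product_sigma_finite "\<lambda>_. N" using N by (simp add: product_sigma_finite_def)
  interpret D: product_sigma_finite "\<lambda>_. density N w" using D by (simp add: product_sigma_finite_def)
  have s: "sets (PiM I (\<lambda>_. density N w)) = sets (PiM I (\<lambda>_. N))" by (intro sets_PiM_cong) auto
  have "density (PiM I (\<lambda>_. N)) (\<lambda>s. \<Prod>i\<in>I. w (s i)) = PiM I (\<lambda>_. density N w)"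
  proof (rule D.PiM_eqI[OF I])
    show "sets (density (PiM I (\<lambda>_. N)) (\<lambda>s. \<Prod>i\<in>I. w (s i))) = sets (PiM I (\<lambda>_. density N w))" using s by simp
    fix A assume "\<And>i. i \<in> I \<Longrightarrow> A i \<in> sets (density N w)"
    then have A: "\<And>i. i \<in> I \<Longrightarrow> A i \<in> sets N" by simp
    then have P: "Pi\<^sub>E I A \<in> sets (PiM I (\<lambda>_. N))" using I by (intro sets_PiM_I_finite) auto
    have "emeasure (density (PiM I (\<lambda>_. N)) (\<lambda>s. \<Prod>i\<in>I. w (s i))) (Pi\<^sub>E I A)
        = (\<integral>\<^sup>+ s. (\<Prod>i\<in>I. w (s i)) * indicator (Pi\<^sub>E I A) s \<partial>PiM I (\<lambda>_. N))"
      using P by (subst emeasure_density) auto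
    also have "\<dots> = (\<integral>\<^sup>+ s. (\<Prod>i\<in>I. w (s i) * indicator (A i) (s i)) \<partial>PiM I (\<lambda>_. N))"
    proof (rule nn_integral_cong)
      fix s assume "s \<in> space (PiM I (\<lambda>_. N))"
      then have "(indicator (Pi\<^sub>E I A) s :: ennreal) = (\<Prod>i\<in>I. indicator (A i) (s i))"
        using I by (auto simp: indicator_def space_PiM PiE_iff Pi_iff prod_zero_iff)
      then show "(\<Prod>i\<in>I. w (s i)) * indicator (Pi\<^sub>E I A) s = (\<Prod>i\<in>I. w (s i) * indicator (A i) (s i))"
        by (simp add: prod.distrib)
    qed
    also have "\<dots> = (\<Prod>i\<in>I. \<integral>\<^sup>+ x. w x * indicator (A i) x \<partial>N)"
      using A by (intro N.product_nn_integral_prod[OF I]) auto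
    also have "\<dots> = (\<Prod>i\<in>I. emeasure (density N w) (A i))"
      using A by (intro prod.cong refl) (simp add: emeasure_density)
    finally show "emeasure (density (PiM I (\<lambda>_. N)) (\<lambda>s. \<Prod>i\<in>I. w (s i))) (Pi\<^sub>E I A)
       = (\<Prod>i\<in>I. emeasure (density N w) (A i))" .
  qed
  then show ?thesis by simp
qed

lemma nn_integral_pair_density:
  assumes Q: "sigma_finite_measure Q" and P: "sigma_finite_measure P" and w [measurable]: "w \<in> borel_measurable P"
    and D: "sigma_finite_measure (density P w)" and h [measurable]: "h \<in> borel_measurable (Q \<Otimes>\<^sub>M P)"
  shows "(\<integral>\<^sup>+ p. h p \<partial>(Q \<Otimes>\<^sub>M density P w)) = (\<integral>\<^sup>+ p. h p * w (snd p) \<partial>(Q \<Otimes>\<^sub>M P))"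
proof -
  interpret P: sigma_finite_measure P by (rule P)
  interpret D: sigma_finite_measure "density P w" by (rule D)
  have s: "sets (Q \<Otimes>\<^sub>M density P w) = sets (Q \<Otimes>\<^sub>M P)" by (intro sets_pair_measure_cong) auto
  have hD: "h \<in> borel_measurable (Q \<Otimes>\<^sub>M density P w)"
    using h by (simp add: measurable_cong_sets[OF s refl])
  have "(\<integral>\<^sup>+ p. h p \<partial>(Q \<Otimes>\<^sub>M density P w)) = (\<integral>\<^sup>+ r. (\<integral>\<^sup>+ s. h (r, s) \<partial>density P w) \<partial>Q)"
    by (rule D.nn_integral_fst[OF hD, symmetric])
  also have "\<dots> = (\<integral>\<^sup>+ r. (\<integral>\<^sup>+ s. h (r, s) * w s \<partial>P) \<partial>Q)"
  proof (rule nn_integral_cong)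
    fix r assume "r \<in> space Q"
    then have "(\<lambda>s. h (r, s)) \<in> borel_measurable P" by measurable
    then show "(\<integral>\<^sup>+ s. h (r, s) \<partial>density P w) = (\<integral>\<^sup>+ s. h (r, s) * w s \<partial>P)"
      by (subst nn_integral_density) (auto simp: mult.commute)
  qed
  also have "\<dots> = (\<integral>\<^sup>+ p. h p * w (snd p) \<partial>(Q \<Otimes>\<^sub>M P))"
    by (subst P.nn_integral_fst[symmetric]) auto
  finally show ?thesis .
qed

text \<open>Let \<open>A \<tau>\<close> be the event that the estimate lies within \<open>r\<close> of \<open>f \<tau>\<close>.  Every outcome lies in
at most \<open>b\<close> of these events, so their probabilities under the law of \<open>n\<close> samples from \<open>p0\<close>
add up to at most \<open>b\<close>.  A change of measure, in which the likelihood ratio \<open>W\<close> enters through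
\<open>W \<le> W\<^sup>2 / (2 * \<kappa>) + \<kappa> / 2\<close>, bounds the sum of the probabilities of \<open>A \<tau>\<close> under
\<open>f \<tau>\<close> by \<open>q * card \<Theta>\<close>.  Hence for some \<open>\<tau>\<close> the error is at least \<open>r\<close> with probability
at least \<open>1 - q\<close>.\<close>

theorem minimax_risk_ge:
  fixes M :: "'a measure" and f w :: "'h \<Rightarrow> 'a \<Rightarrow> real"
  assumes M: "sigma_finite_measure M" and p0: "prob_density M p0"
    and \<Theta>: "finite \<Theta>" "\<Theta> \<noteq> {}"
    and f: "\<And>\<tau>. \<tau> \<in> \<Theta> \<Longrightarrow> prob_density M (f \<tau>)" "\<And>\<tau>. \<tau> \<in> \<Theta> \<Longrightarrow> f \<tau> \<in> F"
    and w: "\<And>\<tau>. \<tau> \<in> \<Theta> \<Longrightarrow> w \<tau> \<in> borel_measurable M" "\<And>\<tau> x. \<tau> \<in> \<Theta> \<Longrightarrow> x \<in> space M \<Longrightarrow> 0 \<le> w \<tau> x"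
      "\<And>\<tau> x. \<tau> \<in> \<Theta> \<Longrightarrow> x \<in> space M \<Longrightarrow> f \<tau> x = p0 x * w \<tau> x"
    and B: "B \<ge> 0" "\<And>\<tau>. \<tau> \<in> \<Theta> \<Longrightarrow> (\<integral>\<^sup>+ x. ennreal ((w \<tau> x)\<^sup>2) \<partial>density M (\<lambda>x. ennreal (p0 x))) \<le> ennreal B"
    and r: "r > 0"
    and b: "\<And>\<tau>. \<tau> \<in> \<Theta> \<Longrightarrow> card {\<tau>'\<in>\<Theta>. TV M (f \<tau>) (f \<tau>') < ennreal (2 * r)} \<le> b"
    and q: "q > 0" "B ^ n * real b \<le> q\<^sup>2 * real (card \<Theta>)"
  shows "ennreal (r * (1 - q)) \<le> minimax_risk M n F"
  unfolding minimax_risk_def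
proof (rule Inf_greatest, clarify)
  fix Q :: "real measure" and fhat :: "real \<Rightarrow> (nat \<Rightarrow> 'a) \<Rightarrow> 'a \<Rightarrow> real"
  assume est: "estimator M n Q fhat"
  then interpret Q: prob_space Q by (simp add: estimator_def)
  interpret M: sigma_finite_measure M by (rule M)
  define P0 where "P0 = density M (\<lambda>x. ennreal (p0 x))"
  define X where "X = Q \<Otimes>\<^sub>M PiM {..<n} (\<lambda>_. M)"
  define T where "T = (\<lambda>\<tau> p. TV M (fhat (fst p) (snd p)) (f \<tau>))"
  define A where "A = (\<lambda>\<tau>. {p\<in>space X. T \<tau> p < ennreal r})"
  define W where "W = (\<lambda>\<tau> s. \<Prod>i<n. ennreal (w \<tau> (s i)))"
  \<comment> \<open>balances the two terms of the bound for the likelihood ratio\<close>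
  define \<kappa> where "\<kappa> = q * real (card \<Theta>) / b"
  have fm: "f \<tau> \<in> borel_measurable M" if "\<tau> \<in> \<Theta>" for \<tau> using prob_densityD(1)[OF f(1)[OF that]] .
  have P0: "prob_space P0" unfolding P0_def by (rule prob_densityD(6)[OF p0])
  interpret P0: prob_space P0 by (rule P0)
  interpret PP: product_sigma_finite "\<lambda>_::nat. P0" by unfold_locales
  have setsP0 [measurable_cong]: "sets P0 = sets M" by (simp add: P0_def)
  have sets0: "sets (PiM {..<n} (\<lambda>_. P0)) = sets (PiM {..<n} (\<lambda>_. M))"
    by (intro sets_PiM_cong) (auto simp: setsP0)
  interpret P0n: prob_space "PiM {..<n} (\<lambda>_. P0)" by (rule prob_space_PiM) (rule P0)
  let ?\<mu> = "Q \<Otimes>\<^sub>M PiM {..<n} (\<lambda>_. P0)"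
  interpret Q0: pair_prob_space Q "PiM {..<n} (\<lambda>_. P0)" by unfold_locales
  have setsX: "sets ?\<mu> = sets X" unfolding X_def by (intro sets_pair_measure_cong sets0 refl)
  have spX: "space ?\<mu> = space X" by (rule sets_eq_imp_space_eq[OF setsX])
  have Tm: "T \<tau> \<in> borel_measurable X" if "\<tau> \<in> \<Theta>" for \<tau>
  proof -
    have e: "(\<lambda>z. fhat (fst (fst z)) (snd (fst z)) (snd z)) \<in> borel_measurable (X \<Otimes>\<^sub>M M)"
      using est unfolding estimator_def X_def by (simp add: case_prod_beta')
    note [measurable] = e fm[OF that]
    have "(\<lambda>(p, x). ennreal \<bar>fhat (fst p) (snd p) x - f \<tau> x\<bar>) \<in> borel_measurable (X \<Otimes>\<^sub>M M)"
      by (simp add: case_prod_beta')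
    from M.borel_measurable_nn_integral[OF this] show ?thesis unfolding T_def TV_def by measurable
  qed
  have Am: "A \<tau> \<in> sets X" if "\<tau> \<in> \<Theta>" for \<tau> using Tm[OF that] unfolding A_def by measurable
  then have Am0: "A \<tau> \<in> sets ?\<mu>" if "\<tau> \<in> \<Theta>" for \<tau> using that by (simp add: setsX)
  have b0: "b > 0"
  proof -
    obtain \<tau> where \<tau>: "\<tau> \<in> \<Theta>" using \<Theta> by blast
    have "\<tau> \<in> {\<tau>'\<in>\<Theta>. TV M (f \<tau>) (f \<tau>') < ennreal (2 * r)}" using \<tau> r by (simp add: TV_def)
    then have "card {\<tau>'\<in>\<Theta>. TV M (f \<tau>) (f \<tau>') < ennreal (2 * r)} > 0" using \<Theta>(1) by (subst card_gt_0_iff) auto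
    then show ?thesis using b[OF \<tau>] by linarith
  qed
  have N0: "card \<Theta> > 0" using \<Theta> by (simp add: card_gt_0_iff)
  have \<kappa>: "\<kappa> > 0" using q(1) b0 N0 by (simp add: \<kappa>_def)
  have Wm: "W \<tau> \<in> borel_measurable (PiM {..<n} (\<lambda>_. P0))" if "\<tau> \<in> \<Theta>" for \<tau>
    using w(1)[OF that] unfolding W_def by measurable
  have iid: "iid_samples M n (f \<tau>) = density (PiM {..<n} (\<lambda>_. P0)) (W \<tau>)" if "\<tau> \<in> \<Theta>" for \<tau>
  proof -
    have "density M (\<lambda>x. ennreal (f \<tau> x)) = density P0 (\<lambda>x. ennreal (w \<tau> x))"
      unfolding P0_def using prob_densityD(1,2)[OF p0] w[OF that] fm[OF that]
      by (subst density_density_eq) (auto intro!: density_cong simp: ennreal_mult)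
    moreover have "prob_space (density M (\<lambda>x. ennreal (f \<tau> x)))" by (rule prob_densityD(6)[OF f(1)[OF that]])
    ultimately have pd: "prob_space (density P0 (\<lambda>x. ennreal (w \<tau> x)))"
      and e: "iid_samples M n (f \<tau>) = PiM {..<n} (\<lambda>_. density P0 (\<lambda>x. ennreal (w \<tau> x)))"
      by (simp_all add: iid_samples_def)
    have "(\<lambda>x. ennreal (w \<tau> x)) \<in> borel_measurable P0" using w(1)[OF that] by measurable
    then show ?thesis unfolding e W_def
      by (rule PiM_density[OF finite_lessThan prob_space_imp_sigma_finite[OF P0] _ prob_space_imp_sigma_finite[OF pd]])
  qed
  have prob_iid: "prob_space (iid_samples M n (f \<tau>))" if "\<tau> \<in> \<Theta>" for \<tau>
    unfolding iid_samples_def by (intro prob_space_PiM prob_densityD(6)[OF f(1)[OF that]])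
  have sets_iid: "sets (Q \<Otimes>\<^sub>M iid_samples M n (f \<tau>)) = sets X" if "\<tau> \<in> \<Theta>" for \<tau>
    unfolding X_def iid_samples_def by (intro sets_pair_measure_cong sets_PiM_cong) auto
  have pair: "(\<integral>\<^sup>+ p. h p \<partial>(Q \<Otimes>\<^sub>M iid_samples M n (f \<tau>))) = (\<integral>\<^sup>+ p. h p * W \<tau> (snd p) \<partial>?\<mu>)"
    if "\<tau> \<in> \<Theta>" "h \<in> borel_measurable X" for \<tau> and h :: "real \<times> (nat \<Rightarrow> 'a) \<Rightarrow> ennreal"
    unfolding iid[OF that(1)]
  proof (rule nn_integral_pair_density)
    show "sigma_finite_measure (density (PiM {..<n} (\<lambda>_. P0)) (W \<tau>))"
      using prob_iid[OF that(1)] unfolding iid[OF that(1)] by (rule prob_space_imp_sigma_finite)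
    show "h \<in> borel_measurable ?\<mu>" using that(2) by (simp add: measurable_cong_sets[OF setsX refl])
  qed (use Wm[OF that(1)] in \<open>auto intro: prob_space_imp_sigma_finite P0n.prob_space_axioms Q.prob_space_axioms\<close>)
  have W2: "(\<integral>\<^sup>+ p. (W \<tau> (snd p))\<^sup>2 \<partial>?\<mu>) \<le> ennreal (B ^ n)" if "\<tau> \<in> \<Theta>" for \<tau>
  proof -
    have "(\<integral>\<^sup>+ p. (W \<tau> (snd p))\<^sup>2 \<partial>?\<mu>) = (\<integral>\<^sup>+ r. (\<integral>\<^sup>+ s. (W \<tau> s)\<^sup>2 \<partial>PiM {..<n} (\<lambda>_. P0)) \<partial>Q)"
      using Wm[OF that] by (subst P0n.nn_integral_fst[symmetric]) auto
    also have "\<dots> = (\<integral>\<^sup>+ s. (W \<tau> s)\<^sup>2 \<partial>PiM {..<n} (\<lambda>_. P0))" by (simp add: Q.emeasure_space_1)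
    also have "\<dots> = (\<integral>\<^sup>+ s. (\<Prod>i<n. (ennreal (w \<tau> (s i)))\<^sup>2) \<partial>PiM {..<n} (\<lambda>_. P0))"
      by (simp add: W_def prod_power_distrib)
    also have "\<dots> = (\<Prod>i<n. \<integral>\<^sup>+ x. (ennreal (w \<tau> x))\<^sup>2 \<partial>P0)"
      using w(1)[OF that] by (intro PP.product_nn_integral_prod) auto
    also have "(\<integral>\<^sup>+ x. (ennreal (w \<tau> x))\<^sup>2 \<partial>P0) = (\<integral>\<^sup>+ x. ennreal ((w \<tau> x)\<^sup>2) \<partial>P0)"
      using w(2)[OF that] by (intro nn_integral_cong) (simp add: ennreal_power sets_eq_imp_space_eq[OF setsP0])
    also have "(\<Prod>i<n. \<integral>\<^sup>+ x. ennreal ((w \<tau> x)\<^sup>2) \<partial>P0) \<le> ennreal B ^ n"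
      using B(2)[OF that, folded P0_def] by (simp add: power_mono)
    finally show ?thesis using B(1) by (simp add: ennreal_power)
  qed
  have AW: "emeasure (Q \<Otimes>\<^sub>M iid_samples M n (f \<tau>)) (A \<tau>)
      \<le> ennreal (B ^ n / (2 * \<kappa>)) + ennreal (\<kappa> / 2) * emeasure ?\<mu> (A \<tau>)" if "\<tau> \<in> \<Theta>" for \<tau>
  proof -
    have "emeasure (Q \<Otimes>\<^sub>M iid_samples M n (f \<tau>)) (A \<tau>) = (\<integral>\<^sup>+ p. indicator (A \<tau>) p \<partial>(Q \<Otimes>\<^sub>M iid_samples M n (f \<tau>)))"
      using Am[OF that] by (simp add: sets_iid[OF that])
    also have "\<dots> = (\<integral>\<^sup>+ p. indicator (A \<tau>) p * W \<tau> (snd p) \<partial>?\<mu>)"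
      using Am[OF that] by (intro pair[OF that]) auto
    also have "\<dots> \<le> (\<integral>\<^sup>+ p. ennreal (1 / (2 * \<kappa>)) * (W \<tau> (snd p))\<^sup>2 + ennreal (\<kappa> / 2) * indicator (A \<tau>) p \<partial>?\<mu>)"
    proof (rule nn_integral_mono)
      fix p assume "p \<in> space ?\<mu>"
      obtain y where y: "y \<ge> 0" "W \<tau> (snd p) = ennreal y"
      proof -
        have "W \<tau> (snd p) \<noteq> \<top>" unfolding W_def by (simp add: ennreal_prod_eq_top)
        then show ?thesis using that by (cases "W \<tau> (snd p)") auto
      qed
      show "indicator (A \<tau>) p * W \<tau> (snd p) \<le> ennreal (1 / (2 * \<kappa>)) * (W \<tau> (snd p))\<^sup>2 + ennreal (\<kappa> / 2) * indicator (A \<tau>) p"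
      proof (cases "p \<in> A \<tau>")
        case True
        have "0 \<le> (y - \<kappa>)\<^sup>2 / (2 * \<kappa>)" using \<kappa> by simp
        also have "(y - \<kappa>)\<^sup>2 / (2 * \<kappa>) = 1 / (2 * \<kappa>) * y\<^sup>2 + \<kappa> / 2 - y"
          using \<kappa> by (simp add: power2_eq_square field_simps)
        finally have "ennreal y \<le> ennreal (1 / (2 * \<kappa>) * y\<^sup>2 + \<kappa> / 2)" by (intro ennreal_leI) simp
        also have "\<dots> = ennreal (1 / (2 * \<kappa>)) * (ennreal y)\<^sup>2 + ennreal (\<kappa> / 2)"
        proof -
          have nn: "0 \<le> 1 / (2 * \<kappa>)" "0 \<le> y\<^sup>2" "0 \<le> \<kappa> / 2" using \<kappa> by auto
          show ?thesis
            by (simp only: ennreal_plus[OF mult_nonneg_nonneg[OF nn(1,2)] nn(3)] ennreal_mult[OF nn(1,2)] ennreal_power[OF y(1)])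
        qed
        finally show ?thesis using True y by simp
      qed simp
    qed
    also have "\<dots> = ennreal (1 / (2 * \<kappa>)) * (\<integral>\<^sup>+ p. (W \<tau> (snd p))\<^sup>2 \<partial>?\<mu>) + ennreal (\<kappa> / 2) * emeasure ?\<mu> (A \<tau>)"
      using Am0[OF that] Wm[OF that]
      by (subst nn_integral_add) (auto simp: nn_integral_cmult nn_integral_cmult_indicator)
    also have "\<dots> \<le> ennreal (1 / (2 * \<kappa>)) * ennreal (B ^ n) + ennreal (\<kappa> / 2) * emeasure ?\<mu> (A \<tau>)"
      by (intro add_mono mult_left_mono W2[OF that]) auto
    finally show ?thesis using \<kappa> B(1) by (simp add: ennreal_mult[symmetric])
  qed
  \<comment> \<open>hypotheses whose events share an outcome lie within \<open>2 * r\<close> of each other\<close>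
  have overlap: "(\<Sum>\<tau>\<in>\<Theta>. emeasure ?\<mu> (A \<tau>)) \<le> ennreal b"
  proof -
    have "(\<Sum>\<tau>\<in>\<Theta>. emeasure ?\<mu> (A \<tau>)) = (\<integral>\<^sup>+ p. (\<Sum>\<tau>\<in>\<Theta>. indicator (A \<tau>) p) \<partial>?\<mu>)"
      using Am0 by (subst nn_integral_sum) auto
    also have "\<dots> \<le> (\<integral>\<^sup>+ p. ennreal b \<partial>?\<mu>)"
    proof (rule nn_integral_mono)
      fix p assume p: "p \<in> space ?\<mu>"
      have "card {\<tau>\<in>\<Theta>. p \<in> A \<tau>} \<le> b"
      proof (cases "{\<tau>\<in>\<Theta>. p \<in> A \<tau>} = {}")
        case True
        then show ?thesis by (simp only: card.empty le0)
      next
        case False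
        then obtain \<tau> where \<tau>: "\<tau> \<in> \<Theta>" "p \<in> A \<tau>" by blast
        have fp: "fhat (fst p) (snd p) \<in> borel_measurable M"
        proof -
          have e: "(\<lambda>z. fhat (fst (fst z)) (snd (fst z)) (snd z)) \<in> borel_measurable (X \<Otimes>\<^sub>M M)"
            using est unfolding estimator_def X_def by (simp add: case_prod_beta')
          have "p \<in> space X" using p spX by simp
          from measurable_compose[OF measurable_Pair1'[OF this] e] show ?thesis by simp
        qed
        have "{\<tau>\<in>\<Theta>. p \<in> A \<tau>} \<subseteq> {\<tau>'\<in>\<Theta>. TV M (f \<tau>) (f \<tau>') < ennreal (2 * r)}"
        proof clarify
          fix \<tau>' assume \<tau>': "\<tau>' \<in> \<Theta>" "p \<in> A \<tau>'"
          have "TV M (f \<tau>) (f \<tau>') \<le> TV M (f \<tau>) (fhat (fst p) (snd p)) + TV M (fhat (fst p) (snd p)) (f \<tau>')"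
            using fm \<tau> \<tau>' fp by (intro TV_triangle) auto
          also have "\<dots> < ennreal r + ennreal r"
            using \<tau>(2) \<tau>'(2) unfolding A_def T_def by (intro add_strict_mono) (auto simp: TV_commute[of M "f \<tau>"])
          also have "\<dots> = ennreal (2 * r)" using r by (simp flip: ennreal_plus)
          finally show "TV M (f \<tau>) (f \<tau>') < ennreal (2 * r)" .
        qed
        then have "card {\<tau>\<in>\<Theta>. p \<in> A \<tau>} \<le> card {\<tau>'\<in>\<Theta>. TV M (f \<tau>) (f \<tau>') < ennreal (2 * r)}"
          using \<Theta>(1) by (intro card_mono) auto
        then show ?thesis using b[OF \<tau>(1)] by linarith
      qed
      moreover have "(\<Sum>\<tau>\<in>\<Theta>. indicator (A \<tau>) p :: ennreal) = of_nat (card {\<tau>\<in>\<Theta>. p \<in> A \<tau>})"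
        using \<Theta>(1) by (simp add: indicator_def sum.If_cases Int_def)
      ultimately show "(\<Sum>\<tau>\<in>\<Theta>. indicator (A \<tau>) p) \<le> ennreal b"
        by (simp add: ennreal_of_nat_eq_real_of_nat)
    qed
    also have "\<dots> = ennreal b" by (simp add: Q0.P.emeasure_space_1)
    finally show ?thesis .
  qed
  let ?R = "risk M n Q fhat F"
  have low: "ennreal r \<le> ?R + ennreal r * emeasure (Q \<Otimes>\<^sub>M iid_samples M n (f \<tau>)) (A \<tau>)" if "\<tau> \<in> \<Theta>" for \<tau>
  proof -
    let ?P = "Q \<Otimes>\<^sub>M iid_samples M n (f \<tau>)"
    interpret I: prob_space "iid_samples M n (f \<tau>)" by (rule prob_iid[OF that])
    interpret QI: pair_prob_space Q "iid_samples M n (f \<tau>)" by unfold_locales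
    have Tm': "T \<tau> \<in> borel_measurable ?P" "A \<tau> \<in> sets ?P"
      using Tm[OF that] Am[OF that] by (simp_all add: measurable_cong_sets[OF sets_iid[OF that] refl] sets_iid[OF that])
    have "ennreal r = (\<integral>\<^sup>+ p. ennreal r \<partial>?P)" by (simp add: QI.P.emeasure_space_1)
    also have "\<dots> \<le> (\<integral>\<^sup>+ p. T \<tau> p + ennreal r * indicator (A \<tau>) p \<partial>?P)"
    proof (rule nn_integral_mono)
      fix p assume "p \<in> space ?P"
      then have "p \<in> space X" using sets_eq_imp_space_eq[OF sets_iid[OF that]] by simp
      then show "ennreal r \<le> T \<tau> p + ennreal r * indicator (A \<tau>) p"
        by (cases "p \<in> A \<tau>") (auto simp: A_def not_less)
    qed
    also have "\<dots> = (\<integral>\<^sup>+ p. T \<tau> p \<partial>?P) + ennreal r * emeasure ?P (A \<tau>)"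
      using Tm' by (subst nn_integral_add) (auto simp: nn_integral_cmult_indicator)
    also have "(\<integral>\<^sup>+ p. T \<tau> p \<partial>?P) \<le> ?R"
      unfolding risk_def T_def using f(2)[OF that] by (intro SUP_upper2[of "f \<tau>"]) (auto simp: case_prod_beta')
    finally show ?thesis by (simp add: add_right_mono)
  qed
  show "ennreal (r * (1 - q)) \<le> ?R"
  proof (cases "?R = \<top>")
    case False
    then obtain R where R: "R \<ge> 0" "?R = ennreal R" by (cases "?R") auto
    have "ennreal (card \<Theta> * r) = (\<Sum>\<tau>\<in>\<Theta>. ennreal r)" using r by (simp add: ennreal_mult ennreal_of_nat_eq_real_of_nat)
    also have "\<dots> \<le> (\<Sum>\<tau>\<in>\<Theta>. ennreal R + ennreal r * (ennreal (B ^ n / (2 * \<kappa>)) + ennreal (\<kappa> / 2) * emeasure ?\<mu> (A \<tau>)))"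
    proof (rule sum_mono)
      fix \<tau> assume \<tau>: "\<tau> \<in> \<Theta>"
      show "ennreal r \<le> ennreal R + ennreal r * (ennreal (B ^ n / (2 * \<kappa>)) + ennreal (\<kappa> / 2) * emeasure ?\<mu> (A \<tau>))"
        using low[OF \<tau>] unfolding R(2) by (rule order_trans) (intro add_left_mono mult_left_mono AW[OF \<tau>] zero_le)
    qed
    also have "\<dots> = card \<Theta> * (ennreal R + ennreal r * ennreal (B ^ n / (2 * \<kappa>)))
        + ennreal r * ennreal (\<kappa> / 2) * (\<Sum>\<tau>\<in>\<Theta>. emeasure ?\<mu> (A \<tau>))"
      by (simp add: sum.distrib sum_distrib_left distrib_left mult.assoc)
    also have "\<dots> \<le> card \<Theta> * (ennreal R + ennreal r * ennreal (B ^ n / (2 * \<kappa>))) + ennreal r * ennreal (\<kappa> / 2) * ennreal b"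
      by (intro add_left_mono mult_left_mono overlap) auto
    also have "\<dots> = ennreal (card \<Theta> * (R + r * (B ^ n / (2 * \<kappa>))) + r * (\<kappa> / 2) * b)"
    proof -
      have "of_nat c * (ennreal R + ennreal r * ennreal x) + ennreal r * ennreal y * ennreal z
          = ennreal (c * (R + r * x) + r * y * z)" if "0 \<le> x" "0 \<le> y" "0 \<le> z" for c :: nat and x y z
        using R(1) r that by (simp add: ennreal_mult ennreal_plus ennreal_of_nat_eq_real_of_nat)
      then show ?thesis using \<kappa> B(1) by simp
    qed
    finally have le: "card \<Theta> * r \<le> card \<Theta> * (R + r * (B ^ n / (2 * \<kappa>))) + r * (\<kappa> / 2) * b"
      using R(1) r \<kappa> B(1) by (subst (asm) ennreal_le_iff) auto
    have 1: "\<kappa> / 2 * b = card \<Theta> * (q / 2)" using b0 by (simp add: \<kappa>_def)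
    have 2: "B ^ n / (2 * \<kappa>) \<le> q / 2"
    proof -
      have "B ^ n / (2 * \<kappa>) = B ^ n * b / (2 * q * card \<Theta>)" using b0 by (simp add: \<kappa>_def)
      also have "\<dots> \<le> q\<^sup>2 * card \<Theta> / (2 * q * card \<Theta>)" using q N0 by (intro divide_right_mono) auto
      also have "\<dots> = q / 2" using q(1) N0 by (simp add: power2_eq_square)
      finally show ?thesis .
    qed
    have "card \<Theta> * r \<le> card \<Theta> * (R + r * (q / 2)) + r * (card \<Theta> * (q / 2))"
    proof -
      have "card \<Theta> * (R + r * (B ^ n / (2 * \<kappa>))) \<le> card \<Theta> * (R + r * (q / 2))"
        using 2 r by (intro mult_left_mono add_left_mono) auto
      moreover have "r * (\<kappa> / 2) * b = r * (card \<Theta> * (q / 2))" using 1 by (simp add: mult.assoc)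
      ultimately show ?thesis using le by linarith
    qed
    also have "\<dots> = card \<Theta> * (R + r * q)" by (simp add: algebra_simps)
    finally have "r \<le> R + r * q" using N0 by (simp only: mult_le_cancel_left_pos of_nat_0_less_iff)
    then have "r * (1 - q) \<le> R" by (simp add: algebra_simps)
    then show ?thesis unfolding R(2) by (rule ennreal_leI)
  qed simp
qed

text \<open>A Chernoff bound.  With weight \<open>(4/5) ^ 8\<close> for each disagreement, every sign vector in the Hamming
ball of radius \<open>card J / 8\<close> has weight at least \<open>(4/5) ^ card J\<close>, while the total weight is
\<open>(1 + (4/5) ^ 8) ^ card J\<close>.\<close>

lemma card_near_signs:
  assumes J: "finite J" and \<tau>: "\<tau> \<in> signs J"
  shows "real (card {\<tau>'\<in>signs J. 8 * card {j\<in>J. \<tau> j \<noteq> \<tau>' j} < card J}) \<le> (3 / 2) ^ card J"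
proof -
  define x :: real where "x = (4 / 5) ^ 8"
  let ?N = "{\<tau>'\<in>signs J. 8 * card {j\<in>J. \<tau> j \<noteq> \<tau>' j} < card J}"
  have w: "(\<Prod>j\<in>J. if \<tau> j \<noteq> \<tau>' j then x else 1) = x ^ card {j\<in>J. \<tau> j \<noteq> \<tau>' j}" for \<tau>'
    using J by (simp add: prod.If_cases Int_def)
  have "real (card ?N) * (4 / 5) ^ card J = (\<Sum>\<tau>'\<in>?N. (4 / 5) ^ card J)" by simp
  also have "\<dots> \<le> (\<Sum>\<tau>'\<in>?N. x ^ card {j\<in>J. \<tau> j \<noteq> \<tau>' j})"
    unfolding x_def power_mult[symmetric] by (intro sum_mono power_decreasing) auto
  also have "\<dots> \<le> (\<Sum>\<tau>'\<in>signs J. x ^ card {j\<in>J. \<tau> j \<noteq> \<tau>' j})"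
    by (intro sum_mono2 finite_signs J) (auto simp: x_def)
  also have "\<dots> = (\<Sum>\<tau>'\<in>signs J. \<Prod>j\<in>J. if \<tau> j \<noteq> \<tau>' j then x else 1)" by (simp only: w)
  also have "\<dots> = (\<Prod>j\<in>J. \<Sum>s\<in>{-1, 1}. if \<tau> j \<noteq> s then x else 1)"
    unfolding signs_def using J by (intro prod_sum_PiE[symmetric]) auto
  also have "\<dots> = (\<Prod>j\<in>J. 1 + x)"
  proof (rule prod.cong)
    fix j assume "j \<in> J"
    then have "\<tau> j = -1 \<or> \<tau> j = 1" using \<tau> by (auto simp: signs_def PiE_iff)
    then show "(\<Sum>s\<in>{-1, 1}. if \<tau> j \<noteq> s then x else 1) = 1 + x" by auto
  qed simp
  finally have "real (card ?N) * (4 / 5) ^ card J \<le> (1 + x) ^ card J" by simp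
  then have "real (card ?N) \<le> (1 + x) ^ card J / (4 / 5) ^ card J" by (simp add: field_simps)
  also have "\<dots> = ((1 + x) / (4 / 5)) ^ card J" by (simp only: power_divide)
  also have "\<dots> \<le> (3 / 2) ^ card J" by (intro power_mono) (simp_all add: x_def power_divide)
  finally show ?thesis .
qed

section \<open>Tilting a measure by signed sums\<close>

lemma exp_ge_power: "0 \<le> y \<Longrightarrow> k > 0 \<Longrightarrow> (y / real k) ^ k \<le> exp y" for y :: real
proof -
  assume y: "0 \<le> y" "k > 0"
  have "(y / real k) ^ k \<le> exp (y / real k) ^ k"
    using y exp_ge_add_one_self[of "y / real k"] by (intro power_mono) (linarith, simp)
  also have "\<dots> = exp y" using y by (simp add: exp_of_nat_mult[symmetric])
  finally show ?thesis .
qed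

lemma exp_taylor_le: "\<bar>exp u - 1 - u\<bar> \<le> u\<^sup>2 * exp \<bar>u\<bar>" for u :: real
proof -
  have lo: "0 \<le> exp u - 1 - u" using exp_ge_add_one_self[of u] by linarith
  have hi: "exp u - 1 \<le> u * exp u"
  proof -
    have "exp u * (1 - u) \<le> exp u * exp (- u)" using exp_ge_add_one_self[of "- u"] by (intro mult_left_mono) auto
    then show ?thesis by (simp add: exp_minus algebra_simps)
  qed
  have "exp u - 1 - u \<le> u\<^sup>2 * exp \<bar>u\<bar>"
  proof (cases "u \<ge> 0")
    case True
    have "exp u - 1 - u \<le> u * (exp u - 1)" using hi by (simp add: algebra_simps)
    also have "\<dots> \<le> u * (u * exp u)" using hi True by (intro mult_left_mono) auto
    finally show ?thesis using True by (simp add: power2_eq_square mult.assoc)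
  next
    case False
    have "exp u - 1 - u \<le> (- u) * (1 - exp u)" using hi by (simp add: algebra_simps)
    also have "\<dots> \<le> (- u) * (- u)" using False exp_ge_add_one_self[of u] by (intro mult_left_mono) linarith+
    also have "\<dots> = u\<^sup>2 * 1" by (simp add: power2_eq_square)
    also have "\<dots> \<le> u\<^sup>2 * exp \<bar>u\<bar>" by (intro mult_left_mono) auto
    finally show ?thesis .
  qed
  with lo show ?thesis by simp
qed

lemma exp_half_le_2: "exp (1 / 2 :: real) \<le> 2"
proof -
  have "(exp (1 / 2 :: real))\<^sup>2 = exp 1" by (simp add: power2_eq_square exp_add[symmetric])
  also have "\<dots> \<le> 2\<^sup>2" using exp_le by simp
  finally show ?thesis by (rule power2_le_imp_le) simp
qed

text \<open>Under \<open>P\<close> the statistics \<open>\<xi> j\<close> are centred and orthonormal, and their signed sums have the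
exponential moments of a normal variable of variance \<open>2 * card J\<close>, up to a \<open>t\<close> of the order
\<open>1 / sqrt (card J)\<close>.  The last condition controls the normalizing constants, the fourth moments
and the likelihood ratios of the tilted measures all at once.\<close>

locale sign_family = prob_space P for P :: "'a measure" +
  fixes J :: "'j set" and \<xi> :: "'j \<Rightarrow> 'a \<Rightarrow> real"
  assumes J: "finite J" "J \<noteq> {}"
    and \<xi>_measurable [measurable]: "\<And>j. j \<in> J \<Longrightarrow> \<xi> j \<in> borel_measurable P"
    and mean: "\<And>j. j \<in> J \<Longrightarrow> has_bochner_integral P (\<xi> j) 0"
    and orth: "\<And>i j. i \<in> J \<Longrightarrow> j \<in> J \<Longrightarrow> has_bochner_integral P (\<lambda>x. \<xi> i x * \<xi> j x) (if i = j then 1 else 0)"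
    and mgf: "\<And>\<tau> t. \<tau> \<in> signs J \<Longrightarrow> t\<^sup>2 * real (card J) \<le> 1 / 2 \<Longrightarrow>
      (\<integral>\<^sup>+ x. ennreal (exp (t * (\<Sum>j\<in>J. \<tau> j * \<xi> j x))) \<partial>P) \<le> ennreal (exp (t\<^sup>2 * real (card J)))"
begin

definition stat :: "('j \<Rightarrow> real) \<Rightarrow> 'a \<Rightarrow> real" where
  "stat \<tau> x = (\<Sum>j\<in>J. \<tau> j * \<xi> j x)"

abbreviation "k \<equiv> real (card J)"

lemma k_ge_1: "k \<ge> 1"
  using J by (simp add: Suc_leI card_gt_0_iff)

lemma stat_measurable [measurable]: "stat \<tau> \<in> borel_measurable P"
  unfolding stat_def by measurable

lemma stat_mean: "integrable P (stat \<tau>)" "expectation (stat \<tau>) = 0"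
proof -
  have "has_bochner_integral P (stat \<tau>) (\<Sum>j\<in>J. \<tau> j * 0)"
    unfolding stat_def by (intro has_bochner_integral_sum has_bochner_integral_mult_right mean)
  then show "integrable P (stat \<tau>)" "expectation (stat \<tau>) = 0"
    by (auto simp: has_bochner_integral_iff)
qed

lemma stat_second_moment: "integrable P (\<lambda>x. (stat c x)\<^sup>2)" "expectation (\<lambda>x. (stat c x)\<^sup>2) = (\<Sum>j\<in>J. (c j)\<^sup>2)"
proof -
  have eq: "(stat c x)\<^sup>2 = (\<Sum>i\<in>J. \<Sum>j\<in>J. (c i * c j) * (\<xi> i x * \<xi> j x))" for x
    by (simp add: stat_def power2_eq_square sum_product mult_ac)
  have "has_bochner_integral P (\<lambda>x. (stat c x)\<^sup>2) (\<Sum>i\<in>J. \<Sum>j\<in>J. (c i * c j) * (if i = j then 1 else 0))"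
    unfolding eq by (intro has_bochner_integral_sum has_bochner_integral_mult_right orth)
  also have "(\<Sum>i\<in>J. \<Sum>j\<in>J. (c i * c j) * (if i = j then 1 else 0)) = (\<Sum>j\<in>J. (c j)\<^sup>2)"
    using J by (intro sum.cong refl) (simp add: power2_eq_square if_distrib cong: if_cong)
  finally show "integrable P (\<lambda>x. (stat c x)\<^sup>2)" "expectation (\<lambda>x. (stat c x)\<^sup>2) = (\<Sum>j\<in>J. (c j)\<^sup>2)"
    by (auto simp: has_bochner_integral_iff)
qed

lemma stat_mgf:
  assumes "\<tau> \<in> signs J" "t\<^sup>2 * k \<le> 1 / 2"
  shows "integrable P (\<lambda>x. exp (t * stat \<tau> x))" "expectation (\<lambda>x. exp (t * stat \<tau> x)) \<le> exp (t\<^sup>2 * k)"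
proof -
  note m = mgf[OF assms, folded stat_def]
  show i: "integrable P (\<lambda>x. exp (t * stat \<tau> x))"
    by (rule integrableI_nonneg) (use m in \<open>auto intro: le_less_trans\<close>)
  have "ennreal (expectation (\<lambda>x. exp (t * stat \<tau> x))) \<le> ennreal (exp (t\<^sup>2 * k))"
    using m by (subst nn_integral_eq_integral[OF i, symmetric]) auto
  then show "expectation (\<lambda>x. exp (t * stat \<tau> x)) \<le> exp (t\<^sup>2 * k)" by simp
qed

text \<open>The largest argument for which the exponential moments are controlled.\<close>

definition t0 :: real where "t0 = 1 / sqrt (2 * k)"

lemma t0: "t0 > 0" "t0\<^sup>2 = 1 / (2 * k)"
  using k_ge_1 by (auto simp: t0_def power_divide)

lemma stat_abs_mgf:
  assumes "\<tau> \<in> signs J"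
  shows "integrable P (\<lambda>x. exp (t0 * \<bar>stat \<tau> x\<bar>))" "expectation (\<lambda>x. exp (t0 * \<bar>stat \<tau> x\<bar>)) \<le> 4"
proof -
  have a: "t0\<^sup>2 * k \<le> 1 / 2" "(- t0)\<^sup>2 * k \<le> 1 / 2" "t0\<^sup>2 * k = 1 / 2" using k_ge_1 by (simp_all add: t0)
  note p = stat_mgf[OF assms a(1)] and m = stat_mgf[OF assms a(2)]
  have b: "exp (t0 * \<bar>stat \<tau> x\<bar>) \<le> exp (t0 * stat \<tau> x) + exp (- t0 * stat \<tau> x)" for x
    by (cases "stat \<tau> x \<ge> 0") (auto simp: abs_if)
  have s: "integrable P (\<lambda>x. exp (t0 * stat \<tau> x) + exp (- t0 * stat \<tau> x))" using p m by simp
  show i: "integrable P (\<lambda>x. exp (t0 * \<bar>stat \<tau> x\<bar>))"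
    by (rule Bochner_Integration.integrable_bound[OF s]) (use b in \<open>auto simp: add_nonneg_nonneg\<close>)
  have "expectation (\<lambda>x. exp (t0 * \<bar>stat \<tau> x\<bar>)) \<le> expectation (\<lambda>x. exp (t0 * stat \<tau> x) + exp (- t0 * stat \<tau> x))"
    using b by (intro integral_mono i s) auto
  also have "\<dots> = expectation (\<lambda>x. exp (t0 * stat \<tau> x)) + expectation (\<lambda>x. exp (- t0 * stat \<tau> x))"
    using p m by (intro Bochner_Integration.integral_add) auto
  also have "\<dots> \<le> exp (1 / 2) + exp (1 / 2)" using p(2) m(2) a(3) by (intro add_mono) auto
  also have "\<dots> \<le> 4" using exp_half_le_2 by simp
  finally show "expectation (\<lambda>x. exp (t0 * \<bar>stat \<tau> x\<bar>)) \<le> 4" .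
qed

lemma stat_fourth_moment:
  assumes "\<tau> \<in> signs J"
  shows "integrable P (\<lambda>x. (stat \<tau> x) ^ 4)" "expectation (\<lambda>x. (stat \<tau> x) ^ 4) \<le> 4096 * k\<^sup>2"
proof -
  have b: "(stat \<tau> x) ^ 4 \<le> 256 / t0 ^ 4 * exp (t0 * \<bar>stat \<tau> x\<bar>)" for x
  proof -
    have "((t0 * \<bar>stat \<tau> x\<bar>) / real 4) ^ 4 \<le> exp (t0 * \<bar>stat \<tau> x\<bar>)" using t0 by (intro exp_ge_power) auto
    then have "t0 ^ 4 * (stat \<tau> x) ^ 4 \<le> 256 * exp (t0 * \<bar>stat \<tau> x\<bar>)"
      by (simp add: power_divide power_mult_distrib power_even_abs)
    then show ?thesis using t0 by (simp add: field_simps)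
  qed
  have s: "integrable P (\<lambda>x. 256 / t0 ^ 4 * exp (t0 * \<bar>stat \<tau> x\<bar>))" using stat_abs_mgf[OF assms] by simp
  show i: "integrable P (\<lambda>x. (stat \<tau> x) ^ 4)"
    by (rule Bochner_Integration.integrable_bound[OF s]) (use b t0 in \<open>auto simp: abs_mult\<close>)
  have "expectation (\<lambda>x. (stat \<tau> x) ^ 4) \<le> expectation (\<lambda>x. 256 / t0 ^ 4 * exp (t0 * \<bar>stat \<tau> x\<bar>))"
    using b by (intro integral_mono i s) auto
  also have "\<dots> \<le> 256 / t0 ^ 4 * 4" using stat_abs_mgf(2)[OF assms] t0
    by (subst integral_mult_right_zero) (intro mult_left_mono, auto)
  also have "t0 ^ 4 = (1 / (2 * k))\<^sup>2" unfolding t0(2)[symmetric] by (simp add: power_mult[symmetric])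
  also have "256 / (1 / (2 * k))\<^sup>2 * 4 = 4096 * k\<^sup>2" using k_ge_1 by (simp add: power_divide power_mult_distrib)
  finally show "expectation (\<lambda>x. (stat \<tau> x) ^ 4) \<le> 4096 * k\<^sup>2" .
qed

lemma sum_square_diff_signs:
  assumes "\<tau> \<in> signs J" "\<tau>' \<in> signs J"
  shows "(\<Sum>j\<in>J. (\<tau> j - \<tau>' j)\<^sup>2) = 4 * real (card {j\<in>J. \<tau> j \<noteq> \<tau>' j})"
proof -
  have "(\<Sum>j\<in>J. (\<tau> j - \<tau>' j)\<^sup>2) = (\<Sum>j\<in>J. if \<tau> j \<noteq> \<tau>' j then 4 else 0)"
  proof (rule sum.cong)
    fix j assume "j \<in> J"
    then have "\<tau> j = -1 \<or> \<tau> j = 1" "\<tau>' j = -1 \<or> \<tau>' j = 1" using assms by (auto simp: signs_def PiE_iff)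
    then show "(\<tau> j - \<tau>' j)\<^sup>2 = (if \<tau> j \<noteq> \<tau>' j then 4 else 0)" by auto
  qed simp
  also have "\<dots> = 4 * real (card {j\<in>J. \<tau> j \<noteq> \<tau>' j})" using J by (simp add: sum.If_cases Int_def)
  finally show ?thesis .
qed

text \<open>The fourth moment method: \<open>\<bar>\<psi>\<bar> \<ge> \<psi>\<^sup>2 / a - \<psi> ^ 4 / a ^ 3\<close> for every \<open>a > 0\<close>, and for \<open>a\<close> a
large multiple of \<open>sqrt k\<close> the second moment prevails.\<close>

lemma expectation_abs_diff_ge:
  assumes \<tau>: "\<tau> \<in> signs J" "\<tau>' \<in> signs J" and far: "card J \<le> 8 * card {j\<in>J. \<tau> j \<noteq> \<tau>' j}"
  shows "sqrt k / 2048 \<le> expectation (\<lambda>x. \<bar>stat \<tau> x - stat \<tau>' x\<bar>)"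
proof -
  define \<psi> where "\<psi> = (\<lambda>x. stat \<tau> x - stat \<tau>' x)"
  \<comment> \<open>makes the fourth moment term half as large as the second moment term\<close>
  define a where "a = 512 * sqrt k"
  have a: "a > 0" "a\<^sup>2 = 262144 * k" using k_ge_1 by (simp_all add: a_def power_mult_distrib)
  have \<psi>: "\<psi> x = stat (\<lambda>j. \<tau> j - \<tau>' j) x" for x
    by (simp add: \<psi>_def stat_def sum_subtractf[symmetric] algebra_simps)
  have i1: "integrable P \<psi>" unfolding \<psi>_def using stat_mean by simp
  have i2: "integrable P (\<lambda>x. (\<psi> x)\<^sup>2)" unfolding \<psi> by (rule stat_second_moment)
  have e2: "expectation (\<lambda>x. (\<psi> x)\<^sup>2) \<ge> k / 2"
    unfolding \<psi> stat_second_moment sum_square_diff_signs[OF \<tau>]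
    using of_nat_mono[OF far, where 'a=real] by simp
  have b4: "(\<psi> x) ^ 4 \<le> 8 * ((stat \<tau> x) ^ 4 + (stat \<tau>' x) ^ 4)" for x
  proof -
    have sq: "(p - q)\<^sup>2 \<le> 2 * (p\<^sup>2 + q\<^sup>2)" for p q :: real
      using sum_squares_ge_zero[of "p + q" 0] by (simp add: power2_eq_square algebra_simps)
    have sq': "(p + q)\<^sup>2 \<le> 2 * (p\<^sup>2 + q\<^sup>2)" for p q :: real
      using sq[of p "- q"] by simp
    have "(\<psi> x) ^ 4 = ((\<psi> x)\<^sup>2)\<^sup>2" by (simp add: power_mult[symmetric])
    also have "\<dots> \<le> (2 * ((stat \<tau> x)\<^sup>2 + (stat \<tau>' x)\<^sup>2))\<^sup>2"
      unfolding \<psi>_def by (intro power_mono sq) simp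
    also have "\<dots> = 4 * ((stat \<tau> x)\<^sup>2 + (stat \<tau>' x)\<^sup>2)\<^sup>2" by (subst power_mult_distrib) simp
    also have "\<dots> \<le> 4 * (2 * (((stat \<tau> x)\<^sup>2)\<^sup>2 + ((stat \<tau>' x)\<^sup>2)\<^sup>2))"
      by (intro mult_left_mono sq') simp
    finally show ?thesis by (simp add: power_mult[symmetric])
  qed
  have s4: "integrable P (\<lambda>x. 8 * ((stat \<tau> x) ^ 4 + (stat \<tau>' x) ^ 4))"
    using stat_fourth_moment(1)[OF \<tau>(1)] stat_fourth_moment(1)[OF \<tau>(2)] by simp
  have i4: "integrable P (\<lambda>x. (\<psi> x) ^ 4)"
    by (rule Bochner_Integration.integrable_bound[OF s4]) (use b4 in \<open>auto simp: \<psi>_def add_nonneg_nonneg\<close>)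
  have "expectation (\<lambda>x. (\<psi> x) ^ 4) \<le> expectation (\<lambda>x. 8 * ((stat \<tau> x) ^ 4 + (stat \<tau>' x) ^ 4))"
    using b4 by (intro integral_mono i4 s4) auto
  also have "\<dots> = 8 * (expectation (\<lambda>x. (stat \<tau> x) ^ 4) + expectation (\<lambda>x. (stat \<tau>' x) ^ 4))"
    using stat_fourth_moment(1)[OF \<tau>(1)] stat_fourth_moment(1)[OF \<tau>(2)] by simp
  also have "\<dots> \<le> 65536 * k\<^sup>2"
    using stat_fourth_moment(2)[OF \<tau>(1)] stat_fourth_moment(2)[OF \<tau>(2)] by simp
  finally have e4: "expectation (\<lambda>x. (\<psi> x) ^ 4) \<le> 65536 * k\<^sup>2" .
  have pt: "(\<psi> x)\<^sup>2 / a - (\<psi> x) ^ 4 / a ^ 3 \<le> \<bar>\<psi> x\<bar>" for x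
  proof -
    have y: "y\<^sup>2 - y ^ 4 \<le> \<bar>y\<bar>" for y :: real
    proof (cases "\<bar>y\<bar> \<le> 1")
      case True
      have "y\<^sup>2 = \<bar>y\<bar> * \<bar>y\<bar>" by (simp add: power2_eq_square)
      also have "\<dots> \<le> \<bar>y\<bar> * 1" using True by (intro mult_left_mono) auto
      finally have "y\<^sup>2 \<le> \<bar>y\<bar>" by simp
      moreover have "0 \<le> y ^ 4" by simp
      ultimately show ?thesis by linarith
    next
      case False
      then have "1 \<le> y\<^sup>2" using one_le_power[of "\<bar>y\<bar>" 2] by simp
      then have "y\<^sup>2 * 1 \<le> y\<^sup>2 * y\<^sup>2" by (intro mult_left_mono) auto
      also have "y\<^sup>2 * y\<^sup>2 = y ^ 4" by (simp flip: power_add)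
      finally show ?thesis by simp
    qed
    have "a * ((\<psi> x / a)\<^sup>2 - (\<psi> x / a) ^ 4) \<le> a * \<bar>\<psi> x / a\<bar>" using a by (intro mult_left_mono y) auto
    moreover have "a * (\<psi> x / a)\<^sup>2 = (\<psi> x)\<^sup>2 / a" using a(1) by (simp add: power_divide power2_eq_square)
    moreover have "a * (\<psi> x / a) ^ 4 = (\<psi> x) ^ 4 / a ^ 3" using a(1) by (simp add: power_divide power_numeral_reduce)
    moreover have "a * \<bar>\<psi> x / a\<bar> = \<bar>\<psi> x\<bar>" using a(1) by simp
    ultimately show ?thesis by (simp add: right_diff_distrib)
  qed
  have "sqrt k / 2048 = (k / 2) / a - 65536 * k\<^sup>2 / a ^ 3"
  proof -
    have "a ^ 3 = a * (262144 * k)" unfolding a(2)[symmetric] by (simp add: power_numeral_reduce)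
    then have "65536 * k\<^sup>2 / a ^ 3 = (k / 4) / a" using k_ge_1 by (simp add: power2_eq_square)
    then have "(k / 2) / a - 65536 * k\<^sup>2 / a ^ 3 = k / (4 * a)" using a(1) by (simp add: field_simps)
    also have "\<dots> = (sqrt k * sqrt k) / (4 * a)" using k_ge_1 by simp
    also have "\<dots> = sqrt k / 2048"
    proof -
      have gen: "s * s / (4 * (512 * s)) = s / 2048" if "s > 0" for s :: real using that by simp
      show ?thesis unfolding a_def by (rule gen) (use k_ge_1 in simp)
    qed
    finally show ?thesis by simp
  qed
  also have "\<dots> \<le> expectation (\<lambda>x. (\<psi> x)\<^sup>2) / a - expectation (\<lambda>x. (\<psi> x) ^ 4) / a ^ 3"
    using e2 e4 a by (intro diff_mono divide_right_mono) auto
  also have "\<dots> = expectation (\<lambda>x. (\<psi> x)\<^sup>2 / a - (\<psi> x) ^ 4 / a ^ 3)" using i2 i4 by simp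
  also have "\<dots> \<le> expectation (\<lambda>x. \<bar>\<psi> x\<bar>)"
    using i1 i2 i4 pt by (intro integral_mono) auto
  finally show ?thesis by (simp add: \<psi>_def)
qed

definition partition_fun :: "real \<Rightarrow> ('j \<Rightarrow> real) \<Rightarrow> real" where
  "partition_fun \<epsilon> \<tau> = expectation (\<lambda>x. exp (\<epsilon> * stat \<tau> x))"

definition tilt :: "real \<Rightarrow> ('j \<Rightarrow> real) \<Rightarrow> 'a \<Rightarrow> real" where
  "tilt \<epsilon> \<tau> x = exp (\<epsilon> * stat \<tau> x) / partition_fun \<epsilon> \<tau>"

lemma tilt_measurable [measurable]: "tilt \<epsilon> \<tau> \<in> borel_measurable P"
  unfolding tilt_def by measurable

context
  fixes \<epsilon> :: real
  assumes \<epsilon>: "\<epsilon> > 0" "\<epsilon> * sqrt k \<le> 1 / 2097152"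
begin

lemma eps_sq: "\<epsilon>\<^sup>2 * k \<le> 1 / 2097152 * (\<epsilon> * sqrt k)" "\<epsilon>\<^sup>2 * k \<le> 1 / 8" "(2 * \<epsilon>)\<^sup>2 * k \<le> 1 / 2"
proof -
  have "\<epsilon>\<^sup>2 * k = (\<epsilon> * sqrt k) * (\<epsilon> * sqrt k)" using k_ge_1 by (simp add: power2_eq_square)
  also have "\<dots> \<le> 1 / 2097152 * (\<epsilon> * sqrt k)" using \<epsilon> by (intro mult_right_mono) auto
  finally show 1: "\<epsilon>\<^sup>2 * k \<le> 1 / 2097152 * (\<epsilon> * sqrt k)" .
  then show 2: "\<epsilon>\<^sup>2 * k \<le> 1 / 8" using \<epsilon>(2) by linarith
  then show "(2 * \<epsilon>)\<^sup>2 * k \<le> 1 / 2" by (simp add: power_mult_distrib)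
qed

lemma eps_le_half_t0: "\<epsilon> \<le> t0 / 2"
proof (rule power2_le_imp_le)
  have "\<epsilon>\<^sup>2 \<le> 1 / (8 * k)" using eps_sq(2) k_ge_1 by (simp add: field_simps)
  then show "\<epsilon>\<^sup>2 \<le> (t0 / 2)\<^sup>2" by (simp add: power_divide t0(2))
qed (use t0 in simp)

lemma partition_bounds:
  assumes "\<tau> \<in> signs J"
  shows "1 \<le> partition_fun \<epsilon> \<tau>" "partition_fun \<epsilon> \<tau> \<le> 1 + 2 * (\<epsilon>\<^sup>2 * k)"
proof -
  have e: "\<epsilon>\<^sup>2 * k \<le> 1 / 2" using eps_sq(2) by simp
  have "1 = expectation (\<lambda>x. 1 + \<epsilon> * stat \<tau> x)" using stat_mean[of \<tau>] by (simp add: prob_space)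
  also have "\<dots> \<le> partition_fun \<epsilon> \<tau>"
    unfolding partition_fun_def using stat_mean[of \<tau>] stat_mgf(1)[OF assms e] exp_ge_add_one_self
    by (intro integral_mono) auto
  finally show "1 \<le> partition_fun \<epsilon> \<tau>" .
  let ?x = "\<epsilon>\<^sup>2 * k"
  have x: "0 \<le> ?x" "?x \<le> 1" using e by auto
  have "partition_fun \<epsilon> \<tau> \<le> exp ?x" unfolding partition_fun_def by (rule stat_mgf(2)[OF assms e])
  also have "\<dots> \<le> 1 + ?x + ?x\<^sup>2" using x by (rule exp_bound)
  also have "?x\<^sup>2 \<le> ?x" using x by (simp add: power2_eq_square mult_left_le)
  finally show "partition_fun \<epsilon> \<tau> \<le> 1 + 2 * ?x" by linarith
qed

lemma tilt_integrable:
  assumes "\<tau> \<in> signs J"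
  shows "integrable P (tilt \<epsilon> \<tau>)"
  using stat_mgf(1)[OF assms, of \<epsilon>] eps_sq(2) unfolding tilt_def by simp

lemma tilt_nonneg: "\<tau> \<in> signs J \<Longrightarrow> 0 \<le> tilt \<epsilon> \<tau> x"
  using partition_bounds(1)[of \<tau>] by (simp add: tilt_def)

lemma tilt_second_moment:
  assumes "\<tau> \<in> signs J"
  shows "(\<integral>\<^sup>+ x. ennreal ((tilt \<epsilon> \<tau> x)\<^sup>2) \<partial>P) \<le> ennreal (exp (4 * (\<epsilon>\<^sup>2 * k)))"
proof -
  have "(\<integral>\<^sup>+ x. ennreal ((tilt \<epsilon> \<tau> x)\<^sup>2) \<partial>P) \<le> (\<integral>\<^sup>+ x. ennreal (exp (2 * \<epsilon> * stat \<tau> x)) \<partial>P)"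
  proof (intro nn_integral_mono ennreal_leI)
    fix x
    have "(tilt \<epsilon> \<tau> x)\<^sup>2 = exp (2 * \<epsilon> * stat \<tau> x) / (partition_fun \<epsilon> \<tau>)\<^sup>2"
      by (simp add: tilt_def power_divide power2_eq_square exp_add[symmetric])
    also have "\<dots> \<le> exp (2 * \<epsilon> * stat \<tau> x) / 1"
      using one_le_power[OF partition_bounds(1)[OF assms], of 2] by (intro divide_left_mono) auto
    finally show "(tilt \<epsilon> \<tau> x)\<^sup>2 \<le> exp (2 * \<epsilon> * stat \<tau> x)" by simp
  qed
  also have "\<dots> \<le> ennreal (exp ((2 * \<epsilon>)\<^sup>2 * k))"
    using mgf[OF assms eps_sq(3)] by (simp add: stat_def)
  finally show ?thesis by (simp add: power_mult_distrib mult.assoc)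
qed

text \<open>To first order in \<open>\<epsilon>\<close> the tilted density is \<open>1 + \<epsilon> * stat \<tau>\<close>.\<close>

lemma tilt_remainder:
  assumes "\<tau> \<in> signs J"
  shows "integrable P (\<lambda>x. \<bar>tilt \<epsilon> \<tau> x - 1 - \<epsilon> * stat \<tau> x\<bar>)"
    "expectation (\<lambda>x. \<bar>tilt \<epsilon> \<tau> x - 1 - \<epsilon> * stat \<tau> x\<bar>) \<le> 130 * (\<epsilon>\<^sup>2 * k)"
proof -
  let ?Z = "partition_fun \<epsilon> \<tau>"
  have Z: "1 \<le> ?Z" "?Z \<le> 1 + 2 * (\<epsilon>\<^sup>2 * k)" by (rule partition_bounds[OF assms])+
  have ie: "integrable P (\<lambda>x. exp (\<epsilon> * stat \<tau> x))" using stat_mgf(1)[OF assms, of \<epsilon>] eps_sq(2) by simp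
  note ia = stat_abs_mgf[OF assms]
  have pt: "\<bar>tilt \<epsilon> \<tau> x - 1 - \<epsilon> * stat \<tau> x\<bar> \<le> 32 * (\<epsilon>\<^sup>2 * k) * exp (t0 * \<bar>stat \<tau> x\<bar>) + exp (\<epsilon> * stat \<tau> x) * (1 - 1 / ?Z)" for x
  proof -
    let ?s = "\<bar>stat \<tau> x\<bar>" and ?u = "\<epsilon> * stat \<tau> x"
    have "((t0 / 2 * ?s) / real 2) ^ 2 \<le> exp (t0 / 2 * ?s)" using t0 by (intro exp_ge_power) auto
    then have "?s\<^sup>2 * (t0\<^sup>2 / 16) \<le> exp (t0 / 2 * ?s)" by (simp add: power_divide power_mult_distrib mult.commute)
    then have s2: "?s\<^sup>2 \<le> 32 * k * exp (t0 / 2 * ?s)" using k_ge_1 by (simp add: t0(2) field_simps)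
    have "\<bar>exp ?u - 1 - ?u\<bar> \<le> ?u\<^sup>2 * exp \<bar>?u\<bar>" by (rule exp_taylor_le)
    also have "\<dots> = \<epsilon>\<^sup>2 * (?s\<^sup>2 * exp (\<epsilon> * ?s))" using \<epsilon> by (simp add: power_mult_distrib abs_mult)
    also have "\<dots> \<le> \<epsilon>\<^sup>2 * (32 * k * exp (t0 / 2 * ?s) * exp (t0 / 2 * ?s))"
      using s2 mult_right_mono[OF eps_le_half_t0, of ?s] by (intro mult_left_mono mult_mono) auto
    also have "\<dots> = 32 * (\<epsilon>\<^sup>2 * k) * exp (t0 * ?s)" by (simp add: exp_add[symmetric] mult.assoc)
    finally have 1: "\<bar>exp ?u - 1 - ?u\<bar> \<le> 32 * (\<epsilon>\<^sup>2 * k) * exp (t0 * ?s)" .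
    have "tilt \<epsilon> \<tau> x - 1 - ?u = (exp ?u - 1 - ?u) - exp ?u * (1 - 1 / ?Z)"
      by (simp add: tilt_def right_diff_distrib)
    moreover have "0 \<le> exp ?u * (1 - 1 / ?Z)" using Z by simp
    ultimately show ?thesis using 1 by linarith
  qed
  have s: "integrable P (\<lambda>x. 32 * (\<epsilon>\<^sup>2 * k) * exp (t0 * \<bar>stat \<tau> x\<bar>) + exp (\<epsilon> * stat \<tau> x) * (1 - 1 / ?Z))"
    using ie ia by simp
  have "integrable P (\<lambda>x. tilt \<epsilon> \<tau> x - 1 - \<epsilon> * stat \<tau> x)"
    using tilt_integrable[OF assms] stat_mean by simp
  then show i: "integrable P (\<lambda>x. \<bar>tilt \<epsilon> \<tau> x - 1 - \<epsilon> * stat \<tau> x\<bar>)" by (rule integrable_abs)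
  have "expectation (\<lambda>x. \<bar>tilt \<epsilon> \<tau> x - 1 - \<epsilon> * stat \<tau> x\<bar>)
      \<le> expectation (\<lambda>x. 32 * (\<epsilon>\<^sup>2 * k) * exp (t0 * \<bar>stat \<tau> x\<bar>) + exp (\<epsilon> * stat \<tau> x) * (1 - 1 / ?Z))"
    using pt by (intro integral_mono i s) auto
  also have "\<dots> = 32 * (\<epsilon>\<^sup>2 * k) * expectation (\<lambda>x. exp (t0 * \<bar>stat \<tau> x\<bar>)) + ?Z * (1 - 1 / ?Z)"
    using ie ia by (simp add: partition_fun_def)
  also have "?Z * (1 - 1 / ?Z) = ?Z - 1" using Z by (simp add: right_diff_distrib)
  also have "32 * (\<epsilon>\<^sup>2 * k) * expectation (\<lambda>x. exp (t0 * \<bar>stat \<tau> x\<bar>)) \<le> 32 * (\<epsilon>\<^sup>2 * k) * 4"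
    using ia by (intro mult_left_mono) auto
  finally show "expectation (\<lambda>x. \<bar>tilt \<epsilon> \<tau> x - 1 - \<epsilon> * stat \<tau> x\<bar>) \<le> 130 * (\<epsilon>\<^sup>2 * k)"
    using Z by linarith
qed

text \<open>The first order term is a multiple of \<open>\<epsilon> * sqrt k\<close> and the remainders are multiples of its
square; the bound on \<open>\<epsilon> * sqrt k\<close> is small enough for the former to prevail.\<close>

lemma tilt_separation:
  assumes \<tau>: "\<tau> \<in> signs J" "\<tau>' \<in> signs J" and far: "card J \<le> 8 * card {j\<in>J. \<tau> j \<noteq> \<tau>' j}"
  shows "\<epsilon> * sqrt k / 4096 \<le> expectation (\<lambda>x. \<bar>tilt \<epsilon> \<tau> x - tilt \<epsilon> \<tau>' x\<bar>)"
proof -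
  let ?R = "\<lambda>\<tau> x. \<bar>tilt \<epsilon> \<tau> x - 1 - \<epsilon> * stat \<tau> x\<bar>"
  have i: "integrable P (\<lambda>x. \<bar>stat \<tau> x - stat \<tau>' x\<bar>)" using stat_mean by simp
  have pt: "\<epsilon> * \<bar>stat \<tau> x - stat \<tau>' x\<bar> - ?R \<tau> x - ?R \<tau>' x \<le> \<bar>tilt \<epsilon> \<tau> x - tilt \<epsilon> \<tau>' x\<bar>" for x
  proof -
    have "\<epsilon> * \<bar>stat \<tau> x - stat \<tau>' x\<bar> = \<bar>\<epsilon> * stat \<tau> x - \<epsilon> * stat \<tau>' x\<bar>"
      using \<epsilon>(1) by (simp add: right_diff_distrib[symmetric] abs_mult)
    then show ?thesis by linarith
  qed
  have "\<epsilon> * sqrt k / 4096 \<le> \<epsilon> * (sqrt k / 2048) - 130 * (\<epsilon>\<^sup>2 * k) - 130 * (\<epsilon>\<^sup>2 * k)"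
  proof -
    have "0 \<le> \<epsilon> * sqrt k" using \<epsilon>(1) by simp
    then show ?thesis using eps_sq(1) by linarith
  qed
  also have "\<dots> \<le> \<epsilon> * expectation (\<lambda>x. \<bar>stat \<tau> x - stat \<tau>' x\<bar>) - expectation (?R \<tau>) - expectation (?R \<tau>')"
    using expectation_abs_diff_ge[OF \<tau> far] tilt_remainder(2)[OF \<tau>(1)] tilt_remainder(2)[OF \<tau>(2)] \<epsilon>(1)
    by (intro diff_mono mult_left_mono) auto
  also have "\<dots> = expectation (\<lambda>x. \<epsilon> * \<bar>stat \<tau> x - stat \<tau>' x\<bar> - ?R \<tau> x - ?R \<tau>' x)"
    using i tilt_remainder(1)[OF \<tau>(1)] tilt_remainder(1)[OF \<tau>(2)]
    by (simp add: Bochner_Integration.integral_diff)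
  also have "\<dots> \<le> expectation (\<lambda>x. \<bar>tilt \<epsilon> \<tau> x - tilt \<epsilon> \<tau>' x\<bar>)"
    using i tilt_remainder(1)[OF \<tau>(1)] tilt_remainder(1)[OF \<tau>(2)] tilt_integrable[OF \<tau>(1)] tilt_integrable[OF \<tau>(2)] pt
    by (intro integral_mono) auto
  finally show ?thesis .
qed

end

end

text \<open>The denominator is \<open>2 ^ 21 * 2 ^ 14 * 20\<close>: the factors stem from the bound on \<open>\<epsilon> * sqrt k\<close>, from
half the separation of the hypotheses, and from \<open>1 - q = 1 / 20\<close>.\<close>

abbreviation lower_const :: real where
  "lower_const \<equiv> 1 / 687194767360"

text \<open>For \<open>\<epsilon>\<close> of order \<open>1 / sqrt (max n k)\<close> the likelihood ratio of \<open>n\<close> samples has second moment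
below \<open>(16/15) ^ k\<close>, which the proportion \<open>(3/4) ^ k\<close> of close sign vectors outweighs.  In the
assumption on \<open>F\<close> the constant \<open>c\<close> is determined by normalization.\<close>

theorem sign_family_minimax_risk_ge:
  fixes M :: "'a measure" and \<xi> :: "'j \<Rightarrow> 'a \<Rightarrow> real"
  assumes M: "sigma_finite_measure M" and p0: "prob_density M p0"
    and fam: "sign_family (density M (\<lambda>x. ennreal (p0 x))) J \<xi>" and n: "n > 0"
    and F: "\<And>\<epsilon> \<tau>. 0 < \<epsilon> \<Longrightarrow> \<epsilon>\<^sup>2 * real (card J) \<le> 1 / 4 \<Longrightarrow> \<tau> \<in> signs J \<Longrightarrow>
      \<exists>f\<in>F. prob_density M f \<and> (\<exists>c. \<forall>x\<in>space M. f x = c * (p0 x * exp (\<epsilon> * (\<Sum>j\<in>J. \<tau> j * \<xi> j x))))"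
  shows "ennreal (lower_const * min 1 (sqrt (real (card J) / real n))) \<le> minimax_risk M n F"
proof -
  define P where "P = density M (\<lambda>x. ennreal (p0 x))"
  interpret sign_family P J \<xi> unfolding P_def by (rule fam)
  note p = prob_densityD[OF p0]
  have setsP [measurable_cong]: "sets P = sets M" by (simp add: P_def)
  have AEp: "AE x in M. 0 \<le> p0 x" using p(2) by auto
  have int_P: "(\<integral>x. h x \<partial>P) = (\<integral>x. p0 x * h x \<partial>M)" if "h \<in> borel_measurable M" for h :: "'a \<Rightarrow> real"
    unfolding P_def using integral_density[OF that p(1) AEp] by simp
  define \<epsilon> where "\<epsilon> = 1 / 2097152 / sqrt (max n k)"
  have mx: "max (real n) k \<ge> 1" "max (real n) k > 0" using k_ge_1 by auto
  have \<epsilon>0: "\<epsilon> > 0" using mx by (simp add: \<epsilon>_def)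
  have ek: "\<epsilon> * sqrt k = 1 / 2097152 * min 1 (sqrt (k / n))"
  proof (cases "real n \<le> k")
    case True
    then have "1 \<le> k / n" using n by (simp add: field_simps)
    then have "1 \<le> sqrt (k / n)" by simp
    then show ?thesis using True k_ge_1 by (simp add: \<epsilon>_def max_def)
  next
    case False
    then have "k / n \<le> 1" using n by (simp add: field_simps)
    then have "sqrt (k / n) \<le> 1" by simp
    then show ?thesis using False by (simp add: \<epsilon>_def max_def real_sqrt_divide)
  qed
  have e1: "\<epsilon> * sqrt k \<le> 1 / 2097152" unfolding ek by simp
  note eps = \<epsilon>0 e1
  have "\<epsilon>\<^sup>2 * k \<le> 1 / 4" using eps_sq(2)[OF eps] by simp
  then have "\<forall>\<tau>\<in>signs J. \<exists>f. f \<in> F \<and> prob_density M f \<and>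
      (\<exists>c. \<forall>x\<in>space M. f x = c * (p0 x * exp (\<epsilon> * stat \<tau> x)))"
    using F[OF \<epsilon>0] unfolding stat_def by blast
  then obtain f where f: "\<And>\<tau>. \<tau> \<in> signs J \<Longrightarrow> f \<tau> \<in> F" "\<And>\<tau>. \<tau> \<in> signs J \<Longrightarrow> prob_density M (f \<tau>)"
    "\<And>\<tau>. \<tau> \<in> signs J \<Longrightarrow> \<exists>c. \<forall>x\<in>space M. f \<tau> x = c * (p0 x * exp (\<epsilon> * stat \<tau> x))" by metis
  have statM: "stat \<tau> \<in> borel_measurable M" for \<tau> using stat_measurable[of \<tau>] by (simp add: measurable_cong_sets[OF setsP refl])
  have tiltM: "tilt \<epsilon> \<tau> \<in> borel_measurable M" for \<tau> using tilt_measurable[of \<epsilon> \<tau>] by (simp add: measurable_cong_sets[OF setsP refl])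
  have ft: "f \<tau> x = p0 x * tilt \<epsilon> \<tau> x" if \<tau>: "\<tau> \<in> signs J" and x: "x \<in> space M" for \<tau> x
  proof -
    obtain c where c: "\<And>x. x \<in> space M \<Longrightarrow> f \<tau> x = c * (p0 x * exp (\<epsilon> * stat \<tau> x))" using f(3)[OF \<tau>] by blast
    have "1 = (\<integral>x. f \<tau> x \<partial>M)" using prob_densityD(5)[OF f(2)[OF \<tau>]] by simp
    also have "\<dots> = (\<integral>x. c * (p0 x * exp (\<epsilon> * stat \<tau> x)) \<partial>M)" by (rule Bochner_Integration.integral_cong) (use c in auto)
    also have "\<dots> = c * partition_fun \<epsilon> \<tau>"
      unfolding partition_fun_def using statM[of \<tau>] by (subst int_P) auto
    finally have "c = 1 / partition_fun \<epsilon> \<tau>" using partition_bounds(1)[OF eps \<tau>] by (simp add: field_simps)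
    then show ?thesis using c[OF x] by (simp add: tilt_def)
  qed
  define r where "r = \<epsilon> * sqrt k / 16384"
  define b where "b = nat \<lfloor>(3 / 2 :: real) ^ card J\<rfloor>"
  have TV: "ennreal (2 * r) \<le> TV M (f \<tau>) (f \<tau>')"
    if \<tau>: "\<tau> \<in> signs J" "\<tau>' \<in> signs J" and far: "card J \<le> 8 * card {j\<in>J. \<tau> j \<noteq> \<tau>' j}" for \<tau> \<tau>'
  proof -
    have "(\<integral>x. \<bar>f \<tau> x - f \<tau>' x\<bar> \<partial>M) = (\<integral>x. p0 x * \<bar>tilt \<epsilon> \<tau> x - tilt \<epsilon> \<tau>' x\<bar> \<partial>M)"
    proof (rule Bochner_Integration.integral_cong)
      fix x assume x: "x \<in> space M"
      have "f \<tau> x - f \<tau>' x = p0 x * (tilt \<epsilon> \<tau> x - tilt \<epsilon> \<tau>' x)"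
        using ft[OF \<tau>(1) x] ft[OF \<tau>(2) x] by (simp add: right_diff_distrib)
      then show "\<bar>f \<tau> x - f \<tau>' x\<bar> = p0 x * \<bar>tilt \<epsilon> \<tau> x - tilt \<epsilon> \<tau>' x\<bar>" using p(2)[OF x] by (simp add: abs_mult)
    qed simp
    also have "\<dots> = expectation (\<lambda>x. \<bar>tilt \<epsilon> \<tau> x - tilt \<epsilon> \<tau>' x\<bar>)"
      using tiltM[of \<tau>] tiltM[of \<tau>'] by (subst int_P) auto
    finally have "4 * r \<le> (\<integral>x. \<bar>f \<tau> x - f \<tau>' x\<bar> \<partial>M)"
      using tilt_separation[OF eps \<tau> far] by (simp add: r_def)
    then show ?thesis unfolding TV_eq_integral[OF f(2)[OF \<tau>(1)] f(2)[OF \<tau>(2)]] by (intro ennreal_leI) simp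
  qed
  have near: "card {\<tau>'\<in>signs J. TV M (f \<tau>) (f \<tau>') < ennreal (2 * r)} \<le> b" if \<tau>: "\<tau> \<in> signs J" for \<tau>
  proof -
    have "{\<tau>'\<in>signs J. TV M (f \<tau>) (f \<tau>') < ennreal (2 * r)}
        \<subseteq> {\<tau>'\<in>signs J. 8 * card {j\<in>J. \<tau> j \<noteq> \<tau>' j} < card J}"
      using TV[OF \<tau>] by (auto simp: not_less[symmetric])
    then have "card {\<tau>'\<in>signs J. TV M (f \<tau>) (f \<tau>') < ennreal (2 * r)}
        \<le> card {\<tau>'\<in>signs J. 8 * card {j\<in>J. \<tau> j \<noteq> \<tau>' j} < card J}"
      using finite_signs[OF J(1)] by (intro card_mono) auto
    then have "real (card {\<tau>'\<in>signs J. TV M (f \<tau>) (f \<tau>') < ennreal (2 * r)}) \<le> (3 / 2) ^ card J"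
      using card_near_signs[OF J(1) \<tau>] by linarith
    then show ?thesis unfolding b_def by (simp add: le_nat_floor)
  qed
  have "n * (\<epsilon>\<^sup>2 * k) \<le> k / 2 ^ 42"
  proof -
    have "n * \<epsilon>\<^sup>2 = n / max n k / 2 ^ 42" using mx by (simp add: \<epsilon>_def power_divide)
    also have "\<dots> \<le> 1 / 2 ^ 42" using mx by (intro divide_right_mono) (auto simp: divide_le_eq)
    finally have "n * \<epsilon>\<^sup>2 * k \<le> 1 / 2 ^ 42 * k" by (rule mult_right_mono) simp
    then show ?thesis by (simp add: mult.assoc)
  qed
  then have "exp (4 * (\<epsilon>\<^sup>2 * k)) ^ n \<le> exp (k * (1 / 2 ^ 40))"
    by (subst exp_of_nat_mult[symmetric]) simp
  also have "\<dots> = exp (1 / 2 ^ 40) ^ card J" by (simp only: exp_of_nat_mult)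
  also have "\<dots> \<le> (16 / 15) ^ card J"
  proof (intro power_mono)
    have "exp (1 / 2 ^ 40 :: real) \<le> 1 + 1 / 2 ^ 40 + (1 / 2 ^ 40)\<^sup>2" by (rule exp_bound) auto
    also have "\<dots> \<le> 16 / 15" by (simp add: power_divide)
    finally show "exp (1 / 2 ^ 40 :: real) \<le> 16 / 15" .
  qed simp
  finally have "exp (4 * (\<epsilon>\<^sup>2 * k)) ^ n * real b \<le> (16 / 15) ^ card J * (3 / 2) ^ card J"
    unfolding b_def by (intro mult_mono) auto
  also have "\<dots> = (4 / 5) ^ card J * 2 ^ card J" by (simp add: power_mult_distrib[symmetric])
  also have "\<dots> \<le> (19 / 20)\<^sup>2 * 2 ^ card J"
  proof (intro mult_right_mono)
    have "(4 / 5 :: real) ^ card J \<le> (4 / 5) ^ 1" using k_ge_1 by (intro power_decreasing) auto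
    then show "(4 / 5 :: real) ^ card J \<le> (19 / 20)\<^sup>2" by (simp add: power2_eq_square)
  qed simp
  finally have q: "exp (4 * (\<epsilon>\<^sup>2 * k)) ^ n * real b \<le> (19 / 20)\<^sup>2 * real (card (signs J))"
    by (simp add: card_signs[OF J(1)])
  have ne: "signs J \<noteq> {}" by (simp add: signs_def PiE_eq_empty_iff)
  have main: "ennreal (r * (1 - 19 / 20)) \<le> minimax_risk M n F"
  proof (rule minimax_risk_ge[OF M p0 finite_signs[OF J(1)] ne f(2) f(1) tiltM tilt_nonneg[OF eps] ft _ _ _ near _ q])
    show "(\<integral>\<^sup>+ x. ennreal ((tilt \<epsilon> \<tau> x)\<^sup>2) \<partial>density M (\<lambda>x. ennreal (p0 x))) \<le> ennreal (exp (4 * (\<epsilon>\<^sup>2 * k)))"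
      if "\<tau> \<in> signs J" for \<tau> using tilt_second_moment[OF eps that] unfolding P_def .
    show "r > 0" using \<epsilon>0 k_ge_1 by (simp add: r_def)
  qed auto
  have eq: "r * (1 - 19 / 20) = lower_const * min 1 (sqrt (k / n))"
    unfolding r_def ek by simp
  show ?thesis using main unfolding eq .
qed

section \<open>Products of subgaussian coordinates\<close>

text \<open>The standard normal law and the uniform law on \<open>{-1, 1}\<close> both qualify as \<open>\<nu>\<close>, so the
hypotheses for normal and for Ising models are analysed together.\<close>

locale subgaussian_product = prob_space \<nu> for \<nu> :: "real measure" +
  fixes d :: nat
  assumes coord_measurable [measurable]: "(\<lambda>x. x) \<in> borel_measurable \<nu>"
    and coord_mgf: "\<And>t. (\<integral>\<^sup>+ x. ennreal (exp (t * x)) \<partial>\<nu>) \<le> ennreal (exp (t\<^sup>2 / 2))"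
    and coord_mean: "has_bochner_integral \<nu> (\<lambda>x. x) 0"
    and coord_variance: "has_bochner_integral \<nu> (\<lambda>x. x\<^sup>2) 1"
begin

abbreviation "prod_law I \<equiv> PiM I (\<lambda>_::nat. \<nu>)"

sublocale product_sigma_finite "\<lambda>_::nat. \<nu>"
  by unfold_locales

lemma prob_space_prod_law: "prob_space (prod_law I)"
  by (rule prob_space_PiM) unfold_locales

lemma component_measurable [measurable]: "i \<in> I \<Longrightarrow> (\<lambda>x. x i) \<in> borel_measurable (prod_law I)"
  using measurable_compose[OF measurable_component_singleton[of i I "\<lambda>_. \<nu>"] coord_measurable] by simp

lemma monomial_moment:
  fixes e :: "nat \<Rightarrow> nat"
  assumes "\<And>i. i < d \<Longrightarrow> e i \<le> 2"
  shows "has_bochner_integral (prod_law {..<d}) (\<lambda>x. \<Prod>i<d. x i ^ e i) (if \<exists>i<d. e i = 1 then 0 else 1)"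
proof -
  have one: "has_bochner_integral \<nu> (\<lambda>x. x ^ 0) 1"
    by (simp add: has_bochner_integral_iff prob_space)
  have m: "has_bochner_integral \<nu> (\<lambda>x. x ^ e i) (if e i = 1 then 0 else 1)" if "i < d" for i
  proof -
    have "e i \<le> 2" using assms that by blast
    then consider "e i = 0" | "e i = 1" | "e i = 2" by linarith
    then show ?thesis using one coord_mean coord_variance by cases auto
  qed
  then have i: "integrable \<nu> (\<lambda>x. x ^ e i)" "integral\<^sup>L \<nu> (\<lambda>x. x ^ e i) = (if e i = 1 then 0 else 1)" if "i < d" for i
    using that by (auto simp: has_bochner_integral_iff)
  have "(\<integral>x. (\<Prod>i<d. x i ^ e i) \<partial>prod_law {..<d}) = (\<Prod>i<d. if e i = 1 then 0 else 1)"
    using i by (subst product_integral_prod[where f = "\<lambda>i x. x ^ e i"]) (auto intro!: prod.cong)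
  also have "\<dots> = (if \<exists>i<d. e i = 1 then 0 else 1)"
    by (auto simp: prod_zero_iff intro!: prod.neutral)
  finally show ?thesis
    using i product_integrable_prod[of "{..<d}" "\<lambda>i x. x ^ e i"] by (simp add: has_bochner_integral_iff)
qed

lemma linear_mgf:
  assumes "finite I"
  shows "(\<integral>\<^sup>+ x. ennreal (exp (\<Sum>i\<in>I. c i * x i)) \<partial>prod_law I) \<le> ennreal (exp ((\<Sum>i\<in>I. (c i)\<^sup>2) / 2))"
proof -
  have "(\<integral>\<^sup>+ x. ennreal (exp (\<Sum>i\<in>I. c i * x i)) \<partial>prod_law I) = (\<integral>\<^sup>+ x. (\<Prod>i\<in>I. ennreal (exp (c i * x i))) \<partial>prod_law I)"
    using assms by (simp add: exp_sum prod_ennreal)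
  also have "\<dots> = (\<Prod>i\<in>I. \<integral>\<^sup>+ x. ennreal (exp (c i * x)) \<partial>\<nu>)"
    using assms by (intro product_nn_integral_prod) auto
  also have "\<dots> \<le> (\<Prod>i\<in>I. ennreal (exp ((c i)\<^sup>2 / 2)))"
    by (intro prod_mono_ennreal coord_mgf)
  also have "\<dots> = ennreal (exp ((\<Sum>i\<in>I. (c i)\<^sup>2) / 2))"
    using assms by (simp add: prod_ennreal exp_sum sum_divide_distrib)
  finally show ?thesis .
qed

definition unit_exp :: "nat \<Rightarrow> nat \<Rightarrow> nat" where
  "unit_exp a i = (if i = a then 1 else 0)"

lemma prod_unit_exp: "a < d \<Longrightarrow> (\<Prod>i<d. x i ^ unit_exp a i) = (x a :: real)"
  by (subst prod.remove[of _ a]) (auto simp: unit_exp_def intro!: prod.neutral)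

lemma linear_sign_family:
  assumes "d \<ge> 1"
  shows "sign_family (prod_law {..<d}) {..<d} (\<lambda>a x. x a)"
proof -
  interpret P: prob_space "prod_law {..<d}" by (rule prob_space_prod_law)
  show ?thesis
  proof unfold_locales
    show "has_bochner_integral (prod_law {..<d}) (\<lambda>x. x j) 0" if "j \<in> {..<d}" for j
    proof -
      have "has_bochner_integral (prod_law {..<d}) (\<lambda>x. \<Prod>i<d. x i ^ unit_exp j i) (if \<exists>i<d. unit_exp j i = 1 then 0 else 1)"
        by (rule monomial_moment) (simp add: unit_exp_def)
      moreover have "\<exists>i<d. unit_exp j i = 1" using that by (auto simp: unit_exp_def)
      ultimately show ?thesis using that by (simp add: prod_unit_exp)
    qed
    show "has_bochner_integral (prod_law {..<d}) (\<lambda>x. x a * x b) (if a = b then 1 else 0)"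
      if "a \<in> {..<d}" "b \<in> {..<d}" for a b
    proof -
      let ?e = "\<lambda>i. unit_exp a i + unit_exp b i"
      have m: "has_bochner_integral (prod_law {..<d}) (\<lambda>x. \<Prod>i<d. x i ^ ?e i) (if \<exists>i<d. ?e i = 1 then 0 else 1)"
        by (rule monomial_moment) (simp add: unit_exp_def)
      have "(\<exists>i<d. ?e i = 1) \<longleftrightarrow> a \<noteq> b" using that by (auto simp: unit_exp_def)
      then have v: "(if \<exists>i<d. ?e i = 1 then 0 else 1 :: real) = (if a = b then 1 else 0)" by simp
      show ?thesis using m[unfolded v] that by (simp add: power_add prod.distrib prod_unit_exp)
    qed
    show "(\<integral>\<^sup>+ x. ennreal (exp (t * (\<Sum>j\<in>{..<d}. \<tau> j * x j))) \<partial>prod_law {..<d}) \<le> ennreal (exp (t\<^sup>2 * real (card {..<d})))"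
      if "\<tau> \<in> signs {..<d}" "t\<^sup>2 * real (card {..<d}) \<le> 1 / 2" for \<tau> t
    proof -
      have "(\<integral>\<^sup>+ x. ennreal (exp (t * (\<Sum>j\<in>{..<d}. \<tau> j * x j))) \<partial>prod_law {..<d})
          \<le> ennreal (exp ((\<Sum>i<d. (t * \<tau> i)\<^sup>2) / 2))"
        using linear_mgf[of "{..<d}" "\<lambda>i. t * \<tau> i"] by (simp add: sum_distrib_left mult.assoc)
      also have "(\<Sum>i<d. (t * \<tau> i)\<^sup>2) = (\<Sum>i<d. t\<^sup>2)"
        using that(1) by (intro sum.cong) (auto simp: signs_def PiE_iff power_mult_distrib power2_eq_1_iff)
      also have "ennreal (exp ((\<Sum>i<d. t\<^sup>2) / 2)) \<le> ennreal (exp (t\<^sup>2 * real (card {..<d})))"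
        by (intro ennreal_leI) (simp add: mult.commute)
      finally show ?thesis .
    qed
    have "0 \<in> {..<d}" using assms by simp
    then show "{..<d} \<noteq> {}" by blast
  qed auto
qed

text \<open>Since \<open>exp (u * s\<^sup>2)\<close> is the average of \<open>exp (sqrt (2 * u) * s * y)\<close> over a standard normal \<open>y\<close>,
an exchange of the integrals leaves the exponential moment of a linear form, and then a normal
integral in \<open>y\<close>.\<close>

lemma square_mgf:
  assumes I: "finite I" and c: "(\<Sum>i\<in>I. (c i)\<^sup>2) \<le> l" and u: "0 \<le> u" "2 * u * l < 1"
  shows "(\<integral>\<^sup>+ x. ennreal (exp (u * (\<Sum>i\<in>I. c i * x i)\<^sup>2)) \<partial>prod_law I) \<le> ennreal (1 / sqrt (1 - 2 * u * l))"
proof -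
  interpret P: prob_space "prod_law I" by (rule prob_space_prod_law)
  interpret PL: pair_sigma_finite "prod_law I" lborel by unfold_locales
  let ?s = "\<lambda>x. \<Sum>i\<in>I. c i * x i"
  have s_meas [measurable]: "?s \<in> borel_measurable (prod_law I)" by measurable
  let ?g = "\<lambda>x y. ennreal (exp (- (1 * (y - 0)\<^sup>2) / 2 + (sqrt (2 * u) * ?s x) * (y - 0)))"
  have lin: "ennreal (sqrt (2 * pi)) * ennreal (exp (u * (?s x)\<^sup>2)) = (\<integral>\<^sup>+ y. ?g x y \<partial>lborel)" for x
    using u by (subst nn_integral_gaussian_1d) (simp_all add: ennreal_mult[symmetric] power_mult_distrib)
  have "ennreal (sqrt (2 * pi)) * (\<integral>\<^sup>+ x. ennreal (exp (u * (?s x)\<^sup>2)) \<partial>prod_law I)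
      = (\<integral>\<^sup>+ x. (\<integral>\<^sup>+ y. ?g x y \<partial>lborel) \<partial>prod_law I)"
    by (subst nn_integral_cmult[symmetric]) (simp_all only: lin, measurable)
  also have "\<dots> = (\<integral>\<^sup>+ y. (\<integral>\<^sup>+ x. ?g x y \<partial>prod_law I) \<partial>lborel)"
    by (rule PL.Fubini'[symmetric]) measurable
  also have "\<dots> \<le> (\<integral>\<^sup>+ y. ennreal (exp (- ((1 - 2 * u * l) * (y - 0)\<^sup>2) / 2 + 0 * (y - 0))) \<partial>lborel)"
  proof (rule nn_integral_mono)
    fix y :: real
    have "(\<integral>\<^sup>+ x. ?g x y \<partial>prod_law I)
        = (\<integral>\<^sup>+ x. ennreal (exp (- y\<^sup>2 / 2)) * ennreal (exp (\<Sum>i\<in>I. (sqrt (2 * u) * y * c i) * x i)) \<partial>prod_law I)"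
      by (intro nn_integral_cong) (simp add: ennreal_mult[symmetric] exp_add[symmetric] sum_distrib_left sum_distrib_right mult_ac)
    also have "\<dots> = ennreal (exp (- y\<^sup>2 / 2)) * (\<integral>\<^sup>+ x. ennreal (exp (\<Sum>i\<in>I. (sqrt (2 * u) * y * c i) * x i)) \<partial>prod_law I)"
      by (rule nn_integral_cmult) measurable
    also have "\<dots> \<le> ennreal (exp (- y\<^sup>2 / 2)) * ennreal (exp ((\<Sum>i\<in>I. (sqrt (2 * u) * y * c i)\<^sup>2) / 2))"
      by (intro mult_left_mono linear_mgf I) simp
    also have "\<dots> \<le> ennreal (exp (- y\<^sup>2 / 2)) * ennreal (exp (u * y\<^sup>2 * l))"
    proof (intro mult_left_mono ennreal_leI)
      have "(\<Sum>i\<in>I. (sqrt (2 * u) * y * c i)\<^sup>2) / 2 = u * y\<^sup>2 * (\<Sum>i\<in>I. (c i)\<^sup>2)"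
        using u by (simp add: power_mult_distrib sum_distrib_left[symmetric])
      also have "\<dots> \<le> u * y\<^sup>2 * l" using u c by (intro mult_left_mono) auto
      finally show "exp ((\<Sum>i\<in>I. (sqrt (2 * u) * y * c i)\<^sup>2) / 2) \<le> exp (u * y\<^sup>2 * l)" by simp
    qed simp
    also have "\<dots> = ennreal (exp (- ((1 - 2 * u * l) * (y - 0)\<^sup>2) / 2 + 0 * (y - 0)))"
      by (simp add: ennreal_mult[symmetric] exp_add[symmetric] field_simps)
    finally show "(\<integral>\<^sup>+ x. ?g x y \<partial>prod_law I) \<le> ennreal (exp (- ((1 - 2 * u * l) * (y - 0)\<^sup>2) / 2 + 0 * (y - 0)))" .
  qed
  also have "\<dots> = ennreal (sqrt (2 * pi / (1 - 2 * u * l)) * exp (0\<^sup>2 / (2 * (1 - 2 * u * l))))"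
    using u by (intro nn_integral_gaussian_1d) simp
  also have "\<dots> = ennreal (sqrt (2 * pi)) * ennreal (1 / sqrt (1 - 2 * u * l))"
    using u by (simp add: ennreal_mult[symmetric] real_sqrt_divide)
  finally have le: "ennreal (sqrt (2 * pi)) * (\<integral>\<^sup>+ x. ennreal (exp (u * (?s x)\<^sup>2)) \<partial>prod_law I)
      \<le> ennreal (sqrt (2 * pi)) * ennreal (1 / sqrt (1 - 2 * u * l))" .
  have "sqrt (2 * pi) > 0" by simp
  then have "ennreal (sqrt (2 * pi)) \<noteq> 0" by (simp only: ennreal_eq_0_iff not_le)
  then show ?thesis using le by (subst (asm) ennreal_mult_le_mult_iff) auto
qed

lemma inverse_sqrt_le_exp:
  fixes x :: real
  assumes "0 \<le> x" "x \<le> 1 / 2"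
  shows "1 / sqrt (1 - x) \<le> exp x"
proof -
  have "x * x \<le> 1 / 2 * (1 / 2)" using assms by (intro mult_mono) auto
  then have "0 \<le> x * (1 - x - x * x)" using assms by (intro mult_nonneg_nonneg) auto
  then have "1 \<le> (1 - x) * ((1 + x) * (1 + x))" by (simp add: algebra_simps)
  also have "\<dots> \<le> (1 - x) * (exp x * exp x)"
    using assms exp_ge_add_one_self[of x] by (intro mult_left_mono mult_mono) auto
  finally have "1 / (1 - x) \<le> (exp x)\<^sup>2" using assms by (simp add: pos_divide_le_eq power2_eq_square mult.commute)
  then have "sqrt (1 / (1 - x)) \<le> exp x" by (intro real_le_lsqrt) (use assms in auto)
  then show ?thesis by (simp add: real_sqrt_divide)
qed

text \<open>Jensen's inequality for \<open>exp\<close>, from its tangent at \<open>\<Sum>b\<in>R. v b\<close>.\<close>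

lemma exp_sum_le_average:
  fixes v :: "'b \<Rightarrow> real"
  assumes "finite R" "R \<noteq> {}"
  shows "exp (\<Sum>b\<in>R. v b) \<le> (\<Sum>b\<in>R. exp (real (card R) * v b)) / real (card R)"
proof -
  let ?A = "\<Sum>b\<in>R. v b" and ?r = "real (card R)"
  have r: "?r > 0" using assms by (simp add: card_gt_0_iff)
  have "(\<Sum>b\<in>R. exp ?A * (1 + (?r * v b - ?A))) \<le> (\<Sum>b\<in>R. exp (?r * v b))"
  proof (rule sum_mono)
    fix b
    have "exp ?A * (1 + (?r * v b - ?A)) \<le> exp ?A * exp (?r * v b - ?A)"
      using exp_ge_add_one_self by (intro mult_left_mono) auto
    then show "exp ?A * (1 + (?r * v b - ?A)) \<le> exp (?r * v b)" by (simp add: exp_add[symmetric])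
  qed
  also have "(\<Sum>b\<in>R. exp ?A * (1 + (?r * v b - ?A))) = exp ?A * (?r + (?r * ?A - ?r * ?A))"
    by (simp add: sum_distrib_left[symmetric] sum.distrib sum_subtractf)
  finally show ?thesis using r by (simp add: field_simps)
qed

text \<open>For fixed coordinates on the left side the exponent is linear in the coordinates on the right side.
Integrating these out leaves the exponential of a sum of squares of linear forms, one for each vertex
on the right; convexity of \<open>exp\<close> reduces this sum to \<open>r\<close> times a single square.\<close>

lemma bipartite_mgf:
  assumes l: "l \<ge> 1" and r: "r \<ge> 1" and lr: "l + r \<le> d" and \<tau>: "\<tau> \<in> signs ({..<l} \<times> {l..<l + r})"
    and t: "t\<^sup>2 * real (l * r) \<le> 1 / 2"
  shows "(\<integral>\<^sup>+ x. ennreal (exp (t * (\<Sum>p\<in>{..<l} \<times> {l..<l + r}. \<tau> p * (x (fst p) * x (snd p))))) \<partial>prod_law {..<d})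
     \<le> ennreal (exp (t\<^sup>2 * real (l * r)))"
proof -
  let ?R = "{l..<l + r}" and ?I = "{..<d} - {l..<l + r}"
  have un: "?I \<union> ?R = {..<d}" using lr by auto
  have dis: "?I \<inter> ?R = {}" by auto
  have LI: "{..<l} \<subseteq> ?I" using lr by auto
  define s where "s = (\<lambda>b x. \<Sum>i\<in>?I. (if i < l then \<tau> (i, b) else 0) * x i)"
  have s_eq: "s b x = (\<Sum>a<l. \<tau> (a, b) * x a)" for b and x :: "nat \<Rightarrow> real"
    unfolding s_def using LI by (intro sum.mono_neutral_cong_right) auto
  have s_meas [measurable]: "s b \<in> borel_measurable (prod_law ?I)" for b unfolding s_def by measurable
  let ?f = "\<lambda>x. ennreal (exp (t * (\<Sum>p\<in>{..<l} \<times> ?R. \<tau> p * (x (fst p) * x (snd p)))))"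
  have fm: "?f \<in> borel_measurable (prod_law (?I \<union> ?R))"
  proof -
    have "(\<lambda>x. x (fst p) * x (snd p)) \<in> borel_measurable (prod_law (?I \<union> ?R))" if "p \<in> {..<l} \<times> ?R" for p
    proof -
      have "fst p \<in> ?I \<union> ?R" "snd p \<in> ?I \<union> ?R" using that lr by auto
      then show ?thesis by measurable
    qed
    then show ?thesis by measurable
  qed
  have "(\<integral>\<^sup>+ x. ?f x \<partial>prod_law {..<d}) = (\<integral>\<^sup>+ x. (\<integral>\<^sup>+ y. ?f (merge ?I ?R (x, y)) \<partial>prod_law ?R) \<partial>prod_law ?I)"
    using product_nn_integral_fold[OF dis _ _ fm] unfolding un by simp
  also have "\<dots> \<le> (\<integral>\<^sup>+ x. (\<Sum>b\<in>?R. ennreal (1 / r) * ennreal (exp (r * t\<^sup>2 / 2 * (s b x)\<^sup>2))) \<partial>prod_law ?I)"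
  proof (rule nn_integral_mono)
    fix x :: "nat \<Rightarrow> real"
    have "(\<integral>\<^sup>+ y. ?f (merge ?I ?R (x, y)) \<partial>prod_law ?R) = (\<integral>\<^sup>+ y. ennreal (exp (\<Sum>b\<in>?R. (t * s b x) * y b)) \<partial>prod_law ?R)"
    proof (rule nn_integral_cong)
      fix y :: "nat \<Rightarrow> real"
      have "(\<Sum>p\<in>{..<l} \<times> ?R. \<tau> p * (merge ?I ?R (x, y) (fst p) * merge ?I ?R (x, y) (snd p)))
          = (\<Sum>p\<in>{..<l} \<times> ?R. \<tau> p * (x (fst p) * y (snd p)))"
        using LI by (intro sum.cong) (auto simp: merge_def)
      also have "\<dots> = (\<Sum>a<l. \<Sum>b\<in>?R. \<tau> (a, b) * (x a * y b))" by (simp add: sum.cartesian_product case_prod_beta')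
      also have "\<dots> = (\<Sum>b\<in>?R. s b x * y b)"
        unfolding s_eq sum_distrib_right by (subst sum.swap) (simp add: mult_ac)
      finally show "?f (merge ?I ?R (x, y)) = ennreal (exp (\<Sum>b\<in>?R. (t * s b x) * y b))"
        by (simp add: sum_distrib_left mult.assoc)
    qed
    also have "\<dots> \<le> ennreal (exp ((\<Sum>b\<in>?R. (t * s b x)\<^sup>2) / 2))" by (rule linear_mgf) simp
    also have "\<dots> \<le> ennreal ((\<Sum>b\<in>?R. exp (real (card ?R) * ((t * s b x)\<^sup>2 / 2))) / real (card ?R))"
      unfolding sum_divide_distrib[of _ _ 2] using r by (intro ennreal_leI exp_sum_le_average) auto
    also have "(\<Sum>b\<in>?R. exp (real (card ?R) * ((t * s b x)\<^sup>2 / 2))) / real (card ?R)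
        = (\<Sum>b\<in>?R. 1 / r * exp (r * t\<^sup>2 / 2 * (s b x)\<^sup>2))"
      unfolding sum_divide_distrib by (rule sum.cong) (auto simp: power_mult_distrib mult_ac)
    also have "ennreal \<dots> = (\<Sum>b\<in>?R. ennreal (1 / r * exp (r * t\<^sup>2 / 2 * (s b x)\<^sup>2)))"
      by (rule sum_ennreal[symmetric]) simp
    also have "\<dots> = (\<Sum>b\<in>?R. ennreal (1 / r) * ennreal (exp (r * t\<^sup>2 / 2 * (s b x)\<^sup>2)))"
      by (intro sum.cong refl ennreal_mult) auto
    finally show "(\<integral>\<^sup>+ y. ?f (merge ?I ?R (x, y)) \<partial>prod_law ?R)
        \<le> (\<Sum>b\<in>?R. ennreal (1 / r) * ennreal (exp (r * t\<^sup>2 / 2 * (s b x)\<^sup>2)))" .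
  qed
  also have "\<dots> = (\<Sum>b\<in>?R. ennreal (1 / r) * (\<integral>\<^sup>+ x. ennreal (exp (r * t\<^sup>2 / 2 * (s b x)\<^sup>2)) \<partial>prod_law ?I))"
    by (subst nn_integral_sum) (auto simp: nn_integral_cmult)
  also have "\<dots> \<le> (\<Sum>b\<in>?R. ennreal (1 / r) * ennreal (1 / sqrt (1 - t\<^sup>2 * real (l * r))))"
  proof (intro sum_mono mult_left_mono)
    fix b assume b: "b \<in> ?R"
    have "(\<Sum>i\<in>?I. (if i < l then \<tau> (i, b) else 0)\<^sup>2) = (\<Sum>i<l. 1)"
    proof (rule sum.mono_neutral_cong_right)
      fix i assume "i \<in> {..<l}"
      then show "(if i < l then \<tau> (i, b) else 0)\<^sup>2 = 1"
        using PiE_mem[OF \<tau>[unfolded signs_def], of "(i, b)"] b by auto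
    qed (use LI in auto)
    then have c: "(\<Sum>i\<in>?I. (if i < l then \<tau> (i, b) else 0)\<^sup>2) \<le> real l" by simp
    have e: "2 * (r * t\<^sup>2 / 2) * real l = t\<^sup>2 * real (l * r)" by simp
    have "(\<integral>\<^sup>+ x. ennreal (exp (r * t\<^sup>2 / 2 * (s b x)\<^sup>2)) \<partial>prod_law ?I)
        \<le> ennreal (1 / sqrt (1 - 2 * (r * t\<^sup>2 / 2) * real l))"
      unfolding s_def using t by (intro square_mgf c) (simp_all add: mult_ac)
    then show "(\<integral>\<^sup>+ x. ennreal (exp (r * t\<^sup>2 / 2 * (s b x)\<^sup>2)) \<partial>prod_law ?I)
        \<le> ennreal (1 / sqrt (1 - t\<^sup>2 * real (l * r)))" unfolding e .
  qed simp
  also have "\<dots> = ennreal (1 / sqrt (1 - t\<^sup>2 * real (l * r)))"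
  proof -
    have "(\<Sum>b\<in>?R. ennreal (1 / r) * E) = E" for E :: ennreal
    proof -
      have "(\<Sum>b\<in>?R. ennreal (1 / r) * E) = (of_nat r * ennreal (1 / r)) * E" by (simp add: mult.assoc)
      also have "of_nat r * ennreal (1 / r) = 1"
        using r by (simp add: ennreal_of_nat_eq_real_of_nat ennreal_mult[symmetric])
      finally show ?thesis by simp
    qed
    then show ?thesis .
  qed
  also have "\<dots> \<le> ennreal (exp (t\<^sup>2 * real (l * r)))"
    by (intro ennreal_leI inverse_sqrt_le_exp) (use t in auto)
  finally show ?thesis .
qed

lemma bipartite_sign_family:
  assumes l: "l \<ge> 1" and r: "r \<ge> 1" and lr: "l + r \<le> d"
  shows "sign_family (prod_law {..<d}) ({..<l} \<times> {l..<l + r}) (\<lambda>p x. x (fst p) * x (snd p))"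
proof -
  interpret P: prob_space "prod_law {..<d}" by (rule prob_space_prod_law)
  let ?J = "{..<l} \<times> {l..<l + r}"
  have lt: "fst p < d" "snd p < d" "fst p < l" "l \<le> snd p" if "p \<in> ?J" for p using that lr by auto
  show ?thesis
  proof unfold_locales
    show "(\<lambda>x. x (fst p) * x (snd p)) \<in> borel_measurable (prod_law {..<d})" if "p \<in> ?J" for p
      by (intro borel_measurable_times component_measurable) (use lt[OF that] in auto)
    show "has_bochner_integral (prod_law {..<d}) (\<lambda>x. x (fst p) * x (snd p)) 0" if "p \<in> ?J" for p
    proof -
      let ?e = "\<lambda>i. unit_exp (fst p) i + unit_exp (snd p) i"
      have "has_bochner_integral (prod_law {..<d}) (\<lambda>x. \<Prod>i<d. x i ^ ?e i) (if \<exists>i<d. ?e i = 1 then 0 else 1)"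
        by (rule monomial_moment) (simp add: unit_exp_def)
      moreover have "?e (fst p) = 1" using lt[OF that] by (simp add: unit_exp_def)
      then have "\<exists>i<d. ?e i = 1" using lt(1)[OF that] by blast
      ultimately show ?thesis using lt[OF that] by (simp add: power_add prod.distrib prod_unit_exp)
    qed
    show "has_bochner_integral (prod_law {..<d}) (\<lambda>x. x (fst p) * x (snd p) * (x (fst q) * x (snd q))) (if p = q then 1 else 0)"
      if pq: "p \<in> ?J" "q \<in> ?J" for p q
    proof -
      note P = lt[OF pq(1)] and Q = lt[OF pq(2)]
      let ?e = "\<lambda>i. unit_exp (fst p) i + unit_exp (snd p) i + (unit_exp (fst q) i + unit_exp (snd q) i)"
      have m: "has_bochner_integral (prod_law {..<d}) (\<lambda>x. \<Prod>i<d. x i ^ ?e i) (if \<exists>i<d. ?e i = 1 then 0 else 1)"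
        by (rule monomial_moment) (use P Q in \<open>auto simp: unit_exp_def\<close>)
      have "(\<exists>i<d. ?e i = 1) \<longleftrightarrow> p \<noteq> q"
      proof
        assume "\<exists>i<d. ?e i = 1"
        then show "p \<noteq> q" by (auto simp: unit_exp_def split: if_splits)
      next
        assume "p \<noteq> q"
        then consider "fst p \<noteq> fst q" | "snd p \<noteq> snd q" by (auto simp: prod_eq_iff)
        then show "\<exists>i<d. ?e i = 1"
        proof cases
          case 1
          then have "?e (fst p) = 1" using P Q by (auto simp: unit_exp_def)
          then show ?thesis using P by blast
        next
          case 2
          then have "?e (snd p) = 1" using P Q by (auto simp: unit_exp_def)
          then show ?thesis using P by blast
        qed
      qed
      then have v: "(if \<exists>i<d. ?e i = 1 then 0 else 1 :: real) = (if p = q then 1 else 0)" by simp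
      show ?thesis using m[unfolded v] P Q by (simp add: power_add prod.distrib prod_unit_exp)
    qed
    show "(\<integral>\<^sup>+ x. ennreal (exp (t * (\<Sum>p\<in>?J. \<tau> p * (x (fst p) * x (snd p))))) \<partial>prod_law {..<d})
        \<le> ennreal (exp (t\<^sup>2 * real (card ?J)))"
      if "\<tau> \<in> signs ?J" "t\<^sup>2 * real (card ?J) \<le> 1 / 2" for \<tau> t
      using bipartite_mgf[OF l r lr that(1), of t] that(2) by (simp add: card_cartesian_product)
    have "(0, l) \<in> ?J" using l r by auto
    then show "?J \<noteq> {}" by blast
  qed simp
qed

end

section \<open>Lower bounds for normal and Ising models\<close>

lemma graphs_nonempty:
  assumes "m \<le> d choose 2"
  shows "graphs d m \<noteq> {}"
  using card_graphs[of d m] assms by (metis binomial_eq_0_iff card.empty not_le)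

definition bipartite_edges :: "nat \<Rightarrow> nat \<Rightarrow> nat set set" where
  "bipartite_edges l r = (\<lambda>(a, b). {a, b}) ` ({..<l} \<times> {l..<l + r})"

lemma inj_on_bipartite: "inj_on (\<lambda>(a, b). {a, b}) ({..<l} \<times> {l..<l + r})" for l r :: nat
  by (rule inj_onI) (auto simp: doubleton_eq_iff)

text \<open>Edges of weight \<open>0\<close> fill up the complete bipartite graph to exactly \<open>m\<close> edges.\<close>

lemma graph_containing_bipartite:
  assumes "l + r \<le> d" "l * r \<le> m" "m \<le> d choose 2"
  obtains E where "E \<in> graphs d m" "bipartite_edges l r \<subseteq> E"
proof -
  let ?C = "{e. e \<subseteq> {..<d} \<and> card e = 2}"
  have fC: "finite ?C" by (rule finite_subset[of _ "Pow {..<d}"]) auto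
  have "card ?C = d choose 2" using n_subsets[of "{..<d}" 2] by simp
  moreover have "card (bipartite_edges l r) = l * r"
    unfolding bipartite_edges_def by (subst card_image[OF inj_on_bipartite]) (simp add: card_cartesian_product)
  moreover have "bipartite_edges l r \<subseteq> ?C"
    using assms(1) by (auto simp: bipartite_edges_def card_insert_if)
  ultimately obtain E where "bipartite_edges l r \<subseteq> E" "E \<subseteq> ?C" "card E = m"
    using exists_subset_between[of "bipartite_edges l r" m ?C] fC assms by auto
  then show ?thesis using that[of E] by (auto simp: graphs_def)
qed


abbreviation std_normal :: "real measure" where
  "std_normal \<equiv> density lborel (\<lambda>x. ennreal (std_normal_density x))"

lemma subgaussian_std_normal: "subgaussian_product std_normal"
proof -
  interpret prob_space std_normal by (rule prob_space_normal_density) simp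
  show ?thesis
  proof
    fix t :: real
    have e: "std_normal_density x * exp (t * x) = 1 / sqrt (2 * pi) * exp (- (1 * (x - 0)\<^sup>2) / 2 + t * (x - 0))" for x
      unfolding exp_add by (simp add: normal_density_def)
    have "(\<integral>\<^sup>+ x. ennreal (exp (t * x)) \<partial>std_normal) = (\<integral>\<^sup>+ x. ennreal (std_normal_density x * exp (t * x)) \<partial>lborel)"
      by (subst nn_integral_density) (auto simp: ennreal_mult)
    also have "\<dots> = (\<integral>\<^sup>+ x. ennreal (1 / sqrt (2 * pi)) * ennreal (exp (- (1 * (x - 0)\<^sup>2) / 2 + t * (x - 0))) \<partial>lborel)"
      unfolding e by (rule nn_integral_cong, rule ennreal_mult) auto
    also have "\<dots> = ennreal (1 / sqrt (2 * pi)) * ennreal (sqrt (2 * pi / 1) * exp (t\<^sup>2 / (2 * 1)))"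
    proof -
      have g: "(\<integral>\<^sup>+ x. ennreal (exp (- (1 * (x - 0)\<^sup>2) / 2 + t * (x - 0))) \<partial>lborel)
          = ennreal (sqrt (2 * pi / 1) * exp (t\<^sup>2 / (2 * 1)))" by (rule nn_integral_gaussian_1d) simp
      show ?thesis by (subst nn_integral_cmult) (simp_all only: g, measurable)
    qed
    also have "\<dots> = ennreal (exp (t\<^sup>2 / 2))" by (simp add: ennreal_mult[symmetric])
    finally show "(\<integral>\<^sup>+ x. ennreal (exp (t * x)) \<partial>std_normal) \<le> ennreal (exp (t\<^sup>2 / 2))" by simp
  next
    show "has_bochner_integral std_normal (\<lambda>x. x) 0"
      using std_normal_moment_odd[of 0] by (intro has_bochner_integral_density) auto
    show "has_bochner_integral std_normal (\<lambda>x. x\<^sup>2) 1"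
      using std_normal_moment_even[of 1] by (intro has_bochner_integral_density) auto
  qed auto
qed

definition std_mvn :: "nat \<Rightarrow> (nat \<Rightarrow> real) \<Rightarrow> real" where
  "std_mvn d x = (\<Prod>i<d. std_normal_density (x i))"

lemma std_mvn_eq: "std_mvn d x = (1 / sqrt (2 * pi)) ^ d * exp (- (\<Sum>i<d. (x i)\<^sup>2) / 2)"
  by (simp add: std_mvn_def normal_density_def prod.distrib exp_sum[symmetric] sum_negf sum_divide_distrib prod_dividef power_one_over)

lemma std_mvn_measurable [measurable]: "std_mvn d \<in> borel_measurable (lborel_pow d)"
  unfolding std_mvn_def by measurable

lemma density_std_mvn: "density (lborel_pow d) (\<lambda>x. ennreal (std_mvn d x)) = PiM {..<d} (\<lambda>_. std_normal)"
proof -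
  have "prob_space std_normal" by (rule prob_space_normal_density) simp
  then have "PiM {..<d} (\<lambda>_. std_normal) = density (lborel_pow d) (\<lambda>x. \<Prod>i<d. ennreal (std_normal_density (x i)))"
    by (intro PiM_density) (auto intro: prob_space_imp_sigma_finite sigma_finite_lborel)
  also have "(\<lambda>x. \<Prod>i<d. ennreal (std_normal_density (x i))) = (\<lambda>x. ennreal (std_mvn d x))"
    by (simp add: std_mvn_def prod_ennreal fun_eq_iff)
  finally show ?thesis by simp
qed

lemma prob_density_std_mvn: "prob_density (lborel_pow d) (std_mvn d)"
proof -
  interpret P: prob_space "density (lborel_pow d) (\<lambda>x. ennreal (std_mvn d x))"
    unfolding density_std_mvn by (intro prob_space_PiM prob_space_normal_density) simp
  show ?thesis using P.emeasure_space_1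
    by (auto simp: prob_density_def emeasure_density std_mvn_def intro!: prod_nonneg cong: nn_integral_cong_simp)
qed

lemma normal_class_member:
  assumes E: "E \<in> graphs d m" and K: "pos_def_mat d K"
    and zero: "\<And>i j. i < d \<Longrightarrow> j < d \<Longrightarrow> i \<noteq> j \<Longrightarrow> {i, j} \<notin> E \<Longrightarrow> K $$ (i, j) = 0"
  shows "\<exists>f\<in>normal_class d m. prob_density (lborel_pow d) f \<and>
    (\<exists>c. \<forall>x. f x = c * exp (- quad_form d K (\<lambda>i. x i - \<mu> i) / 2))"
proof -
  let ?f = "mvn_density d (Matrix.vec d \<mu>) (inv_mat K)"
  note i = pos_def_inverse(4)[OF K] inv_mat_involution[OF K]
  have "?f \<in> normal_graph_class d E"
    unfolding normal_graph_class_def using i zero by (auto intro!: exI[of _ "Matrix.vec d \<mu>"] exI[of _ "inv_mat K"])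
  then have "?f \<in> normal_class d m" using E by (auto simp: normal_class_def)
  moreover have "prob_density (lborel_pow d) ?f" by (rule prob_density_mvn) (use i in auto)
  moreover have "\<exists>c. \<forall>x. ?f x = c * exp (- quad_form d K (\<lambda>i. x i - \<mu> i) / 2)"
  proof -
    have "quad_form d K (\<lambda>i. x i - Matrix.vec d \<mu> $ i) = quad_form d K (\<lambda>i. x i - \<mu> i)" for x
      unfolding quad_form_def by (intro sum.cong) auto
    then have "?f x = exp (- quad_form d K (\<lambda>i. x i - \<mu> i) / 2) / ((2 * pi) powr (real d / 2) / sqrt (Determinant.det K))" for x
      using mvn_density_eq[of "Matrix.vec d \<mu>" d "inv_mat K" x] i by simp
    then show ?thesis by (intro exI[of _ "1 / ((2 * pi) powr (real d / 2) / sqrt (Determinant.det K))"]) simp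
  qed
  ultimately show ?thesis by blast
qed

text \<open>Expanding the square in the exponent separates the reference density from the tilt.\<close>

lemma std_mvn_absorb:
  assumes "\<exists>c. \<forall>x. f x = c * exp (- q x / 2)" and "\<And>x. q x = (\<Sum>i<d. (x i)\<^sup>2) - 2 * h x + a"
  shows "\<exists>c. \<forall>x\<in>space (lborel_pow d). f x = c * (std_mvn d x * exp (h x))"
proof -
  obtain c where c: "\<And>x. f x = c * exp (- q x / 2)" using assms(1) by blast
  let ?b = "(1 / sqrt (2 * pi)) ^ d"
  have b: "?b \<noteq> 0" by simp
  have "f x = (c * exp (- a / 2) / ?b) * (std_mvn d x * exp (h x))" for x
  proof -
    have "- q x / 2 = - a / 2 + (- (\<Sum>i<d. (x i)\<^sup>2) / 2 + h x)" by (simp add: assms(2) field_simps)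
    then have "exp (- q x / 2) = exp (- a / 2) * (exp (- (\<Sum>i<d. (x i)\<^sup>2) / 2) * exp (h x))" by (simp only: exp_add)
    then show ?thesis unfolding c std_mvn_eq using b by simp
  qed
  then show ?thesis by blast
qed

lemma quad_form_one: "quad_form d (1\<^sub>m d) z = (\<Sum>i<d. (z i)\<^sup>2)"
proof -
  have "quad_form d (1\<^sub>m d) z = (\<Sum>i<d. \<Sum>j<d. if i = j then (z i)\<^sup>2 else 0)"
    unfolding quad_form_def by (intro sum.cong) (auto simp: power2_eq_square)
  then show ?thesis by simp
qed

lemma pos_def_one: "pos_def_mat d (1\<^sub>m d)"
  unfolding pos_def_mat_iff quad_form_one
proof (intro conjI allI impI)
  fix z :: "nat \<Rightarrow> real" assume "\<exists>i<d. z i \<noteq> 0"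
  then obtain i where "i < d" "z i \<noteq> 0" by blast
  then show "0 < (\<Sum>i<d. (z i)\<^sup>2)" by (intro sum_pos2[of _ i]) auto
qed auto

text \<open>Shifting the means of independent standard normal coordinates by \<open>\<epsilon> * \<tau> i\<close> tilts their law by
the linear statistics \<open>x i\<close>.\<close>

theorem normal_lower_bound_mean:
  assumes d: "d \<ge> 1" and m: "m \<le> d choose 2" and n: "n > 0"
  shows "ennreal (lower_const * min 1 (sqrt (real d / real n))) \<le> minimax_risk (lborel_pow d) n (normal_class d m)"
proof -
  interpret subgaussian_product std_normal d by (rule subgaussian_std_normal)
  obtain E where E: "E \<in> graphs d m" using graphs_nonempty[OF m] by blast
  have "ennreal (lower_const * min 1 (sqrt (real (card {..<d}) / real n))) \<le> minimax_risk (lborel_pow d) n (normal_class d m)"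
  proof (rule sign_family_minimax_risk_ge[OF sigma_finite_lborel_pow prob_density_std_mvn _ n])
    show "sign_family (density (lborel_pow d) (\<lambda>x. ennreal (std_mvn d x))) {..<d} (\<lambda>a x. x a)"
      unfolding density_std_mvn by (rule linear_sign_family[OF d])
    fix \<epsilon> :: real and \<tau> :: "nat \<Rightarrow> real"
    obtain f where f: "f \<in> normal_class d m" "prob_density (lborel_pow d) f"
      "\<exists>c. \<forall>x. f x = c * exp (- quad_form d (1\<^sub>m d) (\<lambda>i. x i - \<epsilon> * \<tau> i) / 2)"
      using normal_class_member[OF E pos_def_one, of "\<lambda>i. \<epsilon> * \<tau> i"] by auto
    have "\<exists>c. \<forall>x\<in>space (lborel_pow d). f x = c * (std_mvn d x * exp (\<epsilon> * (\<Sum>j<d. \<tau> j * x j)))"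
    proof (rule std_mvn_absorb[OF f(3)])
      show "quad_form d (1\<^sub>m d) (\<lambda>i. x i - \<epsilon> * \<tau> i)
          = (\<Sum>i<d. (x i)\<^sup>2) - 2 * (\<epsilon> * (\<Sum>j<d. \<tau> j * x j)) + (\<Sum>i<d. (\<epsilon> * \<tau> i)\<^sup>2)" for x
        unfolding quad_form_one sum_distrib_left sum_subtractf[symmetric] sum.distrib[symmetric]
        by (intro sum.cong) (auto simp: power2_eq_square algebra_simps)
    qed
    then show "\<exists>f\<in>normal_class d m. prob_density (lborel_pow d) f \<and>
        (\<exists>c. \<forall>x\<in>space (lborel_pow d). f x = c * (std_mvn d x * exp (\<epsilon> * (\<Sum>j<d. \<tau> j * x j))))"
      using f by blast
  qed
  then show ?thesis by simp
qed

definition bipartite_weight :: "nat \<Rightarrow> nat \<Rightarrow> (nat \<times> nat \<Rightarrow> real) \<Rightarrow> nat \<Rightarrow> nat \<Rightarrow> real" where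
  "bipartite_weight l r \<tau> i j = (if (i, j) \<in> {..<l} \<times> {l..<l + r} then \<tau> (i, j) else 0)"

definition bipartite_precision :: "nat \<Rightarrow> nat \<Rightarrow> nat \<Rightarrow> real \<Rightarrow> (nat \<times> nat \<Rightarrow> real) \<Rightarrow> real mat" where
  "bipartite_precision d l r \<epsilon> \<tau> = mat d d (\<lambda>(i, j).
     (if i = j then 1 else 0) - \<epsilon> * bipartite_weight l r \<tau> i j - \<epsilon> * bipartite_weight l r \<tau> j i)"

lemma quad_form_bipartite:
  assumes "l + r \<le> d"
  shows "quad_form d (bipartite_precision d l r \<epsilon> \<tau>) z
    = (\<Sum>i<d. (z i)\<^sup>2) - 2 * (\<epsilon> * (\<Sum>p\<in>{..<l} \<times> {l..<l + r}. \<tau> p * (z (fst p) * z (snd p))))"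
proof -
  let ?w = "bipartite_weight l r \<tau>" and ?S = "\<Sum>p\<in>{..<l} \<times> {l..<l + r}. \<tau> p * (z (fst p) * z (snd p))"
  have S: "(\<Sum>i<d. \<Sum>j<d. ?w i j * (z i * z j)) = ?S"
  proof -
    have "(\<Sum>i<d. \<Sum>j<d. ?w i j * (z i * z j)) = (\<Sum>p\<in>{..<d} \<times> {..<d}. ?w (fst p) (snd p) * (z (fst p) * z (snd p)))"
      by (simp add: sum.cartesian_product case_prod_beta')
    also have "\<dots> = ?S"
      by (rule sum.mono_neutral_cong_right) (use assms in \<open>auto simp: bipartite_weight_def\<close>)
    finally show ?thesis .
  qed
  have S': "(\<Sum>i<d. \<Sum>j<d. ?w j i * (z i * z j)) = ?S"
    by (subst sum.swap) (simp add: S[symmetric] mult.commute)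
  have I: "(\<Sum>i<d. \<Sum>j<d. (if i = j then 1 else 0) * (z i * z j)) = (\<Sum>i<d. (z i)\<^sup>2)"
    by (intro sum.cong refl) (simp add: power2_eq_square if_distrib[of "\<lambda>c. c * _"] cong: if_cong)
  have "quad_form d (bipartite_precision d l r \<epsilon> \<tau>) z
      = (\<Sum>i<d. \<Sum>j<d. (if i = j then 1 else 0) * (z i * z j) - \<epsilon> * (?w i j * (z i * z j)) - \<epsilon> * (?w j i * (z i * z j)))"
    unfolding quad_form_def by (intro sum.cong refl) (simp add: bipartite_precision_def algebra_simps)
  also have "\<dots> = (\<Sum>i<d. (z i)\<^sup>2) - \<epsilon> * ?S - \<epsilon> * ?S"
    by (simp only: sum_subtractf sum_distrib_left[symmetric] I S S')
  finally show ?thesis by simp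
qed

text \<open>By the Cauchy-Schwarz inequality the off-diagonal part is at most \<open>2 * \<epsilon> * sqrt (l * r)\<close> times the
product of the norms of the two halves of \<open>z\<close>.\<close>

lemma pos_def_bipartite:
  assumes lr: "l + r \<le> d" and \<tau>: "\<tau> \<in> signs ({..<l} \<times> {l..<l + r})" and \<epsilon>: "\<epsilon>\<^sup>2 * real (l * r) \<le> 1 / 4"
  shows "pos_def_mat d (bipartite_precision d l r \<epsilon> \<tau>)"
  unfolding pos_def_mat_iff
proof (intro conjI allI impI)
  fix z :: "nat \<Rightarrow> real" assume "\<exists>i<d. z i \<noteq> 0"
  then obtain i where i: "i < d" "z i \<noteq> 0" by blast
  define N where "N = (\<Sum>i<d. (z i)\<^sup>2)"
  have N: "N > 0" unfolding N_def using i by (intro sum_pos2[of _ i]) auto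
  let ?J = "{..<l} \<times> {l..<l + r}"
  let ?S = "\<Sum>p\<in>?J. \<tau> p * (z (fst p) * z (snd p))"
  define A where "A = (\<Sum>a<l. (z a)\<^sup>2)"
  define B where "B = (\<Sum>b\<in>{l..<l + r}. (z b)\<^sup>2)"
  have AB: "0 \<le> A" "0 \<le> B" "A + B \<le> N"
  proof -
    have "A + B = (\<Sum>i\<in>{..<l} \<union> {l..<l + r}. (z i)\<^sup>2)"
      unfolding A_def B_def by (rule sum.union_disjoint[symmetric]) auto
    also have "\<dots> \<le> N" unfolding N_def using lr by (intro sum_mono2) auto
    finally show "A + B \<le> N" .
  qed (auto simp: A_def B_def intro: sum_nonneg)
  have "?S\<^sup>2 \<le> (\<Sum>p\<in>?J. (\<tau> p * (z (fst p) * z (snd p)))\<^sup>2) * real (card ?J)"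
    by (rule sum_squared_le_sum_of_squares)
  also have "(\<Sum>p\<in>?J. (\<tau> p * (z (fst p) * z (snd p)))\<^sup>2) = (\<Sum>p\<in>?J. (z (fst p))\<^sup>2 * (z (snd p))\<^sup>2)"
  proof (rule sum.cong)
    fix p assume p: "p \<in> ?J"
    have "(\<tau> p)\<^sup>2 = 1" using PiE_mem[OF \<tau>[unfolded signs_def] p] by auto
    then show "(\<tau> p * (z (fst p) * z (snd p)))\<^sup>2 = (z (fst p))\<^sup>2 * (z (snd p))\<^sup>2" by (simp add: power_mult_distrib)
  qed simp
  also have "\<dots> = A * B" unfolding A_def B_def by (simp add: sum_product sum.cartesian_product case_prod_beta')
  finally have S2: "?S\<^sup>2 \<le> A * B * real (l * r)" by (simp add: card_cartesian_product)
  have "(2 * (\<epsilon> * ?S))\<^sup>2 = 4 * \<epsilon>\<^sup>2 * ?S\<^sup>2" by (simp add: power_mult_distrib)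
  also have "\<dots> \<le> 4 * \<epsilon>\<^sup>2 * (A * B * real (l * r))" using S2 by (intro mult_left_mono) auto
  also have "\<dots> = 4 * (\<epsilon>\<^sup>2 * real (l * r)) * (A * B)" by (simp only: mult_ac)
  also have "\<dots> \<le> 1 * (A * B)" using \<epsilon> AB by (intro mult_right_mono mult_nonneg_nonneg) auto
  also have "\<dots> \<le> ((A + B) / 2)\<^sup>2" using zero_le_power2[of "A - B"] by (simp add: power2_eq_square field_simps)
  also have "\<dots> \<le> (N / 2)\<^sup>2" using AB by (intro power_mono) auto
  finally have "\<bar>2 * (\<epsilon> * ?S)\<bar> \<le> \<bar>N / 2\<bar>" by (simp only: abs_le_square_iff)
  then have "\<bar>2 * (\<epsilon> * ?S)\<bar> \<le> N / 2" using N by linarith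
  then show "0 < quad_form d (bipartite_precision d l r \<epsilon> \<tau>) z"
    unfolding quad_form_bipartite[OF lr] N_def[symmetric] using N by linarith
qed (auto simp: bipartite_precision_def)

text \<open>The entries \<open>- \<epsilon> * \<tau> (a, b)\<close> of the precision matrix tilt the standard normal law by the
products \<open>x a * x b\<close>.\<close>

theorem normal_lower_bound_edges:
  assumes l: "l \<ge> 1" and r: "r \<ge> 1" and lr: "l + r \<le> d" and lrm: "l * r \<le> m" and m: "m \<le> d choose 2" and n: "n > 0"
  shows "ennreal (lower_const * min 1 (sqrt (real (l * r) / real n))) \<le> minimax_risk (lborel_pow d) n (normal_class d m)"
proof -
  interpret subgaussian_product std_normal d by (rule subgaussian_std_normal)
  let ?J = "{..<l} \<times> {l..<l + r}"
  obtain E where E: "E \<in> graphs d m" "bipartite_edges l r \<subseteq> E" by (rule graph_containing_bipartite[OF lr lrm m])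
  have cJ: "card ?J = l * r" by (simp add: card_cartesian_product)
  have "ennreal (lower_const * min 1 (sqrt (real (card ?J) / real n))) \<le> minimax_risk (lborel_pow d) n (normal_class d m)"
  proof (rule sign_family_minimax_risk_ge[OF sigma_finite_lborel_pow prob_density_std_mvn _ n])
    show "sign_family (density (lborel_pow d) (\<lambda>x. ennreal (std_mvn d x))) ?J (\<lambda>p x. x (fst p) * x (snd p))"
      unfolding density_std_mvn by (rule bipartite_sign_family[OF l r lr])
    fix \<epsilon> :: real and \<tau> :: "nat \<times> nat \<Rightarrow> real"
    assume \<epsilon>: "\<epsilon>\<^sup>2 * real (card ?J) \<le> 1 / 4" and \<tau>: "\<tau> \<in> signs ?J"
    let ?K = "bipartite_precision d l r \<epsilon> \<tau>"
    have zero: "?K $$ (i, j) = 0" if ij: "i < d" "j < d" "i \<noteq> j" "{i, j} \<notin> E" for i j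
    proof -
      have "(i, j) \<notin> ?J" "(j, i) \<notin> ?J"
        using ij(4) E(2) by (force simp: bipartite_edges_def insert_commute)+
      then have "bipartite_weight l r \<tau> i j = 0" "bipartite_weight l r \<tau> j i = 0"
        by (simp_all only: bipartite_weight_def if_False)
      then show ?thesis using ij by (simp add: bipartite_precision_def)
    qed
    obtain f where f: "f \<in> normal_class d m" "prob_density (lborel_pow d) f"
      "\<exists>c. \<forall>x. f x = c * exp (- quad_form d ?K (\<lambda>i. x i - 0) / 2)"
      using normal_class_member[OF E(1) pos_def_bipartite[OF lr \<tau>] zero, of "\<lambda>_. 0"] \<epsilon> unfolding cJ by blast
    have "\<exists>c. \<forall>x\<in>space (lborel_pow d). f x = c * (std_mvn d x * exp (\<epsilon> * (\<Sum>p\<in>?J. \<tau> p * (x (fst p) * x (snd p)))))"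
      by (rule std_mvn_absorb[OF f(3), where a = 0]) (simp add: quad_form_bipartite[OF lr])
    then show "\<exists>f\<in>normal_class d m. prob_density (lborel_pow d) f \<and>
        (\<exists>c. \<forall>x\<in>space (lborel_pow d). f x = c * (std_mvn d x * exp (\<epsilon> * (\<Sum>p\<in>?J. \<tau> p * (x (fst p) * x (snd p))))))"
      using f by blast
  qed
  then show ?thesis unfolding cJ .
qed


definition coin_density :: "real \<Rightarrow> real" where
  "coin_density x = 1 / 2"

abbreviation rademacher :: "real measure" where
  "rademacher \<equiv> density (count_space {-1, 1}) (\<lambda>x. ennreal (coin_density x))"

lemma nn_integral_rademacher:
  assumes "\<And>x. 0 \<le> f x"
  shows "(\<integral>\<^sup>+ x. ennreal (f x) \<partial>rademacher) = ennreal ((f (-1) + f 1) / 2)"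
proof -
  have c: "0 \<le> coin_density x" for x by (simp add: coin_density_def)
  have "(\<integral>\<^sup>+ x. ennreal (f x) \<partial>rademacher) = (\<integral>\<^sup>+ x. ennreal (coin_density x * f x) \<partial>count_space {-1, 1})"
    using assms c by (subst nn_integral_density) (auto simp: ennreal_mult)
  also have "\<dots> = ennreal (coin_density (-1) * f (-1)) + ennreal (coin_density 1 * f 1)"
    by (subst nn_integral_count_space_finite) auto
  also have "\<dots> = ennreal (coin_density (-1) * f (-1) + coin_density 1 * f 1)"
    using assms c by (intro ennreal_plus[symmetric] mult_nonneg_nonneg)
  also have "coin_density (-1) * f (-1) + coin_density 1 * f 1 = (f (-1) + f 1) / 2"
    by (simp add: coin_density_def)
  finally show ?thesis .
qed

lemma prob_space_rademacher: "prob_space rademacher"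
proof
  have "emeasure rademacher (space rademacher) = (\<integral>\<^sup>+ x. ennreal 1 \<partial>rademacher)" by simp
  also have "\<dots> = 1" by (subst nn_integral_rademacher) auto
  finally show "emeasure rademacher (space rademacher) = 1" .
qed

lemma subgaussian_rademacher: "subgaussian_product rademacher"
proof -
  interpret prob_space rademacher by (rule prob_space_rademacher)
  have bi: "has_bochner_integral rademacher f ((f (-1) + f 1) / 2)" for f :: "real \<Rightarrow> real"
  proof (rule has_bochner_integral_density)
    show "AE x in count_space {-1, 1}. 0 \<le> coin_density x" by (simp add: coin_density_def)
    show "has_bochner_integral (count_space {-1, 1}) (\<lambda>x. coin_density x *\<^sub>R f x) ((f (-1) + f 1) / 2)"
      by (simp add: coin_density_def has_bochner_integral_iff integrable_count_space lebesgue_integral_count_space_finite add_divide_distrib)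
  qed auto
  show ?thesis
  proof
    show "(\<integral>\<^sup>+ x. ennreal (exp (t * x)) \<partial>rademacher) \<le> ennreal (exp (t\<^sup>2 / 2))" for t
      using cosh_le_exp_square[of t] by (subst nn_integral_rademacher) (auto intro!: ennreal_leI simp: add.commute)
    show "has_bochner_integral rademacher (\<lambda>x. x) 0" using bi[of "\<lambda>x. x"] by simp
    show "has_bochner_integral rademacher (\<lambda>x. x\<^sup>2) 1" using bi[of "\<lambda>x. x\<^sup>2"] by simp
  qed auto
qed

lemma density_uniform_cube:
  "density (count_space (cube d)) (\<lambda>_. ennreal ((1 / 2) ^ d)) = PiM {..<d} (\<lambda>_. rademacher)"
proof -
  have "PiM {..<d} (\<lambda>_. rademacher)
      = density (PiM {..<d} (\<lambda>_. count_space {-1, 1})) (\<lambda>x. \<Prod>i<d. ennreal (coin_density (x i)))"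
    using prob_space_imp_sigma_finite[OF prob_space_rademacher]
    by (intro PiM_density) (auto intro: sigma_finite_measure_count_space_finite)
  also have "PiM {..<d} (\<lambda>_. count_space {-1, 1 :: real}) = count_space (cube d)"
    unfolding cube_def by (rule count_space_PiM_finite) auto
  also have "(\<lambda>x. \<Prod>i<d. ennreal (coin_density (x i))) = (\<lambda>_ :: nat \<Rightarrow> real. ennreal ((1 / 2) ^ d))"
    by (subst prod_ennreal) (simp_all add: coin_density_def)
  finally show ?thesis by simp
qed

lemma prob_density_uniform_cube: "prob_density (count_space (cube d)) (\<lambda>_. (1 / 2) ^ d)"
proof -
  have "card (cube d) = 2 ^ d" by (simp add: cube_def card_PiE flip: numeral_2_eq_2)
  then show ?thesis
    by (subst prob_density_count_space[OF finite_cube]) (auto simp: power_one_over)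
qed

lemma ising_class_member:
  assumes E: "E \<in> graphs d m"
  shows "ising_pmf d E w h \<in> ising_class d m" "prob_density (count_space (cube d)) (ising_pmf d E w h)"
    "\<exists>c. \<forall>x\<in>space (count_space (cube d)). ising_pmf d E w h x =
        c * ((1 / 2) ^ d * exp ((\<Sum>e\<in>E. w e * (\<Prod>i\<in>e. x i)) + (\<Sum>i<d. h i * x i)))"
proof -
  show "ising_pmf d E w h \<in> ising_class d m" using E by (auto simp: ising_class_def ising_graph_class_def)
  show "prob_density (count_space (cube d)) (ising_pmf d E w h)" by (rule prob_density_ising)
  show "\<exists>c. \<forall>x\<in>space (count_space (cube d)). ising_pmf d E w h x =
        c * ((1 / 2) ^ d * exp ((\<Sum>e\<in>E. w e * (\<Prod>i\<in>e. x i)) + (\<Sum>i<d. h i * x i)))"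
    by (intro exI[of _ "2 ^ d / (\<Sum>y\<in>cube d. ising_weight d E w h y)"])
       (simp add: ising_pmf_def ising_weight_def power_one_over)
qed

text \<open>The external field \<open>\<epsilon> * \<tau> i\<close> tilts the uniform law on the cube by the linear statistics \<open>x i\<close>.\<close>

theorem ising_lower_bound_field:
  assumes d: "d \<ge> 1" and m: "m \<le> d choose 2" and n: "n > 0"
  shows "ennreal (lower_const * min 1 (sqrt (real d / real n))) \<le> minimax_risk (count_space (cube d)) n (ising_class d m)"
proof -
  interpret subgaussian_product rademacher d by (rule subgaussian_rademacher)
  obtain E where E: "E \<in> graphs d m" using graphs_nonempty[OF m] by blast
  have "ennreal (lower_const * min 1 (sqrt (real (card {..<d}) / real n))) \<le> minimax_risk (count_space (cube d)) n (ising_class d m)"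
  proof (rule sign_family_minimax_risk_ge[OF sigma_finite_count_cube prob_density_uniform_cube _ n])
    show "sign_family (density (count_space (cube d)) (\<lambda>_. ennreal ((1 / 2) ^ d))) {..<d} (\<lambda>a x. x a)"
      unfolding density_uniform_cube by (rule linear_sign_family[OF d])
    fix \<epsilon> :: real and \<tau> :: "nat \<Rightarrow> real"
    note f = ising_class_member[OF E, of "\<lambda>_. 0" "\<lambda>i. \<epsilon> * \<tau> i"]
    have "(\<Sum>e\<in>E. 0 * (\<Prod>i\<in>e. x i)) + (\<Sum>i<d. \<epsilon> * \<tau> i * x i) = \<epsilon> * (\<Sum>j<d. \<tau> j * x j)" for x :: "nat \<Rightarrow> real"
      by (simp add: sum_distrib_left mult.assoc)
    then show "\<exists>f\<in>ising_class d m. prob_density (count_space (cube d)) f \<and>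
        (\<exists>c. \<forall>x\<in>space (count_space (cube d)). f x = c * ((1 / 2) ^ d * exp (\<epsilon> * (\<Sum>j<d. \<tau> j * x j))))"
      using f by (intro bexI[OF _ f(1)]) simp
  qed
  then show ?thesis by simp
qed

theorem ising_lower_bound_edges:
  assumes l: "l \<ge> 1" and r: "r \<ge> 1" and lr: "l + r \<le> d" and lrm: "l * r \<le> m" and m: "m \<le> d choose 2" and n: "n > 0"
  shows "ennreal (lower_const * min 1 (sqrt (real (l * r) / real n))) \<le> minimax_risk (count_space (cube d)) n (ising_class d m)"
proof -
  interpret subgaussian_product rademacher d by (rule subgaussian_rademacher)
  let ?J = "{..<l} \<times> {l..<l + r}"
  obtain E where E: "E \<in> graphs d m" "bipartite_edges l r \<subseteq> E" by (rule graph_containing_bipartite[OF lr lrm m])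
  have fE: "finite E" using E(1) by (auto simp: graphs_def intro: finite_subset[of _ "Pow {..<d}"])
  have cJ: "card ?J = l * r" by (simp add: card_cartesian_product)
  have "ennreal (lower_const * min 1 (sqrt (real (card ?J) / real n))) \<le> minimax_risk (count_space (cube d)) n (ising_class d m)"
  proof (rule sign_family_minimax_risk_ge[OF sigma_finite_count_cube prob_density_uniform_cube _ n])
    show "sign_family (density (count_space (cube d)) (\<lambda>_. ennreal ((1 / 2) ^ d))) ?J (\<lambda>p x. x (fst p) * x (snd p))"
      unfolding density_uniform_cube by (rule bipartite_sign_family[OF l r lr])
    fix \<epsilon> :: real and \<tau> :: "nat \<times> nat \<Rightarrow> real"
    define w where "w = (\<lambda>e. if e \<in> bipartite_edges l r then \<epsilon> * \<tau> (Min e, Max e) else 0)"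
    note f = ising_class_member[OF E(1), of w "\<lambda>_. 0"]
    have "(\<Sum>e\<in>E. w e * (\<Prod>i\<in>e. x i)) + (\<Sum>i<d. 0 * x i) = \<epsilon> * (\<Sum>p\<in>?J. \<tau> p * (x (fst p) * x (snd p)))" for x :: "nat \<Rightarrow> real"
    proof -
      have "(\<Sum>e\<in>E. w e * (\<Prod>i\<in>e. x i)) = (\<Sum>e\<in>bipartite_edges l r. w e * (\<Prod>i\<in>e. x i))"
        by (rule sum.mono_neutral_right[OF fE E(2)]) (simp add: w_def)
      also have "\<dots> = (\<Sum>p\<in>?J. w {fst p, snd p} * (\<Prod>i\<in>{fst p, snd p}. x i))"
        unfolding bipartite_edges_def by (subst sum.reindex[OF inj_on_bipartite]) (simp add: case_prod_beta')
      also have "\<dots> = (\<Sum>p\<in>?J. \<epsilon> * (\<tau> p * (x (fst p) * x (snd p))))"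
      proof (rule sum.cong)
        fix p assume p: "p \<in> ?J"
        then have lt: "fst p < snd p" by auto
        have "{fst p, snd p} \<in> bipartite_edges l r" unfolding bipartite_edges_def using p by (intro image_eqI[of _ _ p]) (auto simp: case_prod_beta')
        then have "w {fst p, snd p} = \<epsilon> * \<tau> p" using lt by (simp add: w_def)
        then show "w {fst p, snd p} * (\<Prod>i\<in>{fst p, snd p}. x i) = \<epsilon> * (\<tau> p * (x (fst p) * x (snd p)))" using lt by simp
      qed simp
      finally show ?thesis by (simp add: sum_distrib_left)
    qed
    then show "\<exists>f\<in>ising_class d m. prob_density (count_space (cube d)) f \<and>
        (\<exists>c. \<forall>x\<in>space (count_space (cube d)). f x = c * ((1 / 2) ^ d * exp (\<epsilon> * (\<Sum>p\<in>?J. \<tau> p * (x (fst p) * x (snd p))))))"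
      using f by (intro bexI[OF _ f(1)]) simp
  qed
  then show ?thesis unfolding cJ .
qed


section \<open>The minimax rates\<close>

text \<open>If \<open>m \<le> d\<close>, the \<open>d\<close> coordinates alone give the rate.  Otherwise half of the vertices form one
side of the bipartite graph, and the other side is as large as \<open>m\<close> and \<open>d\<close> permit; whichever of
them sets the limit, the graph has at least \<open>m / 2\<close> edges.\<close>

lemma lower_rate:
  assumes d: "d \<ge> 1" and m: "m \<le> d choose 2"
    and field: "ennreal (lower_const * min 1 (sqrt (real d / real n))) \<le> R"
    and edges: "\<And>l r. l \<ge> 1 \<Longrightarrow> r \<ge> 1 \<Longrightarrow> l + r \<le> d \<Longrightarrow> l * r \<le> m \<Longrightarrow>
      ennreal (lower_const * min 1 (sqrt (real (l * r) / real n))) \<le> R"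
  shows "ennreal (lower_const / 2 * min 1 (sqrt ((real m + real d) / real n))) \<le> R"
proof -
  have *: ?thesis if k: "real m + real d \<le> 4 * k" and R: "ennreal (lower_const * min 1 (sqrt (k / real n))) \<le> R" for k :: real
  proof -
    have "(real m + real d) / real n \<le> 2\<^sup>2 * (k / real n)"
      using divide_right_mono[OF k, of "real n"] by simp
    then have "sqrt ((real m + real d) / real n) \<le> sqrt (2\<^sup>2 * (k / real n))" by (rule real_sqrt_le_mono)
    also have "\<dots> = 2 * sqrt (k / real n)" by (simp only: real_sqrt_mult real_sqrt_abs)
    finally have "sqrt ((real m + real d) / real n) \<le> 2 * sqrt (k / real n)" .
    then have "lower_const / 2 * min 1 (sqrt ((real m + real d) / real n)) \<le> lower_const * min 1 (sqrt (k / real n))"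
    proof -
      have gen: "lower_const / 2 * min 1 a \<le> lower_const * min 1 b" if "a \<le> 2 * b" for a b :: real
        using that by (auto simp: min_def)
      show ?thesis by (rule gen) fact
    qed
    then show ?thesis using R ennreal_leI order_trans by blast
  qed
  show ?thesis
  proof (cases "m \<le> d")
    case True
    then show ?thesis using field by (intro *[of "real d"]) auto
  next
    case False
    have d2: "d \<ge> 2" using False m by (cases "d = 1") (use d in \<open>auto simp: numeral_2_eq_2\<close>)
    \<comment> \<open>the most balanced partition leaves room for \<open>m / 2\<close> edges\<close>
    define r where "r = d div 2"
    define l where "l = min (m div r) (d - r)"
    have r: "r \<ge> 1" "2 * r \<le> d" "d \<le> 2 * r + 1" using d2 by (auto simp: r_def)
    have rm: "r \<le> m" using r False by linarith
    have l1: "l \<ge> 1" using rm r unfolding l_def by (simp add: Suc_le_eq div_greater_zero_iff)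
    have lrd: "l + r \<le> d" using r unfolding l_def by linarith
    have "l * r \<le> m div r * r" unfolding l_def by (intro mult_right_mono) auto
    also have "\<dots> \<le> m" by simp
    finally have lrm: "l * r \<le> m" .
    have half: "m \<le> 2 * (l * r)"
    proof (cases "m div r \<le> d - r")
      case True
      then have lq: "l = m div r" by (simp add: l_def)
      have "m < r + l * r" unfolding lq using r by (intro dividend_less_div_times) linarith
      moreover have "1 * r \<le> l * r" using l1 by (rule mult_right_mono) simp
      ultimately show ?thesis by linarith
    next
      case False
      have "2 * m \<le> d * (d - 1)"
      proof -
        have "even (d * (d - 1))" by (cases "even d") auto
        then show ?thesis using m by (simp add: choose_two)
      qed
      also have "\<dots> \<le> 4 * ((d - r) * r)"
      proof -
        consider "d = 2 * r" | "d = 2 * r + 1" using r by linarith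
        then show ?thesis by cases (auto simp: algebra_simps)
      qed
      finally show ?thesis using False by (simp add: l_def mult.commute min_def)
    qed
    have "real m + real d \<le> 4 * real (l * r)"
    proof -
      have "m + d \<le> 4 * (l * r)" using half \<open>\<not> m \<le> d\<close> by linarith
      then have "real (m + d) \<le> real (4 * (l * r))" by (rule of_nat_mono)
      then show ?thesis by simp
    qed
    then show ?thesis by (rule *) (rule edges[OF l1 r(1) lrd lrm])
  qed
qed

theorem theorem1p4:
  shows "\<exists>c C :: real. c > 0 \<and> C > 0 \<and>
    (\<forall>d m n :: nat. d \<ge> 1 \<and> m \<le> d choose 2 \<and> n \<ge> 1 \<longrightarrow>
       ennreal (c * min 1 (sqrt ((real m + real d) / real n)))
         \<le> minimax_risk (lborel_pow d) n (normal_class d m) \<and>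
       ennreal (c * min 1 (sqrt ((real m + real d) / real n)))
         \<le> minimax_risk (count_space (cube d)) n (ising_class d m) \<and>
       (d \<ge> 2 \<longrightarrow>
         minimax_risk (lborel_pow d) n (normal_class d m)
           \<le> ennreal (C * min 1 (sqrt ((real m + real d) * ln (real d) / real n))) \<and>
         minimax_risk (count_space (cube d)) n (ising_class d m)
           \<le> ennreal (C * min 1 (sqrt ((real m + real d) * ln (real d) / real n)))))"
proof (rule exI[of _ "lower_const / 2"], rule exI[of _ 680], intro conjI allI impI; (elim conjE)?)
  fix d m n :: nat
  assume d: "1 \<le> d" and m: "m \<le> d choose 2" and n: "1 \<le> n"
  then have n0: "n > 0" by simp
  show "ennreal (lower_const / 2 * min 1 (sqrt ((real m + real d) / real n))) \<le> minimax_risk (lborel_pow d) n (normal_class d m)"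
    by (rule lower_rate[OF d m normal_lower_bound_mean[OF d m n0] normal_lower_bound_edges[OF _ _ _ _ m n0]])
  show "ennreal (lower_const / 2 * min 1 (sqrt ((real m + real d) / real n))) \<le> minimax_risk (count_space (cube d)) n (ising_class d m)"
    by (rule lower_rate[OF d m ising_lower_bound_field[OF d m n0] ising_lower_bound_edges[OF _ _ _ _ m n0]])
  assume d2: "2 \<le> d"
  show "minimax_risk (lborel_pow d) n (normal_class d m)
      \<le> ennreal (680 * min 1 (sqrt ((real m + real d) * ln (real d) / real n)))"
    by (rule normal_upper_bound[OF d2 m n])
  show "minimax_risk (count_space (cube d)) n (ising_class d m)
      \<le> ennreal (680 * min 1 (sqrt ((real m + real d) * ln (real d) / real n)))"
    by (rule ising_upper_bound[OF d2 m n])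
qed simp_all

end
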